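(* Let $m$ be an even integer with $2\le m\le n-1$. Then the only convex bodies in $\mathbb R^n$ (containing the origin in their interior) with a polynomial $m$th dual section function are ellipsoids; that is, if $K\subset\mathbb R^n$ is a convex body containing the origin in its interior and $K$ has a polynomial $m$th dual section function, then $K$ is an ellipsoid.
   Context: Ellipsoids are images of the closed Euclidean unit ball of $\mathbb R^n$ under invertible affine maps (not necessarily centered at the origin). A convex body is a compact convex subset of $\mathbb R^n$ with non-empty interior. No smoothness is assumed. For a compact set $L\subset\mathbb R^n$ that is star-shaped about the origin (for every $x\in L$ the segment $[0,x]$ lies in $L$), its radial function is $\rho_L(\theta)=\max\{a\ge 0: a\theta\in L\}$, $\theta\in S^{n-1}$. Let $K$ be a convex body in $\mathbb R^n$ containing the origin in its interior, and let $m$ be an integer with $1\le m\le n-1$. For $\xi\in S^{n-1}$ let $\xi^\perp=\{x\in\mathbb R^n:\langle x,\xi\rangle=0\}$, and for $-\rho_K(-\xi)\le t\le\rho_K(\xi)$ (so that $t\xi\in K$ and $K-t\xi$ is star-shaped about the origin) define $$A_{K,m,\xi}(t)=\frac{1}{n-1}\int_{S^{n-1}\cap\xi^\perp}\rho_{K-t\xi}^m(\theta)\,d\theta,$$ where the integration is with respect to the (unnormalized) spherical Lebesgue measure on the $(n-2)$-dimensional unit sphere $S^{n-1}\cap\xi^\perp$ (counting measure if $n=2$). This is the $m$th dual volume of the section $K\cap\{\xi^\perp+t\xi\}$ taken within the hyperplane $\xi^\perp+t\xi$ with respect to the point $t\xi$. $K$ is said to have a polynomial $m$th dual section function if there are a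 positive integer $N$ (independent of $\xi$) and continuous functions $a_0,\dots,a_N$ on $S^{n-1}$ such that for every $\xi\in S^{n-1}$, $$A_{K,m,\xi}(t)=\sum_{k=0}^N a_k(\xi)\,t^k\quad\text{for all } -\rho_K(-\xi)\le t\le\rho_K(\xi).$$ *)

theory Defs
  imports "HOL-Analysis.Analysis"
begin

definition convex_body :: "'a::euclidean_space set \<Rightarrow> bool" where
  "convex_body K \<longleftrightarrow> compact K \<and> convex K \<and> interior K \<noteq> {}"

definition ellipsoid :: "'a::euclidean_space set \<Rightarrow> bool" where
  "ellipsoid E \<longleftrightarrow> (\<exists>(f :: 'a \<Rightarrow> 'a) c. linear f \<and> bij f \<and> E = (\<lambda>x. c + f x) ` cball 0 1)"

text \<open>The maximum is only meaningful when it is attained, e.g. for \<open>L\<close> compact and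
  star-shaped about the origin and \<open>\<theta> \<noteq> 0\<close>.\<close>

definition radial_fun :: "'a::euclidean_space set \<Rightarrow> 'a \<Rightarrow> real" where
  "radial_fun L \<theta> = (GREATEST a::real. 0 \<le> a \<and> a *\<^sub>R \<theta> \<in> L)"

definition orthonormal_basis_of :: "'a::euclidean_space set \<Rightarrow> 'a set \<Rightarrow> bool" where
  "orthonormal_basis_of S B \<longleftrightarrow> pairwise orthogonal B \<and> (\<forall>b\<in>B. norm b = 1) \<and> span B = S"

lemma ex_orthonormal_basis_of:
  assumes "subspace S"
  shows "\<exists>B. orthonormal_basis_of S B"
  unfolding orthonormal_basis_of_def
  by (metis orthonormal_basis_subspace [OF assms])

text \<open>Lebesgue measure of a linear subspace \<open>S\<close>, as a measure on the Borel sets of the ambient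
  space which is concentrated on \<open>S\<close>. It is built like \<^const>\<open>lborel\<close>, from an orthonormal basis
  of \<open>S\<close>; the result does not depend on which basis is chosen.\<close>

definition lborel_subspace :: "'a::euclidean_space set \<Rightarrow> 'a measure" where
  "lborel_subspace S =
     (let B = (SOME B. orthonormal_basis_of S B)
      in distr (\<Pi>\<^sub>M b\<in>B. lborel) borel (\<lambda>f. \<Sum>b\<in>B. f b *\<^sub>R b))"

text \<open>Unnormalized spherical Lebesgue measure on the unit sphere of a linear subspace \<open>S\<close> of
  positive dimension, again as a Borel measure on the ambient space: the measure of a Borel set
  \<open>A\<close> of unit vectors of \<open>S\<close> is \<open>dim S\<close> times the Lebesgue measure in \<open>S\<close> of the cone
  \<open>{r *\<^sub>R \<theta> | r \<theta>. 0 < r \<and> r \<le> 1 \<and> \<theta> \<in> A}\<close> (polar coordinates). The exceptional value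
  \<open>sgn 0 = 0\<close> is taken on a null set only. If \<open>dim S = 1\<close>, this is the counting measure on the two
  unit vectors of \<open>S\<close>.\<close>

definition sphere_measure :: "'a::euclidean_space set \<Rightarrow> 'a measure" where
  "sphere_measure S =
     scale_measure (of_nat (dim S))
       (distr (restrict_space (lborel_subspace S) (cball 0 1)) borel sgn)"

definition dual_section_fun :: "'a::euclidean_space set \<Rightarrow> nat \<Rightarrow> 'a \<Rightarrow> real \<Rightarrow> real" where
  "dual_section_fun K m \<xi> t =
     1 / (real DIM('a) - 1) *
       (LINT \<theta>|sphere_measure {x. x \<bullet> \<xi> = 0}. radial_fun ((\<lambda>x. x - t *\<^sub>R \<xi>) ` K) \<theta> ^ m)"

definition has_polynomial_dual_section_fun :: "'a::euclidean_space set \<Rightarrow> nat \<Rightarrow> bool" where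
  "has_polynomial_dual_section_fun K m \<longleftrightarrow>
     (\<exists>N::nat. N \<ge> 1 \<and> (\<exists>a :: nat \<Rightarrow> 'a \<Rightarrow> real.
        (\<forall>k\<le>N. continuous_on (sphere 0 1) (a k)) \<and>
        (\<forall>\<xi>\<in>sphere 0 1. \<forall>t\<in>{- radial_fun K (- \<xi>)..radial_fun K \<xi>}.
           dual_section_fun K m \<xi> t = (\<Sum>k\<le>N. a k \<xi> * t ^ k))))"

end

theory Submission
  imports Defs "HOL-Computational_Algebra.Polynomial_Factorial" "HOL-Computational_Algebra.Field_as_Ring"
begin

text \<open>
  The dual section function at \<open>(\<xi>, t)\<close> is, up to a constant, the integral of
  \<open>1 / |x| ^ (n - 1 - m)\<close> over the \<open>x\<close> orthogonal to \<open>\<xi>\<close> with \<open>t \<xi> + x\<close> in \<open>K\<close>. Let \<open>C\<close> be \<open>K\<close> minus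
  a small ball around the origin of radius \<open>r\<close>, let \<open>|y| = 1\<close>, and let \<open>J T\<close> be the integral of
  \<open>(\<eta> \<bullet> y) ^ e / area (x, \<eta>) ^ (n - 1 - m)\<close> over \<open>x\<close> in \<open>C\<close> and \<open>1 < |\<eta>| \<le> 2\<close> with
  \<open>0 \<le> x \<bullet> \<eta> \<le> T\<close>, where \<open>area\<close> denotes the area of the spanned parallelogram.

  Integrating over \<open>x\<close> first, by slices orthogonal to \<open>\<eta>\<close>, the hypothesis shows that \<open>J\<close> is a
  polynomial on \<open>[0, r]\<close> of degree bounded independently of \<open>e\<close> (the ball contributes powers of
  \<open>r\<^sup>2 - t\<^sup>2\<close>, as \<open>m\<close> is even). Integrating over \<open>\<eta>\<close> first, by slices orthogonal to \<open>x\<close>, \<open>J\<close> is an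
  explicit polynomial whose coefficients are integrals over \<open>C\<close> of \<open>|x| ^ - (n + j)\<close> times a polynomial
  in \<open>u = (x / |x|) \<bullet> y\<close>. So these vanish for large \<open>j\<close>. Since \<open>m\<close> is even, the leading coefficients
  in \<open>u\<close> are sums of terms of one sign, hence the moments of \<open>u ^ e\<close> with \<open>e > j\<close> are combinations,
  not depending on \<open>y\<close>, of those of degree at most \<open>j\<close>. Normalized, \<open>u ^ e\<close> concentrates at \<open>\<plusminus> y\<close> as
  \<open>e\<close> grows. In the limit, with \<open>g\<close> the gauge of \<open>K\<close>, the function
  \<open>g x ^ j + (- g (- x)) ^ j\<close> is a polynomial of degree at most \<open>j\<close> on every line for all large \<open>j\<close>.

  On a line missing the origin, unique factorization then shows that the sum and the product of
  \<open>g x\<close> and \<open>- g (- x)\<close> are themselves polynomials, of degree 1 and 2. Thus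
  \<open>l x = g x - g (- x)\<close> is linear, \<open>Q x = g x * g (- x)\<close> is a quadratic form, and
  \<open>K = {x. Q x + l x \<le> 1}\<close>.
\<close>

section \<open>Polynomial functions on the line\<close>

text \<open>The weight is symmetric in its two arguments, and on a slice orthogonal to one of them
  it becomes, up to a constant, the weight of the dual section function; so both orders of
  integration lead to hyperplane integrals of one kind. The cut-offs serve two ends. They make
  negative powers integrable: \<open>|x| ^ - (n + j)\<close> on the body and, on the other side, the
  powers of \<open>1 / |\<eta>|\<close> that come with the coefficients of \<open>T\<close>. And
  they keep the slices where the formulas are polynomial: for \<open>T \<le> r\<close> those of
  \<open>C\<close> have height at most \<open>r\<close> since \<open>|\<eta>| > 1\<close>, those of
  the shell height at most 1 since \<open>|x| > r\<close>. The exponent \<open>e\<close> is a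
  parameter that the hypothesis does not see: the degree in \<open>T\<close> obtained from the
  sections is fixed, that of the explicit polynomial grows with \<open>e\<close>. Hence a fixed
  \<open>j\<close> comes with one relation for every larger \<open>e\<close> of its parity, and
  moments of arbitrarily high degree reduce to finitely many. Neither the section function nor the
  gauge is ever differentiated; continuity of the gauge suffices for the limit.\<close>

definition poly_fun :: "nat \<Rightarrow> (real \<Rightarrow> real) \<Rightarrow> bool" where
  "poly_fun d f \<longleftrightarrow> (\<exists>p. degree p \<le> d \<and> (\<forall>s. f s = poly p s))"

lemma poly_funI: "degree p \<le> d \<Longrightarrow> (\<And>s. f s = poly p s) \<Longrightarrow> poly_fun d f"
  by (auto simp: poly_fun_def)

lemma poly_fun_const: "poly_fun d (\<lambda>s. c)"
  by (rule poly_funI[of "[:c:]"]) auto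

lemma poly_fun_add:
  assumes "poly_fun d f" "poly_fun d g"
  shows "poly_fun d (\<lambda>s. f s + g s)"
proof -
  obtain p q where "degree p \<le> d" "degree q \<le> d" "\<And>s. f s = poly p s" "\<And>s. g s = poly q s"
    using assms by (auto simp: poly_fun_def)
  then show ?thesis by (intro poly_funI[of "p + q"]) (auto intro: degree_add_le)
qed

lemma poly_fun_mult:
  assumes "poly_fun d f" "poly_fun e g"
  shows "poly_fun (d + e) (\<lambda>s. f s * g s)"
proof -
  obtain p q where "degree p \<le> d" "degree q \<le> e" "\<And>s. f s = poly p s" "\<And>s. g s = poly q s"
    using assms by (auto simp: poly_fun_def)
  then show ?thesis
    by (intro poly_funI[of "p * q"]) (auto intro: order_trans[OF degree_mult_le])
qed

lemma poly_fun_cmult: "poly_fun d f \<Longrightarrow> poly_fun d (\<lambda>s. c * f s)"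
  using poly_fun_mult[OF poly_fun_const[of 0 c], of d f] by simp

lemma poly_fun_diff: "poly_fun d f \<Longrightarrow> poly_fun d g \<Longrightarrow> poly_fun d (\<lambda>s. f s - g s)"
  using poly_fun_add[of d f "\<lambda>s. (- 1) * g s"] poly_fun_cmult[of d g "- 1"] by simp

lemma poly_fun_sum: "(\<And>i. i \<in> A \<Longrightarrow> poly_fun d (f i)) \<Longrightarrow> poly_fun d (\<lambda>s. \<Sum>i\<in>A. f i s)"
  by (induction A rule: infinite_finite_induct) (auto intro: poly_fun_const poly_fun_add)

lemma poly_fun_power:
  assumes "poly_fun d f"
  shows "poly_fun (d * n) (\<lambda>s. f s ^ n)"
proof (induction n)
  case 0
  then show ?case using poly_fun_const by simp
next
  case (Suc n)
  then show ?case using poly_fun_mult[OF assms Suc] by (simp add: add.commute)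
qed

section \<open>Interpolation and pointwise limits of polynomials of bounded degree\<close>

definition lagrange_basis :: "nat \<Rightarrow> nat \<Rightarrow> real poly" where
  "lagrange_basis d k = (\<Prod>i\<in>{..d} - {k}. smult (1 / (real k - real i)) [:- real i, 1:])"

lemma degree_lagrange_basis:
  assumes "k \<le> d"
  shows "degree (lagrange_basis d k) \<le> d"
proof -
  have "degree (lagrange_basis d k)
      \<le> (\<Sum>i\<in>{..d} - {k}. degree (smult (1 / (real k - real i)) [:- real i, 1:]))"
    unfolding lagrange_basis_def by (rule order_trans[OF degree_prod_sum_le]) (simp_all only: o_def finite_Diff finite_atMost order_refl)
  also have "\<dots> \<le> (\<Sum>i\<in>{..d} - {k}. 1)"
    by (intro sum_mono order_trans[OF degree_smult_le]) simp
  also have "\<dots> = d" using assms by simp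
  finally show ?thesis .
qed

lemma poly_Lagrange:
  fixes p :: "real poly"
  assumes "degree p \<le> d"
  shows "p = (\<Sum>k\<le>d. smult (poly p (real k)) (lagrange_basis d k))"
proof (rule poly_eqI_degree)
  have l: "poly (lagrange_basis d k) (real i) = (if i = k then 1 else 0)" if "i \<le> d" for i k
  proof -
    have "poly (lagrange_basis d k) (real i) = (\<Prod>h\<in>{..d} - {k}. (real i - real h) / (real k - real h))"
      by (simp add: lagrange_basis_def poly_prod diff_divide_distrib)
    also have "\<dots> = (if i = k then 1 else 0)"
      using that by (auto intro!: prod.neutral prod_zero)
    finally show ?thesis .
  qed
  fix x :: real assume "x \<in> real ` {..d}"
  then obtain i where i: "i \<le> d" "x = real i" by auto
  have "(\<Sum>k\<le>d. poly p (real k) * poly (lagrange_basis d k) (real i)) = (\<Sum>k\<le>d. if k = i then poly p (real k) else 0)"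
    using i by (intro sum.cong refl) (auto simp: l)
  then show "poly p x = poly (\<Sum>k\<le>d. smult (poly p (real k)) (lagrange_basis d k)) x"
    using i by (simp add: poly_sum)
next
  have "card (real ` {..d}) = Suc d" by (subst card_image) auto
  then show "degree p < card (real ` {..d})"
    "degree (\<Sum>k\<le>d. smult (poly p (real k)) (lagrange_basis d k)) < card (real ` {..d})"
    using assms(1) degree_lagrange_basis
    by (auto intro!: le_imp_less_Suc degree_sum_le order_trans[OF degree_smult_le])
qed

text \<open>Interpolation at the nodes \<open>0, ..., d\<close> expresses every \<open>F e\<close>
  through its values there, with basis polynomials that do not depend on \<open>e\<close>; such a
  formula survives a pointwise limit. The common degree bound is essential.\<close>

lemma poly_fun_limit:
  assumes F: "\<And>e::nat. poly_fun d (F e)" and lim: "\<And>s. (\<lambda>e. F e s) \<longlonglongrightarrow> f s"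
  shows "poly_fun d f"
proof -
  have eq: "F e s = (\<Sum>k\<le>d. F e (real k) * poly (lagrange_basis d k) s)" for e s
  proof -
    obtain p where p: "degree p \<le> d" "\<And>s. F e s = poly p s" using F[of e] by (auto simp: poly_fun_def)
    show ?thesis unfolding p(2) by (subst (1) poly_Lagrange[OF p(1)]) (simp add: poly_sum)
  qed
  have "f s = (\<Sum>k\<le>d. f (real k) * poly (lagrange_basis d k) s)" for s
  proof (rule LIMSEQ_unique[OF lim])
    show "(\<lambda>e. F e s) \<longlonglongrightarrow> (\<Sum>k\<le>d. f (real k) * poly (lagrange_basis d k) s)"
      unfolding eq[of _ s] by (intro tendsto_intros lim)
  qed
  then have "f s = poly (\<Sum>k\<le>d. smult (f (real k)) (lagrange_basis d k)) s" for s
    unfolding poly_sum poly_smult by blast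
  moreover have "degree (\<Sum>k\<le>d. smult (f (real k)) (lagrange_basis d k)) \<le> d"
    by (auto intro!: degree_sum_le order_trans[OF degree_smult_le] degree_lagrange_basis)
  ultimately show ?thesis using poly_funI by blast
qed

text \<open>In lowest terms \<open>f = p / q\<close>, every power \<open>q\<^sup>i\<close> has to divide the fixed polynomial \<open>W\<close>.\<close>

lemma poly_fun_of_powers:
  assumes W: "poly_fun E W" and W0: "\<And>s. W s \<noteq> 0"
    and pw: "\<And>i. poly_fun (D + d * i) (\<lambda>s. f s ^ i * W s)"
  shows "poly_fun d f"
proof -
  obtain w where w: "\<And>s. W s = poly w s" using W by (auto simp: poly_fun_def)
  obtain R where R: "\<And>i. degree (R i) \<le> D + d * i" "\<And>i s. f s ^ i * W s = poly (R i) s"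
    using pw unfolding poly_fun_def by metis
  have w0: "w \<noteq> 0" using w W0 by (metis poly_0)
  define g where "g = gcd (R 1) w"
  have g0: "g \<noteq> 0" using w0 by (simp add: g_def)
  obtain p q where pq: "R 1 = p * g" "w = q * g" "coprime p q"
    using gcd_coprime_exists[of "R 1" w] g0 unfolding g_def by blast
  \<comment> \<open>A zero of \<open>q\<close> or of the gcd would be a zero of \<open>W\<close>; so
    \<open>f = p / q\<close> holds at every point.\<close>
  have gs: "poly g s \<noteq> 0" and qs: "poly q s \<noteq> 0" for s using W0[of s] by (auto simp: w pq)
  have f: "f s * poly q s = poly p s" for s
  proof -
    have "f s * (poly q s * poly g s) = poly p s * poly g s" using R(2)[of s 1] unfolding pq(1) by (simp add: w pq(2))
    then show ?thesis using gs[of s] by simp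
  qed
  have "q ^ i dvd w" for i
  proof -
    have "poly (R i * q ^ i) s = poly (p ^ i * w) s" for s
    proof -
      have "poly (R i * q ^ i) s = f s ^ i * W s * poly q s ^ i" by (simp add: R(2))
      also have "\<dots> = (f s * poly q s) ^ i * W s" by (simp add: power_mult_distrib)
      finally show ?thesis by (simp add: f w)
    qed
    then have "R i * q ^ i = p ^ i * w" by (metis ext poly_eq_poly_eq_iff)
    then have "q ^ i dvd p ^ i * w" by (metis dvd_triv_right)
    moreover have "coprime (q ^ i) (p ^ i)" using pq(3) by (simp add: coprime_commute)
    ultimately show ?thesis by (simp add: coprime_dvd_mult_right_iff)
  qed
  then have "degree (q ^ i) \<le> degree w" for i using w0 by (intro dvd_imp_degree_le) auto
  \<comment> \<open>With this exponent a \<open>q\<close> of positive degree would have a power of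
    larger degree than \<open>w\<close>.\<close>
  from this[of "Suc (degree w)"] have "Suc (degree w) * degree q \<le> degree w"
    using w0 pq(2) by (subst (asm) degree_power_eq) auto
  then have "degree q = 0" by (cases "degree q") auto
  then obtain c where c: "q = [:c:]" by (rule degree_eq_zeroE)
  have c0: "c \<noteq> 0" using qs[of 0] c by auto
  define h where "h = smult (1 / c) p"
  have h: "f s = poly h s" for s using f[of s] c c0 by (simp add: h_def field_simps)
  \<comment> \<open>A surplus of \<open>degree h\<close> over \<open>d\<close> is multiplied by
    \<open>i\<close>, whereas \<open>D\<close> is fixed; \<open>i = Suc D\<close> is already large
    enough for a contradiction.\<close>
  have "degree h \<le> d"
  proof (cases "h = 0")
    case False
    have "poly (R i) s = poly (h ^ i * w) s" for i s using R(2)[of s i] by (simp add: h w)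
    then have Ri: "R i = h ^ i * w" for i by (metis ext poly_eq_poly_eq_iff)
    have "i * degree h + degree w \<le> D + d * i" for i
      using R(1)[of i] False w0 unfolding Ri by (simp add: degree_mult_eq degree_power_eq)
    from this[of "Suc D"] show ?thesis
    proof -
      have "Suc D * degree h \<le> D + d * Suc D" using \<open>Suc D * degree h + degree w \<le> D + d * Suc D\<close> by linarith
      then have "Suc D * degree h < Suc D * Suc d" by (simp add: algebra_simps)
      then show ?thesis by (metis Suc_mult_less_cancel1 less_Suc_eq_le)
    qed
  qed simp
  then show ?thesis using h by (intro poly_funI[of h]) auto
qed

section \<open>Ellipsoids from power sums of the two roots on each line\<close>

context
  fixes A B :: "real \<Rightarrow> real" and J :: nat
  assumes AB: "\<And>s. A s * B s \<noteq> 0"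
    and power_sum: "\<And>j. J \<le> j \<Longrightarrow> poly_fun j (\<lambda>s. A s ^ j + B s ^ j)"
begin

lemma poly_fun_symmetric:
  assumes "J \<le> u" "J \<le> v"
  shows "poly_fun (u + v) (\<lambda>s. A s ^ u * B s ^ v + A s ^ v * B s ^ u)"
proof -
  have "poly_fun (u + v) (\<lambda>s. (A s ^ u + B s ^ u) * (A s ^ v + B s ^ v) - (A s ^ (u + v) + B s ^ (u + v)))"
    using assms by (intro poly_fun_diff poly_fun_mult power_sum) auto
  then show ?thesis by (simp add: algebra_simps power_add)
qed

text \<open>Multiplying by \<open>A + B\<close> raises one exponent at a time, so the exponents
  never drop below \<open>J\<close>.\<close>

lemma poly_fun_sum_powers:
  assumes "J \<le> u" "J \<le> v"
  shows "poly_fun (u + v + i) (\<lambda>s. (A s + B s) ^ i * (A s ^ u * B s ^ v + A s ^ v * B s ^ u))"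
  using assms
proof (induction i arbitrary: u v)
  case 0
  then show ?case using poly_fun_symmetric by simp
next
  case (Suc i)
  have "poly_fun (u + v + Suc i) (\<lambda>s. (A s + B s) ^ i * (A s ^ Suc u * B s ^ v + A s ^ v * B s ^ Suc u)
      + (A s + B s) ^ i * (A s ^ u * B s ^ Suc v + A s ^ Suc v * B s ^ u))"
    using Suc.IH[of "Suc u" v] Suc.IH[of u "Suc v"] Suc.prems by (intro poly_fun_add) auto
  also have "(\<lambda>s. (A s + B s) ^ i * (A s ^ Suc u * B s ^ v + A s ^ v * B s ^ Suc u)
      + (A s + B s) ^ i * (A s ^ u * B s ^ Suc v + A s ^ Suc v * B s ^ u))
      = (\<lambda>s. (A s + B s) ^ Suc i * (A s ^ u * B s ^ v + A s ^ v * B s ^ u))"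
    by (simp add: fun_eq_iff algebra_simps)
  finally show ?case .
qed

text \<open>The multiplier \<open>2 * (A * B) ^ J\<close> has no zero, and each further factor
  \<open>A + B\<close> raises the degree bound of the product by one: the form that unique
  factorization can use.\<close>

lemma poly_fun_sum_of_roots: "poly_fun 1 (\<lambda>s. A s + B s)"
proof (rule poly_fun_of_powers)
  show "poly_fun (J + J) (\<lambda>s. A s ^ J * B s ^ J + A s ^ J * B s ^ J)" by (rule poly_fun_symmetric) auto
  show "A s ^ J * B s ^ J + A s ^ J * B s ^ J \<noteq> 0" for s using AB[of s] by simp
  show "poly_fun (J + J + 1 * i) (\<lambda>s. (A s + B s) ^ i * (A s ^ J * B s ^ J + A s ^ J * B s ^ J))" for i
    using poly_fun_sum_powers[of J J i] by simp
qed

lemma poly_fun_prod_of_roots: "poly_fun 2 (\<lambda>s. A s * B s)"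
proof (rule poly_fun_of_powers)
  show "poly_fun (J + J) (\<lambda>s. A s ^ J * B s ^ J + A s ^ J * B s ^ J)" by (rule poly_fun_symmetric) auto
  show "A s ^ J * B s ^ J + A s ^ J * B s ^ J \<noteq> 0" for s using AB[of s] by simp
  show "poly_fun (J + J + 2 * i) (\<lambda>s. (A s * B s) ^ i * (A s ^ J * B s ^ J + A s ^ J * B s ^ J))" for i
  proof -
    have "(A s * B s) ^ i * (A s ^ J * B s ^ J + A s ^ J * B s ^ J)
        = A s ^ (J + i) * B s ^ (J + i) + A s ^ (J + i) * B s ^ (J + i)" for s
      by (simp add: power_add power_mult_distrib)
    moreover have "J + J + 2 * i = (J + i) + (J + i)" by simp
    ultimately show ?thesis using poly_fun_symmetric[of "J + i" "J + i"] by (simp only: le_add1)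
  qed
qed

end

section \<open>Quadratic forms and quadrics recovered from their restrictions to lines\<close>

lemma poly_fun_1E:
  assumes "poly_fun 1 f"
  obtains a b where "\<And>s. f s = a + b * s"
proof -
  obtain p where p: "degree p \<le> 1" "\<And>s. f s = poly p s" using assms by (auto simp: poly_fun_def)
  have "poly p s = (\<Sum>i\<le>1. coeff p i * s ^ i)" for s
  proof -
    have "(\<Sum>i\<le>1. coeff p i * s ^ i) = (\<Sum>i\<le>degree p. coeff p i * s ^ i)"
      using p(1) by (intro sum.mono_neutral_right) (auto simp: coeff_eq_0)
    then show ?thesis by (simp add: poly_altdef)
  qed
  then have "f s = coeff p 0 + coeff p 1 * s" for s
    by (simp add: p(2))
  then show ?thesis using that by blast
qed

lemma poly_fun_2E:
  assumes "poly_fun 2 f"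
  obtains a b c where "\<And>s. f s = a + b * s + c * s\<^sup>2"
proof -
  obtain p where p: "degree p \<le> 2" "\<And>s. f s = poly p s" using assms by (auto simp: poly_fun_def)
  have "poly p s = (\<Sum>i\<le>2. coeff p i * s ^ i)" for s
  proof -
    have "(\<Sum>i\<le>2. coeff p i * s ^ i) = (\<Sum>i\<le>degree p. coeff p i * s ^ i)"
      using p(1) by (intro sum.mono_neutral_right) (auto simp: coeff_eq_0)
    then show ?thesis by (simp add: poly_altdef)
  qed
  then have "f s = coeff p 0 + coeff p 1 * s + coeff p 2 * s\<^sup>2" for s
    by (simp add: p(2) numeral_2_eq_2)
  then show ?thesis using that by blast
qed

text \<open>As in the Jordan-von Neumann theorem, polarization gives a candidate for the bilinear
  form and the parallelogram law makes it additive. Its homogeneity is read off the expansion along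
  lines, rather than obtained from additivity by density. A basis orthonormal for this form yields
  \<open>f\<close>.\<close>

lemma orthonormalize_quadratic_form:
  fixes Q :: "'a::euclidean_space \<Rightarrow> real"
  assumes pos: "\<And>x. x \<noteq> 0 \<Longrightarrow> 0 < Q x"
    and par: "\<And>x y. \<exists>b. \<forall>s. Q (x + s *\<^sub>R y) = Q x + b * s + Q y * s\<^sup>2"
    and hom: "\<And>c x. Q (c *\<^sub>R x) = c\<^sup>2 * Q x"
  shows "\<exists>f::'a \<Rightarrow> 'a. linear f \<and> bij f \<and> (\<forall>x. Q (f x) = (norm x)\<^sup>2)"
proof -
  define \<beta> where "\<beta> x y = (Q (x + y) - Q (x - y)) / 4" for x y
  have Q0: "Q 0 = 0" using hom[of 0 0] by simp
  have Qm: "Q (- x) = Q x" for x using hom[of "-1" x] by simp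
  have ex: "Q (x + s *\<^sub>R y) = Q x + 2 * s * \<beta> x y + Q y * s\<^sup>2" for x y s
  proof -
    obtain b where b: "\<And>s. Q (x + s *\<^sub>R y) = Q x + b * s + Q y * s\<^sup>2" using par[of x y] by blast
    have "\<beta> x y = b / 2" using b[of 1] b[of "-1"] by (simp add: \<beta>_def)
    then show ?thesis using b[of s] by simp
  qed
  have par4: "Q (x + y) + Q (x - y) = 2 * Q x + 2 * Q y" for x y
    using ex[of x 1 y] ex[of x "-1" y] by simp
  have sym: "\<beta> x y = \<beta> y x" for x y using Qm[of "x - y"] by (simp add: \<beta>_def add.commute)
  have self: "\<beta> x x = Q x" for x using hom[of 2 x] by (simp add: \<beta>_def Q0 scaleR_2)
  have sc: "\<beta> x (c *\<^sub>R y) = c * \<beta> x y" for c x y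
    using ex[of x c y] ex[of x "-c" y] by (simp add: \<beta>_def)
  have add: "\<beta> (x + z) y = \<beta> x y + \<beta> z y" for x y z
  proof -
    \<comment> \<open>Parallelogram law for the pairs \<open>x + y\<close>, \<open>z + y\<close> and
      \<open>x - y\<close>, \<open>z - y\<close>; both have the difference \<open>x - z\<close>,
      whose contribution cancels on subtraction.\<close>
    have "Q (x + z + 2 *\<^sub>R y) + Q (x - z) = 2 * Q (x + y) + 2 * Q (z + y)"
      using par4[of "x + y" "z + y"] by (simp add: scaleR_2 algebra_simps)
    moreover have "Q (x + z - 2 *\<^sub>R y) + Q (x - z) = 2 * Q (x - y) + 2 * Q (z - y)"
      using par4[of "x - y" "z - y"] by (simp add: scaleR_2 algebra_simps)
    ultimately have "2 * \<beta> x y + 2 * \<beta> z y = \<beta> (x + z) (2 *\<^sub>R y)"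
      unfolding \<beta>_def by argo
    then show ?thesis by (simp add: sc)
  qed
  have lin: "linear (\<lambda>x. \<beta> x y)" for y
  proof (rule linearI)
    fix x z r
    show "\<beta> (x + z) y = \<beta> x y + \<beta> z y" by (rule add)
    show "\<beta> (r *\<^sub>R x) y = r *\<^sub>R \<beta> x y" using sc[of y r x] sym[of y x] sym[of y "r *\<^sub>R x"] by simp
  qed
  \<comment> \<open>Gram-Schmidt for \<open>\<beta>\<close>; positivity of \<open>Q\<close> permits
    the normalization.\<close>
  have "\<exists>S. finite S \<and> card S = k \<and> (\<forall>x\<in>S. \<forall>y\<in>S. \<beta> x y = (if x = y then 1 else 0))"
    if "k \<le> DIM('a)" for k
    using that
  proof (induction k)
    case 0
    show ?case by (intro exI[of _ "{}"]) auto
  next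
    case (Suc k)
    then obtain S where S: "finite S" "card S = k" "\<And>x y. x \<in> S \<Longrightarrow> y \<in> S \<Longrightarrow> \<beta> x y = (if x = y then 1 else 0)"
      by auto
    have "dim S < DIM('a)" using dim_le_card'[OF S(1)] S(2) Suc.prems by linarith
    then have "span S \<noteq> UNIV" by (metis dim_UNIV dim_span less_irrefl)
    then obtain x where x: "x \<notin> span S" by blast
    define z where "z = x - (\<Sum>t\<in>S. \<beta> x t *\<^sub>R t)"
    have "(\<Sum>t\<in>S. \<beta> x t *\<^sub>R t) \<in> span S" by (intro span_sum span_scale span_base)
    then have z0: "z \<noteq> 0" using x by (auto simp: z_def)
    have zt: "\<beta> z t = 0" if "t \<in> S" for t
    proof -
      have "\<beta> z t = \<beta> x t - (\<Sum>r\<in>S. \<beta> x r * \<beta> r t)"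
        unfolding z_def by (simp add: linear_diff[OF lin] linear_sum[OF lin] linear_scale[OF lin])
      also have "(\<Sum>r\<in>S. \<beta> x r * \<beta> r t) = (\<Sum>r\<in>S. if r = t then \<beta> x r else 0)"
        using that S(3) by (intro sum.cong) auto
      also have "\<dots> = \<beta> x t" using S(1) that by simp
      finally show ?thesis by simp
    qed
    define e where "e = (1 / sqrt (Q z)) *\<^sub>R z"
    have Qz: "0 < Q z" using pos[OF z0] .
    have ee: "\<beta> e e = 1" using Qz by (simp add: self e_def hom power_divide)
    have et: "\<beta> e t = 0" "\<beta> t e = 0" if "t \<in> S" for t
      using zt[OF that] by (simp_all add: e_def linear_scale[OF lin] sc sym[of t z])
    have "e \<notin> S" using et ee by force
    then have "card (insert e S) = Suc k" using S by simp
    moreover have "\<forall>x\<in>insert e S. \<forall>y\<in>insert e S. \<beta> x y = (if x = y then 1 else 0)"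
      using S(3) ee et \<open>e \<notin> S\<close> by auto
    ultimately show ?case using S(1) by blast
  qed
  from this[OF order_refl] obtain S where S': "finite S \<and> card S = DIM('a)
      \<and> (\<forall>x\<in>S. \<forall>y\<in>S. \<beta> x y = (if x = y then 1 else 0))" ..
  then have S: "finite S" "card S = DIM('a)" and S_orth: "\<And>x y. x \<in> S \<Longrightarrow> y \<in> S \<Longrightarrow> \<beta> x y = (if x = y then 1 else 0)"
    by blast+
  obtain \<phi> where \<phi>: "bij_betw \<phi> (Basis :: 'a set) S"
    using S by (metis finite_Basis finite_same_card_bij)
  define f where "f x = (\<Sum>b\<in>Basis. (x \<bullet> b) *\<^sub>R \<phi> b)" for x
  have linf: "linear f"
    unfolding f_def by (rule linear_compose_sum) (simp add: linear_iff inner_simps algebra_simps)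
  have \<phi>\<beta>: "\<beta> (\<phi> a) (\<phi> b) = (if a = b then 1 else 0)" if "a \<in> Basis" "b \<in> Basis" for a b
  proof -
    have "\<phi> a \<in> S" "\<phi> b \<in> S" "\<phi> a = \<phi> b \<longleftrightarrow> a = b"
      using \<phi> that by (auto simp: bij_betw_def inj_on_def)
    then show ?thesis using S_orth by simp
  qed
  have Qf: "Q (f x) = (norm x)\<^sup>2" for x
  proof -
    have b1: "\<beta> (f x) y = (\<Sum>a\<in>Basis. (x \<bullet> a) * \<beta> (\<phi> a) y)" for y
      unfolding f_def by (simp add: linear_sum[OF lin] linear_scale[OF lin])
    have b2: "\<beta> (\<phi> a) (f x) = x \<bullet> a" if "a \<in> Basis" for a
    proof -
      have "\<beta> (\<phi> a) (f x) = (\<Sum>b\<in>Basis. (x \<bullet> b) * \<beta> (\<phi> b) (\<phi> a))"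
        using b1[of "\<phi> a"] sym[of "\<phi> a" "f x"] by simp
      also have "\<dots> = (\<Sum>b\<in>Basis. if b = a then x \<bullet> b else 0)"
        using that by (intro sum.cong) (auto simp: \<phi>\<beta>)
      finally show ?thesis using that by simp
    qed
    have "Q (f x) = (\<Sum>a\<in>Basis. (x \<bullet> a) * (x \<bullet> a))"
      using b1[of "f x"] b2 by (simp add: self)
    also have "\<dots> = x \<bullet> x" by (rule euclidean_inner[symmetric])
    finally show ?thesis by (simp add: power2_norm_eq_inner)
  qed
  have "inj f"
    unfolding linear_injective_0[OF linf]
  proof (intro allI impI)
    fix x assume "f x = 0"
    then have "(norm x)\<^sup>2 = 0" using Qf[of x] Q0 by simp
    then show "x = 0" by simp
  qed
  then have "bij f" using linf by (simp add: bij_def linear_injective_imp_surjective)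
  then show ?thesis using linf Qf by blast
qed

text \<open>In the coordinate \<open>u\<close> with \<open>x = f u\<close> the inequality reads
  \<open>|u|^2 - 2 (u \<bullet> w) \<le> 1\<close>, where \<open>w\<close> represents
  \<open>l\<close> composed with \<open>f\<close> up to the factor \<open>- 1/2\<close>. Completing
  the square gives the ball of center \<open>w\<close> and squared radius
  \<open>1 + |w|^2\<close>.\<close>

lemma ellipsoid_quadric:
  fixes Q l :: "'a::euclidean_space \<Rightarrow> real" and f :: "'a \<Rightarrow> 'a"
  assumes f: "linear f" "bij f" "\<And>x. Q (f x) = (norm x)\<^sup>2" and l: "linear l"
  shows "ellipsoid {x. Q x + l x \<le> 1}"
proof -
  define w where "w = - (1/2) *\<^sub>R (\<Sum>b\<in>Basis. l (f b) *\<^sub>R b)"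
  have lf: "l (f u) = - 2 * (u \<bullet> w)" for u
  proof -
    have "l (f u) = l (f (\<Sum>b\<in>Basis. (u \<bullet> b) *\<^sub>R b))" by (simp add: euclidean_representation)
    also have "\<dots> = (\<Sum>b\<in>Basis. (u \<bullet> b) * l (f b))"
      by (simp add: linear_sum[OF f(1)] linear_scale[OF f(1)] linear_sum[OF l] linear_scale[OF l])
    also have "\<dots> = - 2 * (u \<bullet> w)" by (simp add: w_def inner_sum_right mult.commute)
    finally show ?thesis .
  qed
  define R where "R = sqrt (1 + (norm w)\<^sup>2)"
  have R: "0 < R" "R\<^sup>2 = 1 + (norm w)\<^sup>2" by (auto simp: R_def add_pos_nonneg)
  have iff: "Q (f u) + l (f u) \<le> 1 \<longleftrightarrow> norm (u - w) \<le> R" for u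
  proof -
    have "Q (f u) + l (f u) = (norm (u - w))\<^sup>2 - (norm w)\<^sup>2"
      by (simp add: f(3) lf power2_norm_eq_inner inner_simps inner_commute)
    then have "Q (f u) + l (f u) \<le> 1 \<longleftrightarrow> (norm (u - w))\<^sup>2 \<le> R\<^sup>2" using R by auto
    also have "\<dots> \<longleftrightarrow> norm (u - w) \<le> R" using R(1) by (simp add: abs_le_square_iff[symmetric])
    finally show ?thesis .
  qed
  define h where "h x = f (R *\<^sub>R x)" for x
  have "linear h" unfolding h_def using linear_compose[OF linear_scaleR f(1)] by (simp add: o_def)
  moreover have "bij h"
  proof -
    have "bij ((*\<^sub>R) R :: 'a \<Rightarrow> 'a)"
      using R(1) by (intro bij_betw_byWitness[where f' = "(*\<^sub>R) (1 / R)"]) auto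
    then have "bij (f \<circ> (*\<^sub>R) R)" using f(2) by (rule bij_comp)
    moreover have "h = f \<circ> (*\<^sub>R) R" by (auto simp: h_def)
    ultimately show ?thesis by simp
  qed
  moreover have "{x. Q x + l x \<le> 1} = (\<lambda>x. f w + h x) ` cball 0 1"
  proof (intro equalityI subsetI)
    fix x assume x: "x \<in> {x. Q x + l x \<le> 1}"
    obtain u where u: "x = f u" using f(2) by (metis bij_pointE)
    have "norm (u - w) \<le> R" using x iff u by simp
    then have "norm ((1 / R) *\<^sub>R (u - w)) \<le> 1" using R(1) unfolding norm_scaleR by simp
    then have "(1 / R) *\<^sub>R (u - w) \<in> cball 0 1" by (simp only: mem_cball_0)
    moreover have "x = f w + h ((1 / R) *\<^sub>R (u - w))"
      using R(1) by (simp add: h_def u linear_diff[OF f(1)])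
    ultimately show "x \<in> (\<lambda>x. f w + h x) ` cball 0 1" by blast
  next
    fix x assume "x \<in> (\<lambda>x. f w + h x) ` cball 0 1"
    then obtain v where v: "norm v \<le> 1" "x = f (w + R *\<^sub>R v)" by (auto simp: h_def linear_add[OF f(1)])
    have "norm ((w + R *\<^sub>R v) - w) \<le> R" using v(1) R by (simp add: mult_left_le)
    then show "x \<in> {x. Q x + l x \<le> 1}" using iff v(2) by simp
  qed
  ultimately show ?thesis unfolding ellipsoid_def by blast
qed

text \<open>For a body \<open>Q + l \<le> 1\<close> the line through \<open>0\<close> and
  \<open>x\<close> meets the boundary at the multiples \<open>s * x\<close> with
  \<open>s^2 * Q x + s * l x = 1\<close>. The reciprocals of these \<open>s\<close> are the roots of
  \<open>z^2 - l x * z - Q x\<close>, namely \<open>g x\<close> and \<open>- g (- x)\<close>: hence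
  the sign in the power sums, and the interest in the sum and product of the two functions. At the
  origin both vanish, so lines through it are left to homogeneity.\<close>

lemma ellipsoid_of_gauge_power_sums:
  fixes g :: "'a::euclidean_space \<Rightarrow> real"
  assumes pos: "\<And>x. x \<noteq> 0 \<Longrightarrow> 0 < g x" and hom: "\<And>c x. 0 \<le> c \<Longrightarrow> g (c *\<^sub>R x) = c * g x"
    and cont: "continuous_on UNIV g"
    and poly: "\<And>j p v. J \<le> j \<Longrightarrow> poly_fun j (\<lambda>s. g (p + s *\<^sub>R v) ^ j + (- g (- (p + s *\<^sub>R v))) ^ j)"
  shows "ellipsoid {x. g x \<le> 1}"
proof -
  have g0: "g 0 = 0" using hom[of 0 0] by simp
  have gn: "0 \<le> g x" for x using pos[of x] g0 by (cases "x = 0") auto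
  define l where "l x = g x - g (- x)" for x
  define Q where "Q x = g x * g (- x)" for x
  have lines: "poly_fun 1 (\<lambda>s. l (p + s *\<^sub>R v)) \<and> poly_fun 2 (\<lambda>s. Q (p + s *\<^sub>R v))"
    if "\<And>s. p + s *\<^sub>R v \<noteq> 0" for p v
  proof
    have nz: "g (p + s *\<^sub>R v) * (- g (- (p + s *\<^sub>R v))) \<noteq> 0" for s
      using pos[of "p + s *\<^sub>R v"] pos[of "- (p + s *\<^sub>R v)"] that[of s] by (metis less_irrefl mult_eq_0_iff neg_equal_0_iff_equal)
    show "poly_fun 1 (\<lambda>s. l (p + s *\<^sub>R v))"
      using poly_fun_sum_of_roots[OF nz poly] by (simp add: l_def)
    show "poly_fun 2 (\<lambda>s. Q (p + s *\<^sub>R v))"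
      using poly_fun_cmult[OF poly_fun_prod_of_roots[OF nz poly], where c = "- 1"] by (simp add: Q_def)
  qed
  have lhom: "l (c *\<^sub>R x) = c * l x" for c x
  proof (cases "0 \<le> c")
    case True
    then show ?thesis using hom[of c x] hom[of c "- x"] by (simp add: l_def algebra_simps)
  next
    case False
    then show ?thesis using hom[of "- c" x] hom[of "- c" "- x"] by (simp add: l_def algebra_simps)
  qed
  have Qhom: "Q (c *\<^sub>R x) = c\<^sup>2 * Q x" for c x
  proof (cases "0 \<le> c")
    case True
    then show ?thesis using hom[of c x] hom[of c "- x"] by (simp add: Q_def power2_eq_square)
  next
    case False
    then show ?thesis using hom[of "- c" x] hom[of "- c" "- x"] by (simp add: Q_def power2_eq_square)
  qed
  \<comment> \<open>If the line through \<open>x\<close> and \<open>y\<close> hits the origin, the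
    vectors are dependent and homogeneity decides; otherwise \<open>l\<close> is affine on that line
    and is evaluated at the midpoint.\<close>
  have "l (x + y) = l x + l y" for x y
  proof (cases "\<exists>s. x + s *\<^sub>R (y - x) = 0")
    case True
    then obtain s where s: "(1 - s) *\<^sub>R x = - s *\<^sub>R y" by (auto simp: algebra_simps)
    show ?thesis
    proof (cases "s = 0")
      case True
      then show ?thesis using s lhom[of 0 0] by simp
    next
      case False
      define c where "c = - ((1 - s) / s)"
      have "(1 / s) *\<^sub>R ((1 - s) *\<^sub>R x) = (1 / s) *\<^sub>R (- s *\<^sub>R y)" by (simp only: s)
      then have "((1 - s) / s) *\<^sub>R x = - y" using False by simp
      then have y: "y = c *\<^sub>R x" unfolding c_def scaleR_minus_left by simp
      have "x + y = (1 + c) *\<^sub>R x" by (simp add: y algebra_simps)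
      then have "l (x + y) = (1 + c) * l x" by (simp only: lhom)
      moreover have "l y = c * l x" by (simp only: y lhom)
      ultimately show ?thesis by (simp add: algebra_simps)
    qed
  next
    case False
    then obtain a b where ab: "\<And>s. l (x + s *\<^sub>R (y - x)) = a + b * s"
      using lines[of x "y - x"] poly_fun_1E by metis
    have "(1/2) *\<^sub>R (x + y) = (1/2) *\<^sub>R ((x + x) + (y - x))" by simp
    also have "\<dots> = x + (1/2) *\<^sub>R (y - x)"
      by (simp only: scaleR_add_right[of "1/2" "x + x" "y - x"] scaleR_half_double)
    finally have "x + (1/2) *\<^sub>R (y - x) = (1/2) *\<^sub>R (x + y)" ..
    then have "(1/2) * l (x + y) = a + b * (1/2)" using ab[of "1/2"] lhom[of "1/2" "x + y"] by simp
    moreover have "l x = a" "l y = a + b" using ab[of 0] ab[of 1] by simp_all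
    ultimately show ?thesis by linarith
  qed
  then have l: "linear l" using lhom by (intro linearI) auto
  have Qcont: "continuous_on UNIV Q"
    unfolding Q_def by (intro continuous_on_mult cont continuous_on_compose2[OF cont] continuous_intros) auto
  have "\<exists>b. \<forall>s. Q (x + s *\<^sub>R y) = Q x + b * s + Q y * s\<^sup>2" for x y
  proof (cases "\<exists>s. x + s *\<^sub>R y = 0")
    case True
    then obtain s0 where "x + s0 *\<^sub>R y = 0" by blast
    then have x: "x = (- s0) *\<^sub>R y" by (simp add: eq_neg_iff_add_eq_0)
    have "Q (x + s *\<^sub>R y) = Q x + (- 2 * s0 * Q y) * s + Q y * s\<^sup>2" for s
    proof -
      have "x + s *\<^sub>R y = (s - s0) *\<^sub>R y" by (simp add: x algebra_simps)
      then show ?thesis by (simp only: Qhom x) (simp add: algebra_simps power2_eq_square)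
    qed
    then show ?thesis by blast
  next
    case False
    then obtain a b c where abc: "\<And>s. Q (x + s *\<^sub>R y) = a + b * s + c * s\<^sup>2"
      using lines[of x y] poly_fun_2E by metis
    have a: "a = Q x" using abc[of 0] by simp
    \<comment> \<open>The leading coefficient \<open>c\<close> has to be \<open>Q y\<close>: by
      homogeneity \<open>i^2 * Q (x + y / i) = Q (i x + y)\<close>, and as \<open>i\<close> tends to
      0 the right side tends to \<open>Q y\<close> while the expansion tends to
      \<open>c\<close>.\<close>
    have "(\<lambda>n. Q (inverse (real (Suc n)) *\<^sub>R x + y)) \<longlonglongrightarrow> Q (0 *\<^sub>R x + y)"
      by (intro continuous_on_tendsto_compose[OF Qcont] tendsto_intros LIMSEQ_inverse_real_of_nat) auto
    moreover have "Q (inverse (real (Suc n)) *\<^sub>R x + y) = a * (inverse (real (Suc n)))\<^sup>2 + b * inverse (real (Suc n)) + c" for n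
    proof -
      define i where "i = inverse (real (Suc n))"
      have i: "i * real (Suc n) = 1" by (simp add: i_def)
      have "i *\<^sub>R x + y = i *\<^sub>R (x + real (Suc n) *\<^sub>R y)"
        using i by (simp add: scaleR_add_right)
      then have "Q (i *\<^sub>R x + y) = i\<^sup>2 * (a + b * real (Suc n) + c * (real (Suc n))\<^sup>2)"
        by (simp only: Qhom abc)
      also have "\<dots> = a * i\<^sup>2 + b * i * (i * real (Suc n)) + c * (i * real (Suc n))\<^sup>2"
        by (simp add: algebra_simps power2_eq_square)
      finally show ?thesis using i unfolding i_def[symmetric] by simp
    qed
    ultimately have "(\<lambda>n. a * (inverse (real (Suc n)))\<^sup>2 + b * inverse (real (Suc n)) + c) \<longlonglongrightarrow> Q y"
      by simp
    moreover have "(\<lambda>n. a * (inverse (real (Suc n)))\<^sup>2 + b * inverse (real (Suc n)) + c) \<longlonglongrightarrow> a * 0\<^sup>2 + b * 0 + c"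
      by (intro tendsto_intros LIMSEQ_inverse_real_of_nat)
    ultimately have "Q y = a * 0\<^sup>2 + b * 0 + c" by (rule LIMSEQ_unique)
    then have "c = Q y" by simp
    then show ?thesis using abc a by auto
  qed
  moreover have "0 < Q x" if "x \<noteq> 0" for x using pos[of x] pos[of "- x"] that by (simp add: Q_def)
  ultimately obtain f :: "'a \<Rightarrow> 'a" where f: "linear f" "bij f" "\<And>x. Q (f x) = (norm x)\<^sup>2"
    using orthonormalize_quadratic_form[of Q] Qhom by metis
  have "g x \<le> 1 \<longleftrightarrow> Q x + l x \<le> 1" for x
  proof -
    \<comment> \<open>The second factor is positive, so the quadric cuts out exactly the unit ball
      of \<open>g\<close>.\<close>
    have "1 - (Q x + l x) = (1 - g x) * (1 + g (- x))" by (simp add: Q_def l_def algebra_simps)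
    moreover have "0 < 1 + g (- x)" using gn[of "- x"] by simp
    ultimately have "0 \<le> 1 - (Q x + l x) \<longleftrightarrow> 0 \<le> 1 - g x" by (simp add: zero_le_mult_iff)
    then show ?thesis by simp
  qed
  then show ?thesis using ellipsoid_quadric[OF f l] by simp
qed

section \<open>Gauge and radial function\<close>

text \<open>The Minkowski gauge, when \<open>L\<close> is convex with \<open>0\<close> in its
  interior. At \<open>x = 0\<close> the admissible \<open>a\<close> have no greatest element, so the
  value there is set by hand.\<close>

definition star_gauge :: "'a::euclidean_space set \<Rightarrow> 'a \<Rightarrow> real" where
  "star_gauge L x = (if x = 0 then 0 else 1 / radial_fun L x)"

context
  fixes L :: "'a::euclidean_space set"
  assumes L: "compact L" "convex L" "0 \<in> interior L"
begin

lemma radial_fun_Greatest: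
  assumes x: "x \<noteq> 0"
  shows "0 < radial_fun L x" and "0 \<le> a \<Longrightarrow> a *\<^sub>R x \<in> L \<longleftrightarrow> a \<le> radial_fun L x"
proof -
  define S where "S = {a. 0 \<le> a \<and> a *\<^sub>R x \<in> L}"
  have S0: "0 \<in> S" using L(3) interior_subset by (auto simp: S_def)
  obtain B where B: "\<And>y. y \<in> L \<Longrightarrow> norm y \<le> B" using compact_imp_bounded[OF L(1)] by (auto simp: bounded_iff)
  have "closed ((\<lambda>a. a *\<^sub>R x) -` L)"
    by (rule closed_vimage[OF compact_imp_closed[OF L(1)]]) (intro continuous_intros)
  moreover have "S = {0..} \<inter> (\<lambda>a. a *\<^sub>R x) -` L" by (auto simp: S_def)
  ultimately have "closed S" by auto
  moreover have "bounded S"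
    unfolding bounded_iff
  proof (intro exI ballI)
    fix a assume "a \<in> S"
    then have "\<bar>a\<bar> * norm x \<le> B" using B[of "a *\<^sub>R x"] by (simp add: S_def)
    then show "norm a \<le> B / norm x" using x by (simp add: field_simps)
  qed
  ultimately have "compact S" by (simp add: compact_eq_bounded_closed)
  then obtain s where s: "s \<in> S" "\<And>a. a \<in> S \<Longrightarrow> a \<le> s"
    using compact_attains_sup[of S] S0 by blast
  have r: "radial_fun L x = s"
    unfolding radial_fun_def by (rule Greatest_equality) (use s in \<open>auto simp: S_def\<close>)
  show iff: "a *\<^sub>R x \<in> L \<longleftrightarrow> a \<le> radial_fun L x" if "0 \<le> a" for a
  proof
    assume "a *\<^sub>R x \<in> L"
    then show "a \<le> radial_fun L x" using that s(2)[of a] by (simp add: r S_def)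
  next
    assume a: "a \<le> radial_fun L x"
    show "a *\<^sub>R x \<in> L"
    proof (cases "a = 0")
      case True
      then show ?thesis using S0 by (simp add: S_def)
    next
      case False
      then have s0: "0 < s" using a r that by simp
      have "(1 - a / s) *\<^sub>R 0 + (a / s) *\<^sub>R (s *\<^sub>R x) \<in> L"
        using s(1) S0 a r s0 that by (intro convexD[OF L(2)]) (auto simp: S_def)
      then show ?thesis using s0 by simp
    qed
  qed
  obtain e where e: "0 < e" "cball 0 e \<subseteq> L" using L(3) by (auto simp: mem_interior_cball)
  then have "(e / norm x) *\<^sub>R x \<in> L" using x by (intro subsetD[OF e(2)]) auto
  then have "e / norm x \<le> radial_fun L x" using iff[of "e / norm x"] e by simp
  moreover have "0 < e / norm x" using e x by simp
  ultimately show "0 < radial_fun L x" by linarith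
qed

lemma star_gauge_le1: "star_gauge L x \<le> 1 \<longleftrightarrow> x \<in> L"
proof (cases "x = 0")
  case True
  then show ?thesis using L(3) interior_subset by (auto simp: star_gauge_def)
next
  case False
  then show ?thesis using radial_fun_Greatest(1)[OF False] radial_fun_Greatest(2)[OF False, of 1]
    by (simp add: star_gauge_def)
qed

lemma star_gauge_pos: "x \<noteq> 0 \<Longrightarrow> 0 < star_gauge L x"
  using radial_fun_Greatest(1) by (simp add: star_gauge_def)

lemma star_gauge_nonneg: "0 \<le> star_gauge L x"
  using star_gauge_pos[of x] by (cases "x = 0") (auto simp: star_gauge_def)

lemma radial_fun_scaleR:
  assumes c: "0 < c" and x: "x \<noteq> 0"
  shows "radial_fun L (c *\<^sub>R x) = radial_fun L x / c"
proof -
  have cx: "c *\<^sub>R x \<noteq> 0" using c x by simp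
  have "a \<le> radial_fun L (c *\<^sub>R x) \<longleftrightarrow> a \<le> radial_fun L x / c" if "0 \<le> a" for a
    using radial_fun_Greatest(2)[OF cx that] radial_fun_Greatest(2)[OF x, of "a * c"] c that
    by (simp add: field_simps)
  from this[of "radial_fun L (c *\<^sub>R x)"] this[of "radial_fun L x / c"]
  show ?thesis using radial_fun_Greatest(1)[OF cx] radial_fun_Greatest(1)[OF x] c by simp
qed

lemma star_gauge_scaleR: "0 \<le> c \<Longrightarrow> star_gauge L (c *\<^sub>R x) = c * star_gauge L x"
  by (cases "c = 0") (auto simp: star_gauge_def radial_fun_scaleR)

lemma star_gauge_triangle: "star_gauge L (x + y) \<le> star_gauge L x + star_gauge L y"
proof (cases "x = 0 \<or> y = 0")
  case True
  then show ?thesis by (auto simp: star_gauge_def)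
next
  case False
  then have p: "0 < star_gauge L x" "0 < star_gauge L y" using star_gauge_pos by auto
  define a b where "a = star_gauge L x" and "b = star_gauge L y"
  have ab: "0 < a" "0 < b" using p by (auto simp: a_def b_def)
  have "star_gauge L ((1 / a) *\<^sub>R x) \<le> 1" "star_gauge L ((1 / b) *\<^sub>R y) \<le> 1"
    using ab by (simp_all add: star_gauge_scaleR a_def[symmetric] b_def[symmetric])
  then have "(1 / a) *\<^sub>R x \<in> L" "(1 / b) *\<^sub>R y \<in> L" by (simp_all only: star_gauge_le1)
  then have "(a / (a + b)) *\<^sub>R ((1 / a) *\<^sub>R x) + (b / (a + b)) *\<^sub>R ((1 / b) *\<^sub>R y) \<in> L"
    using ab by (intro convexD[OF L(2)]) (simp_all add: add_divide_distrib[symmetric])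
  then have "(1 / (a + b)) *\<^sub>R (x + y) \<in> L" using ab by (simp add: scaleR_add_right)
  then have "star_gauge L ((1 / (a + b)) *\<^sub>R (x + y)) \<le> 1" by (simp only: star_gauge_le1)
  then have "star_gauge L (x + y) / (a + b) \<le> 1" using ab by (simp add: star_gauge_scaleR)
  then show ?thesis using ab by (simp add: a_def b_def)
qed

lemma star_gauge_le_norm:
  assumes r: "0 < r" "cball 0 r \<subseteq> L"
  shows "star_gauge L x \<le> norm x / r"
proof (cases "x = 0")
  case False
  have "(r / norm x) *\<^sub>R x \<in> L" using r False by (intro subsetD[OF r(2)]) auto
  then have "(r / norm x) * star_gauge L x \<le> 1"
    using r star_gauge_le1[of "(r / norm x) *\<^sub>R x"] by (simp add: star_gauge_scaleR)
  then show ?thesis using r False by (simp add: field_simps)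
qed (simp add: star_gauge_def)

lemma continuous_on_star_gauge: "continuous_on S (star_gauge L)"
proof -
  obtain r where r: "0 < r" "cball 0 r \<subseteq> L" using L(3) by (auto simp: mem_interior_cball)
  have "(1 / r)-lipschitz_on S (star_gauge L)"
  proof (rule lipschitz_onI)
    fix x y
    have "star_gauge L x \<le> star_gauge L y + norm (x - y) / r"
      using star_gauge_triangle[of y "x - y"] star_gauge_le_norm[OF r, of "x - y"] by simp
    moreover have "star_gauge L y \<le> star_gauge L x + norm (x - y) / r"
      using star_gauge_triangle[of x "y - x"] star_gauge_le_norm[OF r, of "y - x"] by (simp add: norm_minus_commute)
    ultimately show "dist (star_gauge L x) (star_gauge L y) \<le> 1 / r * dist x y"
      by (simp add: dist_norm abs_le_iff)
  qed (use r in simp)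
  then show ?thesis by (rule lipschitz_on_continuous_on)
qed

lemma radial_fun_eq: "x \<noteq> 0 \<Longrightarrow> radial_fun L x = 1 / star_gauge L x"
  by (simp add: star_gauge_def)

lemma borel_measurable_radial_fun [measurable]: "radial_fun L \<in> borel_measurable borel"
proof -
  have [measurable]: "star_gauge L \<in> borel_measurable borel"
    by (rule borel_measurable_continuous_onI[OF continuous_on_star_gauge])
  \<comment> \<open>Only the unspecified value at the origin is not given by the gauge.\<close>
  have "radial_fun L = (\<lambda>x. if x = 0 then radial_fun L 0 else 1 / star_gauge L x)"
    by (auto simp: radial_fun_eq)
  also have "\<dots> \<in> borel_measurable borel" by measurable
  finally show ?thesis .
qed

lemma radial_fun_sgn_iff:
  assumes "x \<noteq> 0"
  shows "norm x \<le> radial_fun L (sgn x) \<longleftrightarrow> x \<in> L"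
proof -
  have "sgn x \<noteq> 0" using assms by (simp add: sgn_zero_iff)
  then show ?thesis using radial_fun_Greatest(2)[of "sgn x" "norm x"] assms by (simp add: sgn_div_norm)
qed

lemma radial_fun_le:
  assumes "\<And>y. y \<in> L \<Longrightarrow> norm y \<le> R" "norm x = 1"
  shows "radial_fun L x \<le> R"
proof -
  have "x \<noteq> 0" using assms(2) by auto
  then have "radial_fun L x *\<^sub>R x \<in> L" "0 < radial_fun L x"
    using radial_fun_Greatest(2)[of x "radial_fun L x"] radial_fun_Greatest(1)[of x] by auto
  then show ?thesis using assms(1)[of "radial_fun L x *\<^sub>R x"] assms(2) by simp
qed

end

section \<open>Lebesgue measure on hyperplanes\<close>

lemma borel_measurable_linear:
  fixes f :: "'a::euclidean_space \<Rightarrow> 'b::euclidean_space"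
  shows "linear f \<Longrightarrow> f \<in> borel_measurable borel"
  by (simp add: borel_measurable_continuous_onI linear_continuous_on linear_linear)

text \<open>The uniqueness argument for translation-invariant measures: by Fubini the two measures
  are proportional, and the test set \<open>B\<close>, the unit ball, is fixed by \<open>T\<close>
  and by negation, which makes the factor 1.\<close>

lemma distr_lborel_orthogonal:
  fixes T :: "'a::euclidean_space \<Rightarrow> 'a"
  assumes T: "orthogonal_transformation T"
  shows "distr lborel borel T = lborel"
proof (rule measure_eqI)
  have lin: "linear T" by (rule orthogonal_transformation_linear[OF T])
  then have [measurable]: "T \<in> borel_measurable borel" by (rule borel_measurable_linear)
  have lborel_shift: "(\<integral>\<^sup>+x. g (c + x) \<partial>lborel) = (\<integral>\<^sup>+x. g x \<partial>lborel)"
    if [measurable]: "g \<in> borel_measurable borel" for g :: "'a \<Rightarrow> ennreal" and c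
    by (subst (2) lborel_distr_plus[of c, symmetric]) (simp add: nn_integral_distr)
  have T_shift: "(\<integral>\<^sup>+x. g (c + T x) \<partial>lborel) = (\<integral>\<^sup>+x. g (T x) \<partial>lborel)"
    if [measurable]: "g \<in> borel_measurable borel" for g :: "'a \<Rightarrow> ennreal" and c
  proof -
    obtain c' where "c = T c'" using orthogonal_transformation_surj[OF T] by (metis surjD)
    then show ?thesis
      using lborel_shift[of "\<lambda>x. g (T x)" c'] by (simp add: linear_add[OF lin])
  qed
  fix A assume "A \<in> sets (distr lborel borel T)"
  then have [measurable]: "A \<in> sets borel" by simp
  define B :: "'a set" where "B = cball 0 1"
  have [measurable]: "B \<in> sets borel" by (simp add: B_def)
  have TB: "indicator B (- T x) = (indicator B x :: ennreal)" for x
    using T by (simp add: B_def indicator_def orthogonal_transformation_norm)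
  have "emeasure (distr lborel borel T) A * emeasure lborel B
      = (\<integral>\<^sup>+x. indicator A (T x) * (\<integral>\<^sup>+y. indicator B y \<partial>lborel) \<partial>lborel)"
  proof -
    have "(\<integral>\<^sup>+x. indicator A (T x) \<partial>lborel) = emeasure (distr lborel borel T) A"
      using nn_integral_distr[of T lborel borel "indicator A"] by simp
    then show ?thesis by (simp add: nn_integral_multc)
  qed
  also have "\<dots> = (\<integral>\<^sup>+x. (\<integral>\<^sup>+y. indicator A (T x) * indicator B (- T x + y) \<partial>lborel) \<partial>lborel)"
  proof (rule nn_integral_cong, goal_cases)
    case (1 x)
    have "(\<integral>\<^sup>+y. indicator B (- T x + y) \<partial>lborel) = (\<integral>\<^sup>+y. indicator B y \<partial>lborel)"
      by (rule lborel_shift) simp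
    then show ?case
      by (subst nn_integral_cmult) (simp_all del: nn_integral_indicator)
  qed
  also have "\<dots> = (\<integral>\<^sup>+y. (\<integral>\<^sup>+x. indicator A (T x) * indicator B (- T x + y) \<partial>lborel) \<partial>lborel)"
    by (rule lborel_pair.Fubini') measurable
  also have "\<dots> = (\<integral>\<^sup>+y. (\<integral>\<^sup>+x. indicator A (y + T x) * indicator B (- T x) \<partial>lborel) \<partial>lborel)"
  proof (rule nn_integral_cong, goal_cases)
    case (1 y)
    show ?case
      using T_shift[of "\<lambda>x. indicator A x * indicator B (- x + y)" y] by simp
  qed
  also have "\<dots> = (\<integral>\<^sup>+x. (\<integral>\<^sup>+y. indicator A (T x + y) * indicator B x \<partial>lborel) \<partial>lborel)"
    by (subst lborel_pair.Fubini') (simp_all add: TB add.commute)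
  also have "\<dots> = emeasure lborel A * emeasure lborel B"
    by (simp add: nn_integral_multc lborel_shift nn_integral_cmult)
  finally have *: "emeasure lborel B * emeasure (distr lborel borel T) A = emeasure lborel B * emeasure lborel A"
    by (simp add: mult.commute)
  have "emeasure lborel B \<noteq> 0"
    unfolding B_def using content_cball_pos[of 1 "0::'a"]
    by (auto simp: measure_def)
  moreover have "emeasure lborel B \<noteq> top"
    unfolding B_def using emeasure_lborel_cball_finite[of "0::'a" 1] by simp
  ultimately show "emeasure (distr lborel borel T) A = emeasure lborel A"
    using * by (simp add: ennreal_mult_cancel_left)
qed simp

section \<open>Independence of the orthonormal basis, and slicing by parallel hyperplanes\<close>

lemma finite_orthonormal:
  fixes B :: "'a::euclidean_space set"
  assumes "pairwise orthogonal B" "\<And>b. b \<in> B \<Longrightarrow> norm b = 1"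
  shows "finite B" "independent B"
proof -
  have "0 \<notin> B" using assms(2) by force
  then show "independent B" using assms(1) pairwise_orthogonal_independent by blast
  then show "finite B" by (rule independent_imp_finite)
qed

text \<open>For the standard basis this is the construction of \<open>lborel\<close>. A bijection
  from the standard basis to \<open>B\<close> extends to an orthogonal map, under which
  \<open>lborel\<close> is invariant.\<close>

lemma distr_PiM_orthonormal_basis:
  fixes B :: "(real^'n) set"
  assumes orth: "pairwise orthogonal B" and norm: "\<And>b. b \<in> B \<Longrightarrow> norm b = 1"
    and span: "span B = UNIV"
  shows "distr (\<Pi>\<^sub>M b\<in>B. lborel) borel (\<lambda>f. \<Sum>b\<in>B. f b *\<^sub>R b) = (lborel :: (real^'n) measure)"
proof -
  have fin: "finite B" and ind: "independent B" using finite_orthonormal orth norm by blast+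
  have "card B = DIM(real^'n)"
    using dim_span_eq_card_independent[OF ind] span by (simp add: dim_UNIV)
  then obtain \<phi> where \<phi>: "bij_betw \<phi> (Basis :: (real^'n) set) B"
    using fin by (metis finite_Basis finite_same_card_bij)
  define T where "T x = (\<Sum>b\<in>Basis. (x \<bullet> b) *\<^sub>R \<phi> b)" for x :: "real^'n"
  have lin: "linear T"
    unfolding T_def by (rule linear_compose_sum) (simp add: linear_iff inner_simps algebra_simps)
  have \<phi>B: "b \<in> Basis \<Longrightarrow> \<phi> b \<in> B" for b using \<phi> by (auto simp: bij_betw_def)
  have inn: "\<phi> a \<bullet> \<phi> b = (if a = b then 1 else 0)" if "a \<in> Basis" "b \<in> Basis" for a b
  proof (cases "a = b")
    case True
    then show ?thesis using norm[OF \<phi>B[OF that(1)]] by (simp add: norm_eq_1)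
  next
    case False
    then have "\<phi> a \<noteq> \<phi> b" using that \<phi> by (metis bij_betw_def inj_onD)
    then show ?thesis using False pairwiseD[OF orth \<phi>B[OF that(1)] \<phi>B[OF that(2)]]
      by (simp add: orthogonal_def)
  qed
  have "T x \<bullet> T y = x \<bullet> y" for x y
  proof -
    have "T x \<bullet> T y = (\<Sum>a\<in>Basis. \<Sum>b\<in>Basis. (x \<bullet> a) * ((y \<bullet> b) * (\<phi> a \<bullet> \<phi> b)))"
      unfolding T_def inner_sum_left inner_sum_right
      by (simp add: sum_distrib_left) (subst sum.swap, simp add: mult.left_commute)
    also have "\<dots> = (\<Sum>a\<in>Basis. \<Sum>b\<in>Basis. if a = b then (x \<bullet> a) * (y \<bullet> b) else 0)"
      by (intro sum.cong refl) (simp add: inn)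
    also have "\<dots> = x \<bullet> y" by (simp add: euclidean_inner[of x y])
    finally show ?thesis .
  qed
  with lin have T: "orthogonal_transformation T" by (simp add: orthogonal_transformation_def)
  let ?r = "\<lambda>f. \<lambda>b\<in>Basis. f (\<phi> b) :: real"
  have r[measurable]: "?r \<in> measurable (\<Pi>\<^sub>M b\<in>B. lborel) (\<Pi>\<^sub>M b\<in>Basis. lborel)"
    by (intro measurable_restrict measurable_component_singleton \<phi>B)
  have "distr (\<Pi>\<^sub>M b\<in>B. lborel) (\<Pi>\<^sub>M b\<in>Basis. lborel) ?r = (\<Pi>\<^sub>M b\<in>(Basis::(real^'n) set). (lborel::real measure))"
  proof (rule product_sigma_finite.PiM_eqI)
    show "product_sigma_finite (\<lambda>_. lborel::real measure)" ..
    fix A :: "real^'n \<Rightarrow> real set" assume A: "\<And>i. i \<in> Basis \<Longrightarrow> A i \<in> sets lborel"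
    interpret product_sigma_finite "\<lambda>_. lborel::real measure" ..
    have e: "?r -` Pi\<^sub>E Basis A \<inter> space (\<Pi>\<^sub>M b\<in>B. lborel) = Pi\<^sub>E B (\<lambda>b. A (inv_into Basis \<phi> b))"
    proof -
      have "(\<lambda>b\<in>Basis. f (\<phi> b)) \<in> Pi\<^sub>E Basis A \<longleftrightarrow> (\<forall>b\<in>B. f b \<in> A (inv_into Basis \<phi> b))" for f
      proof -
        have "(\<lambda>b\<in>Basis. f (\<phi> b)) \<in> Pi\<^sub>E Basis A \<longleftrightarrow> (\<forall>b\<in>Basis. f (\<phi> b) \<in> A b)"
          by (auto simp: PiE_def Pi_def)
        also have "\<dots> \<longleftrightarrow> (\<forall>b\<in>B. f b \<in> A (inv_into Basis \<phi> b))"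
        proof -
          have B: "B = \<phi> ` Basis" and "inj_on \<phi> Basis" using \<phi> by (auto simp: bij_betw_def)
          then show ?thesis unfolding B by simp
        qed
        finally show ?thesis .
      qed
      then show ?thesis by (auto simp: space_PiM PiE_def Pi_def)
    qed
    have iB: "inv_into Basis \<phi> b \<in> Basis" if "b \<in> B" for b
      using \<phi> that by (metis bij_betw_def inv_into_into)
    have "emeasure (distr (\<Pi>\<^sub>M b\<in>B. lborel) (\<Pi>\<^sub>M b\<in>Basis. lborel) ?r) (Pi\<^sub>E Basis A)
        = emeasure (\<Pi>\<^sub>M b\<in>B. lborel) (Pi\<^sub>E B (\<lambda>b. A (inv_into Basis \<phi> b)))"
      by (subst emeasure_distr[OF r]) (use A in \<open>auto simp: e intro!: sets_PiM_I_finite\<close>)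
    also have "\<dots> = (\<Prod>b\<in>B. emeasure lborel (A (inv_into Basis \<phi> b)))"
      using A iB by (intro emeasure_PiM fin) auto
    also have "\<dots> = (\<Prod>b\<in>Basis. emeasure lborel (A (inv_into Basis \<phi> (\<phi> b))))"
      by (rule prod.reindex_bij_betw[OF \<phi>, symmetric])
    also have "\<dots> = (\<Prod>b\<in>Basis. emeasure lborel (A b))"
      using \<phi> by (intro prod.cong refl) (simp add: bij_betw_def)
    finally show "emeasure (distr (\<Pi>\<^sub>M b\<in>B. lborel) (\<Pi>\<^sub>M b\<in>Basis. lborel) ?r) (Pi\<^sub>E Basis A)
        = (\<Prod>i\<in>Basis. emeasure lborel (A i))" .
  qed simp_all
  note pp = this
  have Tm[measurable]: "T \<in> borel_measurable borel" by (rule borel_measurable_linear[OF lin])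
  have s[measurable]: "(\<lambda>f. \<Sum>b\<in>(Basis::(real^'n) set). f b *\<^sub>R b) \<in> borel_measurable (\<Pi>\<^sub>M b\<in>Basis. lborel)"
    by measurable
  have "lborel = distr lborel borel T" by (rule distr_lborel_orthogonal[OF T, symmetric])
  also have "\<dots> = distr (distr (distr (\<Pi>\<^sub>M b\<in>B. lborel) (\<Pi>\<^sub>M b\<in>Basis. lborel) ?r) borel (\<lambda>f. \<Sum>b\<in>Basis. f b *\<^sub>R b)) borel T"
    unfolding pp by (subst lborel_eq) simp
  also have "\<dots> = distr (\<Pi>\<^sub>M b\<in>B. lborel) borel (T \<circ> ((\<lambda>f. \<Sum>b\<in>Basis. f b *\<^sub>R b) \<circ> ?r))"
    by (simp add: distr_distr comp_assoc)
  also have "T \<circ> ((\<lambda>f. \<Sum>b\<in>Basis. f b *\<^sub>R b) \<circ> ?r) = (\<lambda>f. \<Sum>b\<in>B. f b *\<^sub>R b)"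
  proof
    fix f :: "real^'n \<Rightarrow> real"
    have "(T \<circ> ((\<lambda>f. \<Sum>b\<in>Basis. f b *\<^sub>R b) \<circ> ?r)) f = (\<Sum>b\<in>Basis. f (\<phi> b) *\<^sub>R T b)"
      by (simp add: linear_sum[OF lin] linear_scale[OF lin])
    also have "\<dots> = (\<Sum>b\<in>Basis. f (\<phi> b) *\<^sub>R \<phi> b)"
    proof (intro sum.cong refl arg_cong2[where f=scaleR])
      fix b :: "real^'n" assume b: "b \<in> Basis"
      have "T b = (\<Sum>a\<in>Basis. if a = b then \<phi> a else 0)"
        unfolding T_def using b by (intro sum.cong refl) (auto simp: inner_Basis)
      also have "\<dots> = \<phi> b" using b by simp
      finally show "T b = \<phi> b" .
    qed
    also have "\<dots> = (\<Sum>b\<in>B. f b *\<^sub>R b)" by (rule sum.reindex_bij_betw[OF \<phi>])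
    finally show "(T \<circ> ((\<lambda>f. \<Sum>b\<in>Basis. f b *\<^sub>R b) \<circ> ?r)) f = (\<Sum>b\<in>B. f b *\<^sub>R b)" .
  qed
  finally show ?thesis ..
qed

definition hyperplane_measure :: "real^'n \<Rightarrow> (real^'n) measure" where
  "hyperplane_measure \<xi> = lborel_subspace {x. x \<bullet> \<xi> = 0}"

lemma sets_hyperplane_measure[simp, measurable_cong]: "sets (hyperplane_measure \<xi>) = sets borel"
  by (simp add: hyperplane_measure_def lborel_subspace_def Let_def)

lemma space_hyperplane_measure[simp]: "space (hyperplane_measure \<xi>) = UNIV"
  by (simp add: hyperplane_measure_def lborel_subspace_def Let_def)

lemma subspace_hyperplane': "subspace {x. x \<bullet> (\<xi>::'a::euclidean_space) = 0}"
  using subspace_hyperplane[of \<xi>] by (simp add: inner_commute)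

text \<open>The basis chosen for the hyperplane becomes an orthonormal basis of the whole space when
  \<open>\<xi>\<close> is adjoined; Fubini for the product measure then splits off the coordinate
  along \<open>\<xi>\<close>.\<close>

lemma nn_integral_lborel_slice:
  fixes \<xi> :: "real^'n"
  assumes \<xi>: "norm \<xi> = 1" and [measurable]: "F \<in> borel_measurable borel"
  shows "(\<integral>\<^sup>+x. F x \<partial>lborel) = (\<integral>\<^sup>+t. (\<integral>\<^sup>+x. F (t *\<^sub>R \<xi> + x) \<partial>hyperplane_measure \<xi>) \<partial>lborel)"
proof -
  let ?H = "{x. x \<bullet> \<xi> = 0}"
  define B where "B = (SOME B. orthonormal_basis_of ?H B)"
  have "orthonormal_basis_of ?H B"
    unfolding B_def using ex_orthonormal_basis_of[OF subspace_hyperplane'] by (rule someI_ex)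
  then have orth: "pairwise orthogonal B" and norm: "\<And>b. b \<in> B \<Longrightarrow> norm b = 1" and span: "span B = ?H"
    by (auto simp: orthonormal_basis_of_def)
  have fin: "finite B" using finite_orthonormal orth norm by blast
  have \<xi>\<xi>: "\<xi> \<bullet> \<xi> = 1" using \<xi> by (simp add: norm_eq_1)
  have "\<xi> \<notin> B" using span \<xi>\<xi> by (metis (mono_tags, lifting) mem_Collect_eq span_superset subsetD zero_neq_one)
  have BH: "b \<bullet> \<xi> = 0" if "b \<in> B" for b using span that span_superset by blast
  have orth': "pairwise orthogonal (insert \<xi> B)"
    using orth BH by (auto simp: pairwise_insert orthogonal_def inner_commute)
  have norm': "\<And>b. b \<in> insert \<xi> B \<Longrightarrow> norm b = 1" using norm \<xi> by auto
  have span': "span (insert \<xi> B) = UNIV"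
  proof -
    have "x \<in> span (insert \<xi> B)" for x
    proof -
      have "x - (x \<bullet> \<xi>) *\<^sub>R \<xi> \<in> span B" unfolding span by (simp add: inner_simps \<xi>\<xi>)
      then show ?thesis by (metis span_breakdown_eq)
    qed
    then show ?thesis by blast
  qed
  interpret product_sigma_finite "\<lambda>_. lborel::real measure" ..
  have m[measurable]: "(\<lambda>f. \<Sum>b\<in>B. f b *\<^sub>R b) \<in> borel_measurable (\<Pi>\<^sub>M b\<in>B. (lborel::real measure))"
    by measurable
  have m'[measurable]: "(\<lambda>f. \<Sum>b\<in>insert \<xi> B. f b *\<^sub>R b) \<in> borel_measurable (\<Pi>\<^sub>M b\<in>insert \<xi> B. (lborel::real measure))"
    by measurable
  have "(\<integral>\<^sup>+x. F x \<partial>lborel) = (\<integral>\<^sup>+f. F (\<Sum>b\<in>insert \<xi> B. f b *\<^sub>R b) \<partial>(\<Pi>\<^sub>M b\<in>insert \<xi> B. lborel))"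
    by (subst distr_PiM_orthonormal_basis[OF orth' norm' span', symmetric])
       (simp_all add: nn_integral_distr)
  also have "\<dots> = (\<integral>\<^sup>+t. (\<integral>\<^sup>+f. F (\<Sum>b\<in>insert \<xi> B. (f(\<xi>:=t)) b *\<^sub>R b) \<partial>(\<Pi>\<^sub>M b\<in>B. lborel)) \<partial>lborel)"
    by (rule product_nn_integral_insert_rev[OF fin \<open>\<xi> \<notin> B\<close>]) measurable
  also have "\<dots> = (\<integral>\<^sup>+t. (\<integral>\<^sup>+f. F (t *\<^sub>R \<xi> + (\<Sum>b\<in>B. f b *\<^sub>R b)) \<partial>(\<Pi>\<^sub>M b\<in>B. lborel)) \<partial>lborel)"
  proof -
    have "(\<Sum>b\<in>insert \<xi> B. (f(\<xi>:=t)) b *\<^sub>R b) = t *\<^sub>R \<xi> + (\<Sum>b\<in>B. f b *\<^sub>R b)" for f :: "real^'n \<Rightarrow> real" and t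
    proof -
      have "(\<Sum>b\<in>B. (f(\<xi>:=t)) b *\<^sub>R b) = (\<Sum>b\<in>B. f b *\<^sub>R b)"
        using \<open>\<xi> \<notin> B\<close> by (intro sum.cong) auto
      then show ?thesis using fin \<open>\<xi> \<notin> B\<close> by simp
    qed
    then show ?thesis by simp
  qed
  also have "\<dots> = (\<integral>\<^sup>+t. (\<integral>\<^sup>+x. F (t *\<^sub>R \<xi> + x) \<partial>hyperplane_measure \<xi>) \<partial>lborel)"
    unfolding hyperplane_measure_def lborel_subspace_def Let_def B_def[symmetric]
    by (simp add: nn_integral_distr)
  finally show ?thesis .
qed

lemma AE_hyperplane:
  fixes \<xi> :: "real^'n"
  shows "AE x in hyperplane_measure \<xi>. x \<bullet> \<xi> = 0"
proof -
  let ?H = "{x. x \<bullet> \<xi> = 0}"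
  define B where "B = (SOME B. orthonormal_basis_of ?H B)"
  have "orthonormal_basis_of ?H B"
    unfolding B_def using ex_orthonormal_basis_of[OF subspace_hyperplane'] by (rule someI_ex)
  then have "span B = ?H" by (auto simp: orthonormal_basis_of_def)
  then have "b \<in> B \<Longrightarrow> b \<bullet> \<xi> = 0" for b using span_superset by blast
  then show ?thesis
    unfolding hyperplane_measure_def lborel_subspace_def Let_def B_def[symmetric]
    by (subst AE_distr_iff) (auto simp: inner_sum_left)
qed

text \<open>Thickening the hyperplane to a slab of width \<open>c\<close> expresses its measure
  through \<open>lborel\<close>. Rotation and scaling behavior can then be taken from the ambient
  space, without reference to the chosen basis.\<close>

lemma nn_integral_hyperplane_eq:
  fixes \<xi> :: "real^'n"
  assumes \<xi>: "norm \<xi> = 1" and [measurable]: "g \<in> borel_measurable borel" and c: "0 \<le> c"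
  shows "ennreal c * (\<integral>\<^sup>+x. g x \<partial>hyperplane_measure \<xi>)
    = (\<integral>\<^sup>+x. g (x - (x \<bullet> \<xi>) *\<^sub>R \<xi>) * indicator {0..c} (x \<bullet> \<xi>) \<partial>lborel)"
proof -
  have \<xi>\<xi>: "\<xi> \<bullet> \<xi> = 1" using \<xi> by (simp add: norm_eq_1)
  have "(\<integral>\<^sup>+x. g (x - (x \<bullet> \<xi>) *\<^sub>R \<xi>) * indicator {0..c} (x \<bullet> \<xi>) \<partial>lborel)
    = (\<integral>\<^sup>+t. (\<integral>\<^sup>+x. g ((t *\<^sub>R \<xi> + x) - ((t *\<^sub>R \<xi> + x) \<bullet> \<xi>) *\<^sub>R \<xi>) * indicator {0..c} ((t *\<^sub>R \<xi> + x) \<bullet> \<xi>) \<partial>hyperplane_measure \<xi>) \<partial>lborel)"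
    by (rule nn_integral_lborel_slice[OF \<xi>]) measurable
  also have "\<dots> = (\<integral>\<^sup>+t. (\<integral>\<^sup>+x. g x * indicator {0..c} t \<partial>hyperplane_measure \<xi>) \<partial>lborel)"
    by (rule nn_integral_cong, rule nn_integral_cong_AE)
       (use AE_hyperplane[of \<xi>] in eventually_elim, simp add: inner_simps \<xi>\<xi>)
  also have "\<dots> = (\<integral>\<^sup>+t. (\<integral>\<^sup>+x. g x \<partial>hyperplane_measure \<xi>) * indicator {0..c} t \<partial>lborel)"
    by (intro nn_integral_cong nn_integral_multc) measurable
  also have "\<dots> = (\<integral>\<^sup>+x. g x \<partial>hyperplane_measure \<xi>) * c"
    using c by (subst nn_integral_cmult) auto
  finally show ?thesis by (simp add: mult.commute)
qed

lemma hyperplane_measure_orthogonal: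
  fixes \<xi> :: "real^'n" and T :: "real^'n \<Rightarrow> real^'n"
  assumes \<xi>: "norm \<xi> = 1" and T: "orthogonal_transformation T" and [measurable]: "g \<in> borel_measurable borel"
  shows "(\<integral>\<^sup>+x. g (T x) \<partial>hyperplane_measure \<xi>) = (\<integral>\<^sup>+x. g x \<partial>hyperplane_measure (T \<xi>))"
proof -
  have lin: "linear T" by (rule orthogonal_transformation_linear[OF T])
  have Tm[measurable]: "T \<in> borel_measurable borel" by (rule borel_measurable_linear[OF lin])
  have T\<xi>: "norm (T \<xi>) = 1" using T \<xi> by (simp add: orthogonal_transformation_norm)
  have "(\<integral>\<^sup>+x. g x \<partial>hyperplane_measure (T \<xi>))
     = (\<integral>\<^sup>+x. g (x - (x \<bullet> T \<xi>) *\<^sub>R T \<xi>) * indicator {0..1} (x \<bullet> T \<xi>) \<partial>distr lborel borel T)"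
    using nn_integral_hyperplane_eq[OF T\<xi>, of g 1] by (simp add: distr_lborel_orthogonal[OF T])
  also have "\<dots> = (\<integral>\<^sup>+x. g (T x - (T x \<bullet> T \<xi>) *\<^sub>R T \<xi>) * indicator {0..1} (T x \<bullet> T \<xi>) \<partial>lborel)"
    by (rule nn_integral_distr) measurable
  also have "\<dots> = (\<integral>\<^sup>+x. g (T (x - (x \<bullet> \<xi>) *\<^sub>R \<xi>)) * indicator {0..1} (x \<bullet> \<xi>) \<partial>lborel)"
    using T by (simp add: orthogonal_transformation_def linear_diff linear_scale)
  also have "\<dots> = (\<integral>\<^sup>+x. g (T x) \<partial>hyperplane_measure \<xi>)"
    using nn_integral_hyperplane_eq[OF \<xi>, of "\<lambda>x. g (T x)" 1] by simp
  finally show ?thesis ..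
qed

lemma nn_integral_lborel_scaleR:
  fixes g :: "'a::euclidean_space \<Rightarrow> ennreal"
  assumes [measurable]: "g \<in> borel_measurable borel" and c: "0 < c"
  shows "(\<integral>\<^sup>+x. g x \<partial>lborel) = ennreal (c ^ DIM('a)) * (\<integral>\<^sup>+x. g (c *\<^sub>R x) \<partial>lborel)"
  using c by (subst lborel_affine[of c "0::'a"])
     (simp_all add: nn_integral_density nn_integral_distr nn_integral_cmult)

lemma hyperplane_measure_scaleR:
  fixes \<xi> :: "real^'n"
  assumes \<xi>: "norm \<xi> = 1" and [measurable]: "g \<in> borel_measurable borel" and c: "0 < c"
  shows "(\<integral>\<^sup>+x. g x \<partial>hyperplane_measure \<xi>)
    = ennreal (c ^ (CARD('n) - 1)) * (\<integral>\<^sup>+x. g (c *\<^sub>R x) \<partial>hyperplane_measure \<xi>)"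
proof -
  \<comment> \<open>The slab of width \<open>c\<close> is the dilated slab of width 1; the factor
    \<open>c\<close> due to the width turns the exponent \<open>n\<close> into
    \<open>n - 1\<close>.\<close>
  have "c * (\<integral>\<^sup>+x. g x \<partial>hyperplane_measure \<xi>)
      = (\<integral>\<^sup>+x. g (x - (x \<bullet> \<xi>) *\<^sub>R \<xi>) * indicator {0..c} (x \<bullet> \<xi>) \<partial>lborel)"
    using nn_integral_hyperplane_eq[OF \<xi>, of g c] c by simp
  also have "\<dots> = ennreal (c ^ CARD('n)) *
      (\<integral>\<^sup>+x. g (c *\<^sub>R x - ((c *\<^sub>R x) \<bullet> \<xi>) *\<^sub>R \<xi>) * indicator {0..c} ((c *\<^sub>R x) \<bullet> \<xi>) \<partial>lborel)"
    using nn_integral_lborel_scaleR[OF _ c, of "\<lambda>x. g (x - (x \<bullet> \<xi>) *\<^sub>R \<xi>) * indicator {0..c} (x \<bullet> \<xi>)"]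
    by simp
  also have "(\<integral>\<^sup>+x. g (c *\<^sub>R x - ((c *\<^sub>R x) \<bullet> \<xi>) *\<^sub>R \<xi>) * indicator {0..c} ((c *\<^sub>R x) \<bullet> \<xi>) \<partial>lborel)
    = (\<integral>\<^sup>+x. g (c *\<^sub>R (x - (x \<bullet> \<xi>) *\<^sub>R \<xi>)) * indicator {0..1} (x \<bullet> \<xi>) \<partial>lborel)"
  proof (rule nn_integral_cong, goal_cases)
    case (1 x)
    have "c * (x \<bullet> \<xi>) \<in> {0..c} \<longleftrightarrow> (x \<bullet> \<xi>) \<in> {0..1}" using c by (auto simp: zero_le_mult_iff)
    then show ?case
      by (simp add: indicator_def algebra_simps)
  qed
  also have "\<dots> = (\<integral>\<^sup>+x. g (c *\<^sub>R x) \<partial>hyperplane_measure \<xi>)"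
    using nn_integral_hyperplane_eq[OF \<xi>, of "\<lambda>x. g (c *\<^sub>R x)" 1] by simp
  finally have *: "ennreal c * (\<integral>\<^sup>+x. g x \<partial>hyperplane_measure \<xi>)
     = ennreal (c ^ CARD('n)) * (\<integral>\<^sup>+x. g (c *\<^sub>R x) \<partial>hyperplane_measure \<xi>)" .
  have "c ^ CARD('n) = c * c ^ (CARD('n) - 1)" by (metis power_Suc zero_less_card_finite Suc_pred')
  with * c have "ennreal c * (\<integral>\<^sup>+x. g x \<partial>hyperplane_measure \<xi>)
     = ennreal c * (ennreal (c ^ (CARD('n) - 1)) * (\<integral>\<^sup>+x. g (c *\<^sub>R x) \<partial>hyperplane_measure \<xi>))"
    by (simp add: ennreal_mult mult.assoc)
  with c show ?thesis by (subst (asm) ennreal_mult_cancel_left) auto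
qed

lemma emeasure_hyperplane_cball:
  fixes \<xi> :: "real^'n"
  assumes \<xi>: "norm \<xi> = 1" and r: "0 \<le> r"
  shows "emeasure (hyperplane_measure \<xi>) (cball 0 r) < \<infinity>"
proof -
  have "emeasure (hyperplane_measure \<xi>) (cball 0 r)
    = (\<integral>\<^sup>+x. indicator (cball 0 r) (x - (x \<bullet> \<xi>) *\<^sub>R \<xi>) * indicator {0..1} (x \<bullet> \<xi>) \<partial>lborel)"
    using nn_integral_hyperplane_eq[OF \<xi>, of "indicator (cball 0 r)" 1]
    by (simp add: borel_measurable_indicator)
  also have "\<dots> \<le> (\<integral>\<^sup>+x. indicator (cball (0::real^'n) (r + 1)) x \<partial>lborel)"
  proof (rule nn_integral_mono, goal_cases)
    case (1 x)
    have "norm x \<le> r + 1" if "norm (x - (x \<bullet> \<xi>) *\<^sub>R \<xi>) \<le> r" "0 \<le> x \<bullet> \<xi>" "x \<bullet> \<xi> \<le> 1"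
      using that \<xi> norm_triangle_ineq[of "x - (x \<bullet> \<xi>) *\<^sub>R \<xi>" "(x \<bullet> \<xi>) *\<^sub>R \<xi>"] by simp
    then show ?case
      by (auto simp: indicator_def)
  qed
  also have "\<dots> < \<infinity>" using emeasure_compact_finite[OF compact_cball, of "0::real^'n" "r + 1"] by simp
  finally show ?thesis .
qed

lemma sigma_finite_hyperplane_measure:
  fixes \<xi> :: "real^'n"
  assumes \<xi>: "norm \<xi> = 1"
  shows "sigma_finite_measure (hyperplane_measure \<xi>)"
proof
  show "\<exists>A. countable A \<and> A \<subseteq> sets (hyperplane_measure \<xi>) \<and> \<Union> A = space (hyperplane_measure \<xi>)
     \<and> (\<forall>a\<in>A. emeasure (hyperplane_measure \<xi>) a \<noteq> \<infinity>)"
  proof (intro exI conjI ballI)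
    show "countable (range (\<lambda>n::nat. cball (0::real^'n) (real n)))" by simp
    show "\<Union> (range (\<lambda>n::nat. cball 0 (real n))) = space (hyperplane_measure \<xi>)"
      by (auto simp: real_arch_simple)
    fix a assume "a \<in> range (\<lambda>n::nat. cball (0::real^'n) (real n))"
    then show "emeasure (hyperplane_measure \<xi>) a \<noteq> \<infinity>" using emeasure_hyperplane_cball[OF \<xi>] by (auto simp: less_top)
  qed auto
qed

lemma distr_pair_hyperplane:
  fixes \<xi> :: "real^'n"
  assumes \<xi>: "norm \<xi> = 1"
  shows "distr (lborel \<Otimes>\<^sub>M hyperplane_measure \<xi>) borel (\<lambda>(t,x). t *\<^sub>R \<xi> + x) = lborel"
proof (rule measure_eqI)
  let ?P = "lborel \<Otimes>\<^sub>M hyperplane_measure \<xi>" and ?f = "\<lambda>(t,x). t *\<^sub>R \<xi> + x"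
  interpret sigma_finite_measure "hyperplane_measure \<xi>" by (rule sigma_finite_hyperplane_measure[OF \<xi>])
  fix A assume "A \<in> sets (distr ?P borel ?f)"
  then have [measurable]: "A \<in> sets borel" by simp
  have m[measurable]: "?f \<in> borel_measurable ?P" by measurable
  have "emeasure (distr ?P borel ?f) A
    = (\<integral>\<^sup>+x. indicator A x \<partial>distr ?P borel ?f)" by simp
  also have "\<dots> = (\<integral>\<^sup>+p. indicator A (case p of (t,x) \<Rightarrow> t *\<^sub>R \<xi> + x) \<partial>?P)"
    by (rule nn_integral_distr) measurable
  also have "\<dots> = (\<integral>\<^sup>+t. \<integral>\<^sup>+x. indicator A (t *\<^sub>R \<xi> + x) \<partial>hyperplane_measure \<xi> \<partial>lborel)"
    by (subst nn_integral_fst[symmetric]) auto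
  also have "\<dots> = emeasure lborel A"
    using nn_integral_lborel_slice[OF \<xi>, of "indicator A"] by simp
  finally show "emeasure (distr ?P borel ?f) A = emeasure lborel A" .
qed simp

lemma integral_lborel_slice:
  fixes \<xi> :: "real^'n" and F :: "real^'n \<Rightarrow> real"
  assumes \<xi>: "norm \<xi> = 1" and F: "integrable lborel F"
  shows "(\<integral>x. F x \<partial>lborel) = (\<integral>t. (\<integral>x. F (t *\<^sub>R \<xi> + x) \<partial>hyperplane_measure \<xi>) \<partial>lborel)"
proof -
  let ?P = "lborel \<Otimes>\<^sub>M hyperplane_measure \<xi>" and ?f = "\<lambda>(t,x). t *\<^sub>R \<xi> + x"
  interpret L: sigma_finite_measure "hyperplane_measure \<xi>" by (rule sigma_finite_hyperplane_measure[OF \<xi>])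
  interpret pair_sigma_finite "lborel :: real measure" "hyperplane_measure \<xi>" ..
  have m[measurable]: "?f \<in> borel_measurable ?P" by measurable
  have [measurable]: "F \<in> borel_measurable borel" using F by simp
  have "integrable (distr ?P borel ?f) F"
    by (simp add: distr_pair_hyperplane[OF \<xi>] F)
  then have int: "integrable ?P (\<lambda>p. F (case p of (t,x) \<Rightarrow> t *\<^sub>R \<xi> + x))"
    by (subst (asm) integrable_distr_eq) auto
  have "(\<integral>x. F x \<partial>lborel) = (\<integral>x. F x \<partial>distr ?P borel ?f)"
    by (simp add: distr_pair_hyperplane[OF \<xi>])
  also have "\<dots> = (\<integral>p. F (case p of (t,x) \<Rightarrow> t *\<^sub>R \<xi> + x) \<partial>?P)"
    by (rule integral_distr) measurable
  also have "\<dots> = (\<integral>t. (\<integral>x. F (t *\<^sub>R \<xi> + x) \<partial>hyperplane_measure \<xi>) \<partial>lborel)"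
    using integral_fst'[OF int] by simp
  finally show ?thesis .
qed

section \<open>Polar coordinates\<close>

lemma nn_integral_power_Icc:
  assumes "0 \<le> a"
  shows "(\<integral>\<^sup>+x. ennreal (x ^ p) * indicator {0..a} x \<partial>lborel) = ennreal (a ^ (p + 1) / real (p + 1))"
proof -
  have "((\<lambda>x. x ^ (p + 1) / real (p + 1)) has_real_derivative x ^ p) (at x)" for x :: real
    using DERIV_cdivide[OF DERIV_pow[of "p + 1" x], of "real (p + 1)"] by simp
  then have "(\<integral>\<^sup>+x. ennreal (x ^ p) * indicator {0..a} x \<partial>lborel)
      = ennreal (a ^ (p + 1) / real (p + 1) - 0 ^ (p + 1) / real (p + 1))"
    using assms by (intro nn_integral_FTC_Icc) auto
  then show ?thesis by simp
qed

text \<open>Treats Lebesgue measure on the space and on a hyperplane at once; polar coordinates rest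
  on this scaling law and, for Fubini, on sigma-finiteness.\<close>

definition homogeneous_measure :: "nat \<Rightarrow> 'a::euclidean_space measure \<Rightarrow> bool" where
  "homogeneous_measure D \<mu> \<longleftrightarrow> sets \<mu> = sets borel \<and> sigma_finite_measure \<mu> \<and> 0 < D
     \<and> (\<forall>g c. g \<in> borel_measurable borel \<longrightarrow> 0 < c \<longrightarrow>
          (\<integral>\<^sup>+x. g x \<partial>\<mu>) = ennreal (c ^ D) * (\<integral>\<^sup>+x. g (c *\<^sub>R x) \<partial>\<mu>))"

lemma homogeneous_measureD:
  assumes "homogeneous_measure D \<mu>"
  shows "sets \<mu> = sets borel" "sigma_finite_measure \<mu>" "0 < D"
    "\<And>g c. g \<in> borel_measurable borel \<Longrightarrow> 0 < c \<Longrightarrow>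
        (\<integral>\<^sup>+x. g x \<partial>\<mu>) = ennreal (c ^ D) * (\<integral>\<^sup>+x. g (c *\<^sub>R x) \<partial>\<mu>)"
  using assms unfolding homogeneous_measure_def by blast+

lemma homogeneous_lborel: "homogeneous_measure DIM('a) (lborel :: 'a::euclidean_space measure)"
  unfolding homogeneous_measure_def
  by (intro conjI allI impI nn_integral_lborel_scaleR) (simp_all add: sigma_finite_lborel)

lemma homogeneous_hyperplane:
  fixes \<xi> :: "real^'n"
  assumes "norm \<xi> = 1" "2 \<le> CARD('n)"
  shows "homogeneous_measure (CARD('n) - 1) (hyperplane_measure \<xi>)"
  unfolding homogeneous_measure_def
proof (intro conjI allI impI)
  show "sigma_finite_measure (hyperplane_measure \<xi>)" by (rule sigma_finite_hyperplane_measure[OF assms(1)])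
  fix g :: "real^'n \<Rightarrow> ennreal" and c :: real assume "g \<in> borel_measurable borel" "0 < c"
  then show "(\<integral>\<^sup>+x. g x \<partial>hyperplane_measure \<xi>)
      = ennreal (c ^ (CARD('n) - 1)) * (\<integral>\<^sup>+x. g (c *\<^sub>R x) \<partial>hyperplane_measure \<xi>)"
    by (rule hyperplane_measure_scaleR[OF assms(1)])
qed (use assms(2) in simp_all)

text \<open>The set \<open>{0}\<close> is invariant under doubling, so its mass, which is finite,
  equals \<open>2 ^ D\<close> times itself.\<close>

lemma homogeneous_AE_nonzero:
  fixes \<mu> :: "'a::euclidean_space measure"
  assumes "homogeneous_measure D \<mu>"
  shows "AE x in \<mu>. x \<noteq> 0"
proof -
  have [measurable_cong]: "sets \<mu> = sets borel" and D: "0 < D" using homogeneous_measureD[OF assms] by blast+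
  have sp: "space \<mu> = UNIV" using sets_eq_imp_space_eq[of \<mu> borel] \<open>sets \<mu> = sets borel\<close> by simp
  interpret sigma_finite_measure \<mu> by (rule homogeneous_measureD[OF assms])
  have "(\<integral>\<^sup>+x. indicator {0::'a} x \<partial>\<mu>) = ennreal (2 ^ D) * (\<integral>\<^sup>+x. indicator {0::'a} (2 *\<^sub>R x) \<partial>\<mu>)"
    by (rule homogeneous_measureD(4)[OF assms]) simp_all
  also have "(\<lambda>x. indicator {0::'a} (2 *\<^sub>R x) :: ennreal) = indicator {0}"
    by (auto simp: indicator_def)
  finally have e: "emeasure \<mu> {0} = ennreal (2 ^ D) * emeasure \<mu> {0}"
    by simp
  have fin: "emeasure \<mu> {0} \<noteq> \<infinity>"
  proof -
    obtain A where A: "range A \<subseteq> sets \<mu>" "(\<Union>i. A i) = space \<mu>" "\<And>i::nat. emeasure \<mu> (A i) \<noteq> \<infinity>"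
      using sigma_finite by metis
    obtain i where "0 \<in> A i" using A(2) sp by auto
    then have "emeasure \<mu> {0} \<le> emeasure \<mu> (A i)" using A(1) by (intro emeasure_mono) auto
    then show ?thesis using A(3)[of i] by (auto simp: top_unique)
  qed
  then obtain r where r: "emeasure \<mu> {0} = ennreal r" "0 \<le> r"
    by (cases "emeasure \<mu> {0}") auto
  have "r = 2 ^ D * r" using e r by (simp add: ennreal_mult[symmetric])
  then have "r = 0 \<or> (2::real) ^ D = 1" by simp
  moreover have "(2::real) ^ D > 1" using D by (simp add: one_less_power)
  ultimately have "emeasure \<mu> {0} = 0" using r by simp
  then have "{0} \<in> null_sets \<mu>" by (simp add: null_sets_def \<open>sets \<mu> = sets borel\<close>)
  then show ?thesis by (rule AE_I') auto
qed

text \<open>Polar coordinates with the annulus \<open>1/2 \<le> |z| \<le> 1\<close> in place of the unit sphere: the inner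
  integral over the ray depends on \<open>z\<close> only up to scaling, and \<open>ln 2\<close> is the mass of
  \<open>d\<lambda>/\<lambda>\<close> on the admissible scales.\<close>

lemma nn_integral_annulus:
  fixes \<mu> :: "'a::euclidean_space measure"
  assumes \<mu>: "homogeneous_measure D \<mu>" and [measurable]: "F \<in> borel_measurable borel"
  shows "ennreal (ln 2) * (\<integral>\<^sup>+x. F x \<partial>\<mu>)
    = (\<integral>\<^sup>+z. indicator {1/2..1} (norm z) *
        (\<integral>\<^sup>+l. F (l *\<^sub>R z) * ennreal (l ^ (D - 1)) * indicator {0<..} l \<partial>lborel) \<partial>\<mu>)"
proof -
  have [measurable_cong]: "sets \<mu> = sets borel" and D: "0 < D" using homogeneous_measureD[OF \<mu>] by blast+
  interpret M: sigma_finite_measure \<mu> by (rule homogeneous_measureD[OF \<mu>])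
  interpret pair_sigma_finite \<mu> "lborel::real measure" ..
  have scale: "(\<integral>\<^sup>+x. g x \<partial>\<mu>) = ennreal (c ^ D) * (\<integral>\<^sup>+x. g (c *\<^sub>R x) \<partial>\<mu>)"
    if "g \<in> borel_measurable borel" "0 < c" for g c
    using homogeneous_measureD(4)[OF \<mu>] that by blast
  \<comment> \<open>The density \<open>1 / l\<close> on the scales \<open>l\<close> for which
    \<open>x / l\<close> lies in the annulus. Substituting \<open>x = l z\<close> at fixed
    \<open>l\<close> brings in \<open>l ^ D\<close>, and \<open>l ^ D / l\<close> is the Jacobian
    \<open>l ^ (D - 1)\<close>.\<close>
  define \<kappa> :: "'a \<Rightarrow> real \<Rightarrow> ennreal"
    where "\<kappa> x l = (if norm x \<le> l \<and> l \<le> 2 * norm x \<and> 0 < l then ennreal (1 / l) else 0)" for x l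
  have [measurable]: "(\<lambda>(x, l). \<kappa> x l) \<in> borel_measurable (borel \<Otimes>\<^sub>M borel)"
    unfolding \<kappa>_def by measurable
  have "(\<integral>\<^sup>+z. indicator {1/2..1} (norm z) *
        (\<integral>\<^sup>+l. F (l *\<^sub>R z) * ennreal (l ^ (D - 1)) * indicator {0<..} l \<partial>lborel) \<partial>\<mu>)
    = (\<integral>\<^sup>+z. (\<integral>\<^sup>+l. indicator {1/2..1} (norm z) *
        (F (l *\<^sub>R z) * ennreal (l ^ (D - 1)) * indicator {0<..} l) \<partial>lborel) \<partial>\<mu>)"
    by (intro nn_integral_cong nn_integral_cmult[symmetric]) measurable
  also have "\<dots> = (\<integral>\<^sup>+l. (\<integral>\<^sup>+z. indicator {1/2..1} (norm z) *
        (F (l *\<^sub>R z) * ennreal (l ^ (D - 1)) * indicator {0<..} l) \<partial>\<mu>) \<partial>lborel)"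
    by (rule Fubini'[symmetric]) measurable
  also have "\<dots> = (\<integral>\<^sup>+l. (\<integral>\<^sup>+x. F x * \<kappa> x l \<partial>\<mu>) \<partial>lborel)"
  proof (rule nn_integral_cong, goal_cases)
    case (1 l)
    show ?case
    proof (cases "0 < l")
      case True
      have lD: "l ^ D * (1 / l) = l ^ (D - 1)"
        using D True by (cases D) auto
      have ind: "\<kappa> (l *\<^sub>R z) l = indicator {1/2..1} (norm z) * ennreal (1 / l)" for z :: 'a
      proof -
        have "l * norm z \<le> l \<and> l \<le> 2 * (l * norm z) \<longleftrightarrow> norm z \<in> {1/2..1}"
          using True mult_le_cancel_left_pos[of l "norm z" 1] mult_le_cancel_left_pos[of l 1 "2 * norm z"]
          by (auto simp: mult.left_commute)
        then show ?thesis using True by (auto simp: indicator_def \<kappa>_def)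
      qed
      have "(\<integral>\<^sup>+x. F x * \<kappa> x l \<partial>\<mu>)
        = ennreal (l ^ D) * (\<integral>\<^sup>+z. F (l *\<^sub>R z) * (indicator {1/2..1} (norm z) * ennreal (1 / l)) \<partial>\<mu>)"
        unfolding ind[symmetric] by (rule scale[OF _ True]) measurable
      also have "\<dots> = (\<integral>\<^sup>+z. ennreal (l ^ D) * (F (l *\<^sub>R z) * (indicator {1/2..1} (norm z) * ennreal (1 / l))) \<partial>\<mu>)"
        by (rule nn_integral_cmult[symmetric]) measurable
      also have "\<dots> = (\<integral>\<^sup>+z. indicator {1/2..1} (norm z) * (F (l *\<^sub>R z) * ennreal (l ^ (D - 1))) \<partial>\<mu>)"
      proof (rule nn_integral_cong, goal_cases)
        case (1 z)
        have "ennreal (l ^ D) * (F (l *\<^sub>R z) * (indicator {1/2..1} (norm z) * ennreal (1 / l)))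
          = indicator {1/2..1} (norm z) * (F (l *\<^sub>R z) * (ennreal (l ^ D) * ennreal (1 / l)))"
          by (simp only: mult_ac)
        also have "ennreal (l ^ D) * ennreal (1 / l) = ennreal (l ^ (D - 1))"
          unfolding lD[symmetric] using True by (intro ennreal_mult[symmetric]) auto
        finally show ?case .
      qed
      finally show ?thesis using True by simp
    qed (simp add: \<kappa>_def)
  qed
  also have "\<dots> = (\<integral>\<^sup>+x. (\<integral>\<^sup>+l. F x * \<kappa> x l \<partial>lborel) \<partial>\<mu>)"
    by (rule Fubini') measurable
  also have "\<dots> = (\<integral>\<^sup>+x. ennreal (ln 2) * F x \<partial>\<mu>)"
  proof (rule nn_integral_cong_AE)
    have "(\<integral>\<^sup>+l. F x * \<kappa> x l \<partial>lborel) = ennreal (ln 2) * F x"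
      if "x \<noteq> 0" for x
    proof -
      have nx: "0 < norm x" using that by simp
      then have nl: "norm x \<le> l \<Longrightarrow> 0 < l" for l by linarith
      have "(\<integral>\<^sup>+l. \<kappa> x l \<partial>lborel) = (\<integral>\<^sup>+l. ennreal (1 / l) * indicator {norm x..2 * norm x} l \<partial>lborel)"
      proof (rule nn_integral_cong, goal_cases)
        case (1 l)
        show ?case
          using nl[of l] by (cases "norm x \<le> l") (simp_all add: indicator_def \<kappa>_def)
      qed
      also have "\<dots> = ennreal (ln (2 * norm x) - ln (norm x))"
        using nx by (intro nn_integral_FTC_Icc) (auto intro!: derivative_eq_intros dest: nl)
      also have "\<dots> = ennreal (ln 2)" using nx that by (simp add: ln_mult)
      finally show ?thesis by (subst nn_integral_cmult) (auto simp: mult.commute)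
    qed
    with homogeneous_AE_nonzero[OF \<mu>] show "AE x in \<mu>. (\<integral>\<^sup>+l. F x * \<kappa> x l \<partial>lborel) = ennreal (ln 2) * F x"
      by auto
  qed
  also have "\<dots> = ennreal (ln 2) * (\<integral>\<^sup>+x. F x \<partial>\<mu>)" by (rule nn_integral_cmult) measurable
  finally show ?thesis ..
qed

text \<open>In polar coordinates the weight leaves \<open>l ^ (m - 1)\<close> on each ray, with
  integral \<open>f ^ m / m\<close> up to the length of \<open>z\<close>, whereas on the ball the
  ray gives \<open>f ^ m / D\<close>. Thus an integral of \<open>f ^ m\<close> over directions
  becomes a volume with the weight \<open>|x| ^ - k\<close>.\<close>

lemma nn_integral_star_body:
  fixes \<mu> :: "'a::euclidean_space measure"
  assumes \<mu>: "homogeneous_measure D \<mu>" and [measurable]: "f \<in> borel_measurable borel"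
    and f: "\<And>x. 0 \<le> f x" and m: "0 < m" and D: "k + m = D"
  shows "ennreal (real m) * (\<integral>\<^sup>+x. indicator {x. norm x \<le> f (sgn x)} x * ennreal ((1 / norm x) ^ k) \<partial>\<mu>)
    = ennreal (real D) * (\<integral>\<^sup>+x. indicator (cball 0 1) x * ennreal (f (sgn x) ^ m) \<partial>\<mu>)"
proof -
  have [measurable_cong]: "sets \<mu> = sets borel" by (rule homogeneous_measureD[OF \<mu>])
  have [measurable]: "(\<lambda>x::'a. f (sgn x)) \<in> borel_measurable borel" by measurable
  have [measurable]: "{x. norm x \<le> f (sgn x)} \<in> sets borel" by measurable
  define I where "I = (\<integral>\<^sup>+z. indicator {1/2..1} (norm z) * ennreal ((1 / norm z) ^ D * f (sgn z) ^ m) \<partial>\<mu>)"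
  have in1: "(\<integral>\<^sup>+l. indicator {x. norm x \<le> f (sgn x)} (l *\<^sub>R z) * ennreal ((1 / norm (l *\<^sub>R z)) ^ k) * ennreal (l ^ (D - 1)) * indicator {0<..} l \<partial>lborel)
      = ennreal (1 / real m) * ennreal ((1 / norm z) ^ D * f (sgn z) ^ m)" if z: "0 < norm z" for z :: 'a
  proof -
    have "AE l::real in lborel. l \<noteq> 0" by (rule AE_lborel_singleton)
    then have "(\<integral>\<^sup>+l. indicator {x. norm x \<le> f (sgn x)} (l *\<^sub>R z) * ennreal ((1 / norm (l *\<^sub>R z)) ^ k) * ennreal (l ^ (D - 1)) * indicator {0<..} l \<partial>lborel)
        = (\<integral>\<^sup>+l. ennreal ((1 / norm z) ^ k) * (ennreal (l ^ (m - 1)) * indicator {0..f (sgn z) / norm z} l) \<partial>lborel)"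
    proof (intro nn_integral_cong_AE, eventually_elim)
      case (elim l)
      show ?case
      proof (cases "0 < l")
        case True
        have "D - 1 = k + (m - 1)" using D m by simp
        then have "(1 / norm (l *\<^sub>R z)) ^ k * l ^ (D - 1) = (1 / norm z) ^ k * l ^ (m - 1)"
          using True z by (simp add: power_add field_simps)
        then have "ennreal ((1 / norm (l *\<^sub>R z)) ^ k) * ennreal (l ^ (D - 1)) = ennreal ((1 / norm z) ^ k) * ennreal (l ^ (m - 1))"
          using True by (simp add: ennreal_mult[symmetric] del: norm_scaleR)
        moreover have "l *\<^sub>R z \<in> {x. norm x \<le> f (sgn x)} \<longleftrightarrow> l \<in> {0..f (sgn z) / norm z}"
          using True z by (simp add: sgn_scaleR field_simps)
        ultimately show ?thesis using True by (auto simp: indicator_def)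
      next
        case False
        then show ?thesis using \<open>l \<noteq> 0\<close> by (auto simp: indicator_def)
      qed
    qed
    also have "\<dots> = ennreal ((1 / norm z) ^ k) * ennreal ((f (sgn z) / norm z) ^ m / real m)"
      using nn_integral_power_Icc[of "f (sgn z) / norm z" "m - 1"] m f[of "sgn z"]
      by (subst nn_integral_cmult) auto
    also have "\<dots> = ennreal (1 / real m) * ennreal ((1 / norm z) ^ D * f (sgn z) ^ m)"
      using f[of "sgn z"] by (simp add: ennreal_mult[symmetric] D[symmetric] power_add power_divide)
    finally show ?thesis .
  qed
  have in2: "(\<integral>\<^sup>+l. indicator (cball 0 1) (l *\<^sub>R z) * ennreal (f (sgn (l *\<^sub>R z)) ^ m) * ennreal (l ^ (D - 1)) * indicator {0<..} l \<partial>lborel)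
      = ennreal (1 / real D) * ennreal ((1 / norm z) ^ D * f (sgn z) ^ m)" if z: "0 < norm z" for z :: 'a
  proof -
    have "AE l::real in lborel. l \<noteq> 0" by (rule AE_lborel_singleton)
    then have "(\<integral>\<^sup>+l. indicator (cball 0 1) (l *\<^sub>R z) * ennreal (f (sgn (l *\<^sub>R z)) ^ m) * ennreal (l ^ (D - 1)) * indicator {0<..} l \<partial>lborel)
        = (\<integral>\<^sup>+l. ennreal (f (sgn z) ^ m) * (ennreal (l ^ (D - 1)) * indicator {0..1 / norm z} l) \<partial>lborel)"
    proof (intro nn_integral_cong_AE, eventually_elim)
      case (elim l)
      show ?case
      proof (cases "0 < l")
        case True
        have "l *\<^sub>R z \<in> cball 0 1 \<longleftrightarrow> l \<in> {0..1 / norm z}"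
          using True z by (simp add: field_simps)
        then show ?thesis using True by (auto simp: indicator_def sgn_scaleR)
      next
        case False
        then show ?thesis using \<open>l \<noteq> 0\<close> by (auto simp: indicator_def)
      qed
    qed
    also have "\<dots> = ennreal (f (sgn z) ^ m) * ennreal ((1 / norm z) ^ D / real D)"
      using nn_integral_power_Icc[of "1 / norm z" "D - 1"] m D
      by (subst nn_integral_cmult) auto
    also have "\<dots> = ennreal (1 / real D) * ennreal ((1 / norm z) ^ D * f (sgn z) ^ m)"
      using f[of "sgn z"] by (simp add: ennreal_mult[symmetric])
    finally show ?thesis .
  qed
  have gen: "ennreal c * (ennreal (ln 2) * (\<integral>\<^sup>+x. F x \<partial>\<mu>)) = I"
    if F[measurable]: "F \<in> borel_measurable borel" and c: "0 < c" and
      F': "\<And>z. 0 < norm z \<Longrightarrow> (\<integral>\<^sup>+l. F (l *\<^sub>R z) * ennreal (l ^ (D - 1)) * indicator {0<..} l \<partial>lborel)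
        = ennreal (1 / c) * ennreal ((1 / norm z) ^ D * f (sgn z) ^ m)" for F c
  proof -
    have "ennreal (ln 2) * (\<integral>\<^sup>+x. F x \<partial>\<mu>)
      = (\<integral>\<^sup>+z. ennreal (1 / c) * (indicator {1/2..1} (norm z) * ennreal ((1 / norm z) ^ D * f (sgn z) ^ m)) \<partial>\<mu>)"
      unfolding nn_integral_annulus[OF \<mu> F]
    proof (rule nn_integral_cong)
      fix z :: 'a
      show "indicator {1/2..1} (norm z) * (\<integral>\<^sup>+l. F (l *\<^sub>R z) * ennreal (l ^ (D - 1)) * indicator {0<..} l \<partial>lborel)
        = ennreal (1 / c) * (indicator {1/2..1} (norm z) * ennreal ((1 / norm z) ^ D * f (sgn z) ^ m))"
      proof (cases "0 < norm z")
        case True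
        show ?thesis unfolding F'[OF True] by (rule mult.left_commute)
      qed simp
    qed
    also have "\<dots> = ennreal (1 / c) * I"
      unfolding I_def by (rule nn_integral_cmult) measurable
    finally have "ennreal c * (ennreal (ln 2) * (\<integral>\<^sup>+x. F x \<partial>\<mu>)) = ennreal (c * (1 / c)) * I"
      using c by (simp only: mult.assoc[symmetric] ennreal_mult[symmetric] less_imp_le divide_nonneg_pos zero_le_one)
    then show ?thesis using c by simp
  qed
  have meas1: "(\<lambda>x. indicator {x. norm x \<le> f (sgn x)} x * ennreal ((1 / norm x) ^ k)) \<in> borel_measurable borel"
    by measurable
  have meas2: "(\<lambda>x::'a. indicator (cball 0 1) x * ennreal (f (sgn x) ^ m)) \<in> borel_measurable borel"
    by (intro borel_measurable_times_ennreal borel_measurable_indicator) auto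
  have m': "0 < real m" and D': "0 < real D" using m D by auto
  have eq1: "ennreal (real m) * (ennreal (ln 2) * (\<integral>\<^sup>+x. indicator {x. norm x \<le> f (sgn x)} x * ennreal ((1 / norm x) ^ k) \<partial>\<mu>)) = I"
    by (rule gen[of "\<lambda>x. indicator {x. norm x \<le> f (sgn x)} x * ennreal ((1 / norm x) ^ k)" "real m", OF meas1 m' in1])
  have eq2: "ennreal (real D) * (ennreal (ln 2) * (\<integral>\<^sup>+x. indicator (cball 0 1) x * ennreal (f (sgn x) ^ m) \<partial>\<mu>)) = I"
    by (rule gen[of "\<lambda>x. indicator (cball 0 1) x * ennreal (f (sgn x) ^ m)" "real D", OF meas2 D' in2])
  have "a * x = c * y" if "a * (ennreal (ln 2) * x) = i" "c * (ennreal (ln 2) * y) = i" for a c x y i :: ennreal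
  proof -
    have "ennreal (ln 2) * (a * x) = ennreal (ln 2) * (c * y)" using that by (metis mult.left_commute)
    moreover have "ennreal (ln 2) \<noteq> 0" "ennreal (ln 2) \<noteq> top" by (simp_all add: ennreal_eq_0_iff not_le)
    ultimately show ?thesis unfolding ennreal_mult_cancel_left by blast
  qed
  from this[OF eq1 eq2] show ?thesis .
qed

section \<open>Moments on hyperplanes and dual sections\<close>

lemma sets_borel_cball [measurable]: "cball (c::'a::euclidean_space) a \<in> sets borel"
  by simp

lemma distr_hyperplane_orthogonal:
  fixes \<xi> :: "real^'n" and T :: "real^'n \<Rightarrow> real^'n"
  assumes \<xi>: "norm \<xi> = 1" and T: "orthogonal_transformation T"
  shows "distr (hyperplane_measure \<xi>) borel T = hyperplane_measure (T \<xi>)"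
proof (rule measure_eqI)
  have [measurable]: "T \<in> borel_measurable borel"
    by (rule borel_measurable_linear[OF orthogonal_transformation_linear[OF T]])
  fix A assume "A \<in> sets (distr (hyperplane_measure \<xi>) borel T)"
  then have A: "A \<in> sets borel" by simp
  have "emeasure (distr (hyperplane_measure \<xi>) borel T) A = (\<integral>\<^sup>+x. indicator A (T x) \<partial>hyperplane_measure \<xi>)"
    using A nn_integral_distr[of T "hyperplane_measure \<xi>" borel "indicator A"] by simp
  also have "\<dots> = emeasure (hyperplane_measure (T \<xi>)) A"
    using hyperplane_measure_orthogonal[OF \<xi> T, of "indicator A"] A by simp
  finally show "emeasure (distr (hyperplane_measure \<xi>) borel T) A = emeasure (hyperplane_measure (T \<xi>)) A" .
qed simp

lemma integral_hyperplane_orthogonal: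
  fixes \<xi> :: "real^'n" and T :: "real^'n \<Rightarrow> real^'n" and F :: "real^'n \<Rightarrow> real"
  assumes \<xi>: "norm \<xi> = 1" and T: "orthogonal_transformation T" and [measurable]: "F \<in> borel_measurable borel"
  shows "(\<integral>x. F x \<partial>hyperplane_measure (T \<xi>)) = (\<integral>x. F (T x) \<partial>hyperplane_measure \<xi>)"
proof -
  have [measurable]: "T \<in> borel_measurable borel"
    by (rule borel_measurable_linear[OF orthogonal_transformation_linear[OF T]])
  show ?thesis
    unfolding distr_hyperplane_orthogonal[OF \<xi> T, symmetric] by (rule integral_distr) measurable
qed

lemma integral_hyperplane_scaleR:
  fixes \<xi> :: "real^'n" and F :: "real^'n \<Rightarrow> real"
  assumes \<xi>: "norm \<xi> = 1" and F[measurable]: "F \<in> borel_measurable borel" and c: "0 < c"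
  shows "(\<integral>x. F x \<partial>hyperplane_measure \<xi>) = c ^ (CARD('n) - 1) * (\<integral>x. F (c *\<^sub>R x) \<partial>hyperplane_measure \<xi>)"
proof -
  let ?M = "density (distr (hyperplane_measure \<xi>) borel (\<lambda>x. c *\<^sub>R x)) (\<lambda>_. ennreal (c ^ (CARD('n) - 1)))"
  have "hyperplane_measure \<xi> = ?M"
  proof (rule measure_eqI)
    fix A assume "A \<in> sets (hyperplane_measure \<xi>)"
    then have A[measurable]: "A \<in> sets borel" by simp
    have "emeasure ?M A = (\<integral>\<^sup>+x. ennreal (c ^ (CARD('n) - 1)) * indicator A x \<partial>distr (hyperplane_measure \<xi>) borel (\<lambda>x. c *\<^sub>R x))"
      by (rule emeasure_density) (use A in simp_all)
    also have "\<dots> = (\<integral>\<^sup>+x. ennreal (c ^ (CARD('n) - 1)) * indicator A (c *\<^sub>R x) \<partial>hyperplane_measure \<xi>)"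
      by (rule nn_integral_distr) measurable
    also have "\<dots> = ennreal (c ^ (CARD('n) - 1)) * (\<integral>\<^sup>+x. indicator A (c *\<^sub>R x) \<partial>hyperplane_measure \<xi>)"
      by (rule nn_integral_cmult) measurable
    also have "\<dots> = (\<integral>\<^sup>+x. indicator A x \<partial>hyperplane_measure \<xi>)"
      by (rule hyperplane_measure_scaleR[OF \<xi> _ c, symmetric]) measurable
    finally show "emeasure (hyperplane_measure \<xi>) A = emeasure ?M A" by simp
  qed simp
  then have "(\<integral>x. F x \<partial>hyperplane_measure \<xi>) = (\<integral>x. F x \<partial>?M)" by simp
  also have "\<dots> = (\<integral>x. c ^ (CARD('n) - 1) *\<^sub>R F x \<partial>distr (hyperplane_measure \<xi>) borel (\<lambda>x. c *\<^sub>R x))"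
    by (rule integral_density) (use c in simp_all)
  also have "\<dots> = (\<integral>x. c ^ (CARD('n) - 1) *\<^sub>R F (c *\<^sub>R x) \<partial>hyperplane_measure \<xi>)"
    by (rule integral_distr) measurable
  finally show ?thesis by simp
qed

lemma orthogonal_transformation_reflect:
  fixes v :: "'a::euclidean_space"
  shows "orthogonal_transformation (\<lambda>x. x - (2 * (x \<bullet> v) / (v \<bullet> v)) *\<^sub>R v)"
proof (cases "v = 0")
  case False
  then have v: "v \<bullet> v \<noteq> 0" by simp
  have "(x - (2 * (x \<bullet> v) / (v \<bullet> v)) *\<^sub>R v) \<bullet> (y - (2 * (y \<bullet> v) / (v \<bullet> v)) *\<^sub>R v) = x \<bullet> y" for x y
  proof -
    define a b where "a = 2 * (x \<bullet> v) / (v \<bullet> v)" and "b = 2 * (y \<bullet> v) / (v \<bullet> v)"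
    have a: "a * (v \<bullet> v) = 2 * (x \<bullet> v)" and b: "b * (v \<bullet> v) = 2 * (y \<bullet> v)"
      using v by (simp_all add: a_def b_def)
    have "(x - a *\<^sub>R v) \<bullet> (y - b *\<^sub>R v) = x \<bullet> y - b * (x \<bullet> v) - a * (y \<bullet> v) + a * (b * (v \<bullet> v))"
      by (simp add: inner_diff_left inner_diff_right inner_commute[of v y] algebra_simps)
    also have "\<dots> = x \<bullet> y - b * (x \<bullet> v) + a * (y \<bullet> v)"
      by (simp add: b)
    also have "b * (x \<bullet> v) = a * (y \<bullet> v)" by (simp add: a_def b_def)
    finally show ?thesis by (simp add: a_def b_def)
  qed
  moreover have "linear (\<lambda>x. x - (2 * (x \<bullet> v) / (v \<bullet> v)) *\<^sub>R v)"
    by (rule linearI) (simp_all add: inner_simps algebra_simps add_divide_distrib)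
  ultimately show ?thesis by (simp add: orthogonal_transformation_def)
qed simp

text \<open>After \<open>\<omega>\<close> has been moved to \<open>\<omega>'\<close>, the reflection
  exchanging \<open>S e\<close> and \<open>e'\<close> fixes \<open>\<omega>'\<close>, which is
  orthogonal to both.\<close>

lemma orthogonal_transformation_exists_2:
  fixes \<omega> e \<omega>' e' :: "real^'n"
  assumes "norm \<omega> = 1" "norm e = 1" "\<omega> \<bullet> e = 0" "norm \<omega>' = 1" "norm e' = 1" "\<omega>' \<bullet> e' = 0"
  shows "\<exists>T. orthogonal_transformation T \<and> T \<omega> = \<omega>' \<and> T e = e'"
proof -
  obtain S where S: "orthogonal_transformation S" "S \<omega> = \<omega>'"
    using orthogonal_transformation_exists[of \<omega> \<omega>'] assms by metis
  have Se: "norm (S e) = 1" "S e \<bullet> \<omega>' = 0"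
    using S assms by (auto simp: orthogonal_transformation_norm orthogonal_transformation_def inner_commute)
  define v where "v = S e - e'"
  define R where "R x = x - (2 * (x \<bullet> v) / (v \<bullet> v)) *\<^sub>R v" for x
  have R: "orthogonal_transformation R" unfolding R_def by (rule orthogonal_transformation_reflect)
  have "\<omega>' \<bullet> v = 0" using Se assms by (simp add: v_def inner_simps inner_commute)
  then have 1: "R \<omega>' = \<omega>'" by (simp add: R_def)
  have 2: "R (S e) = e'"
  proof (cases "v = 0")
    case False
    have "v \<bullet> v = 2 * (S e \<bullet> v)"
      using Se assms by (simp add: v_def inner_simps norm_eq_1 inner_commute)
    moreover have "v \<bullet> v \<noteq> 0" using False by simp
    ultimately have "2 * (S e \<bullet> v) / (v \<bullet> v) = 1" by (metis divide_self)
    then have "R (S e) = S e - v" by (simp only: R_def scaleR_one)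
    then show ?thesis by (simp add: v_def)
  qed (simp add: R_def v_def)
  have "orthogonal_transformation (R \<circ> S)" using R S(1) by (rule orthogonal_transformation_compose)
  then show ?thesis using 1 2 S by (intro exI[of _ "R \<circ> S"]) auto
qed

section \<open>Weighted moments of balls in a hyperplane\<close>

lemma ex_orthonormal_pair:
  assumes "2 \<le> CARD('n)"
  shows "\<exists>\<omega> e :: real^'n. norm \<omega> = 1 \<and> norm e = 1 \<and> \<omega> \<bullet> e = 0"
proof -
  obtain i j :: 'n where "i \<noteq> j"
    using assms card_2_iff' by (metis (full_types) One_nat_def UNIV_I card_1_singleton_iff card_le_Suc0_iff_eq finite not_less_eq_eq numeral_2_eq_2)
  then show ?thesis
    by (intro exI[of _ "axis i 1"] exI[of _ "axis j 1"]) (auto simp: inner_axis_axis)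
qed

definition hyperplane_moment :: "nat \<Rightarrow> real^'n \<Rightarrow> real^'n \<Rightarrow> nat \<Rightarrow> real \<Rightarrow> real" where
  "hyperplane_moment k \<omega> y i a =
    (\<integral>x. indicator (cball 0 a) x * ((1 / norm x) ^ k * (x \<bullet> y) ^ i) \<partial>hyperplane_measure \<omega>)"

context
  fixes k m :: nat
  assumes km: "k + m = CARD('n::finite) - 1" and m: "0 < m" and n2: "2 \<le> CARD('n)"
begin

text \<open>The ball is the star body with constant radial function \<open>a\<close>. The weight is
  integrable because \<open>k\<close> is smaller than the dimension \<open>n - 1\<close>.\<close>

lemma weight_finite:
  fixes \<omega> :: "real^'n"
  assumes \<omega>: "norm \<omega> = 1" and a: "0 \<le> a"
  shows "(\<integral>\<^sup>+x. indicator (cball 0 a) x * ennreal ((1 / norm x) ^ k) \<partial>hyperplane_measure \<omega>) < \<infinity>"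
proof -
  let ?W = "\<integral>\<^sup>+x. indicator (cball 0 a) x * ennreal ((1 / norm x) ^ k) \<partial>hyperplane_measure \<omega>"
  have c: "{x. norm x \<le> a} = cball (0::real^'n) a" by (auto simp: dist_norm)
  have "ennreal (real m) * ?W
      = ennreal (real (CARD('n) - 1)) * (\<integral>\<^sup>+x. indicator (cball 0 1) x * ennreal (a ^ m) \<partial>hyperplane_measure \<omega>)"
    using nn_integral_star_body[OF homogeneous_hyperplane[OF \<omega> n2], of "\<lambda>_. a" m k] a m km unfolding c by simp
  also have "(\<integral>\<^sup>+x. indicator (cball 0 1) x * ennreal (a ^ m) \<partial>hyperplane_measure \<omega>)
      = emeasure (hyperplane_measure \<omega>) (cball 0 1) * ennreal (a ^ m)"
    by (subst nn_integral_multc) auto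
  also have "ennreal (real (CARD('n) - 1)) * \<dots> < top"
    using emeasure_hyperplane_cball[OF \<omega>, of 1] by (simp add: ennreal_mult_less_top)
  finally show ?thesis using m by (auto simp: ennreal_mult_less_top)
qed

lemma moment_integrable:
  fixes \<omega> :: "real^'n"
  assumes \<omega>: "norm \<omega> = 1" and a: "0 \<le> a"
  shows "integrable (hyperplane_measure \<omega>) (\<lambda>x. indicator (cball 0 a) x * ((1 / norm x) ^ k * (x \<bullet> y) ^ i))"
proof -
  have 1: "integrable (hyperplane_measure \<omega>) (\<lambda>x. indicator (cball 0 a) x * (1 / norm x) ^ k)"
  proof (rule integrableI_bounded)
    have "(\<integral>\<^sup>+x. ennreal (norm (indicator (cball 0 a) x * (1 / norm x) ^ k)) \<partial>hyperplane_measure \<omega>)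
        = (\<integral>\<^sup>+x. indicator (cball 0 a) x * ennreal ((1 / norm x) ^ k) \<partial>hyperplane_measure \<omega>)"
      by (intro nn_integral_cong) (auto simp: indicator_def)
    then show "(\<integral>\<^sup>+x. ennreal (norm (indicator (cball 0 a) x * (1 / norm x) ^ k)) \<partial>hyperplane_measure \<omega>) < \<infinity>"
      using weight_finite[OF \<omega> a] by simp
  qed measurable
  show ?thesis
  proof (rule Bochner_Integration.integrable_bound)
    show "integrable (hyperplane_measure \<omega>) (\<lambda>x. (a * norm y) ^ i * (indicator (cball 0 a) x * (1 / norm x) ^ k))"
      using 1 by simp
    show "AE x in hyperplane_measure \<omega>. norm (indicator (cball 0 a) x * ((1 / norm x) ^ k * (x \<bullet> y) ^ i))
      \<le> norm ((a * norm y) ^ i * (indicator (cball 0 a) x * (1 / norm x) ^ k))"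
    proof (rule AE_I2)
      fix x :: "real^'n"
      have "\<bar>x \<bullet> y\<bar> ^ i \<le> (a * norm y) ^ i" if "norm x \<le> a"
        by (rule power_mono[OF order_trans[OF Cauchy_Schwarz_ineq2 mult_right_mono[OF that]]]) simp_all
      then show "norm (indicator (cball 0 a) x * ((1 / norm x) ^ k * (x \<bullet> y) ^ i))
        \<le> norm ((a * norm y) ^ i * (indicator (cball 0 a) x * (1 / norm x) ^ k))"
        using a by (auto simp: indicator_def abs_mult power_abs mult.commute intro!: mult_right_mono)
    qed
  qed measurable
qed

lemma moment_orthogonal:
  fixes \<omega> y :: "real^'n" and T :: "real^'n \<Rightarrow> real^'n"
  assumes \<omega>: "norm \<omega> = 1" and T: "orthogonal_transformation T"
  shows "hyperplane_moment k (T \<omega>) (T y) i a = hyperplane_moment k \<omega> y i a"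
proof -
  have "hyperplane_moment k (T \<omega>) (T y) i a
    = (\<integral>x. indicator (cball 0 a) (T x) * ((1 / norm (T x)) ^ k * (T x \<bullet> T y) ^ i) \<partial>hyperplane_measure \<omega>)"
    unfolding hyperplane_moment_def by (rule integral_hyperplane_orthogonal[OF \<omega> T]) measurable
  moreover have "indicator (cball 0 a) (T x) = (indicator (cball 0 a) x :: real)" for x
    using T by (simp add: indicator_def orthogonal_transformation_norm)
  ultimately show ?thesis
    using T by (simp add: hyperplane_moment_def orthogonal_transformation_norm)
       (simp add: orthogonal_transformation_def)
qed

lemma moment_scale:
  fixes \<omega> y :: "real^'n"
  assumes \<omega>: "norm \<omega> = 1" and a: "0 < a"
  shows "hyperplane_moment k \<omega> y i a = a ^ (m + i) * hyperplane_moment k \<omega> y i 1"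
proof -
  have e: "a ^ (CARD('n) - 1) * ((1 / a) ^ k * a ^ i) = a ^ (m + i)"
    unfolding km[symmetric] power_add using a by (simp add: field_simps)
  have "hyperplane_moment k \<omega> y i a = a ^ (CARD('n) - 1) *
    (\<integral>x. indicator (cball 0 a) (a *\<^sub>R x) * ((1 / norm (a *\<^sub>R x)) ^ k * ((a *\<^sub>R x) \<bullet> y) ^ i) \<partial>hyperplane_measure \<omega>)"
    unfolding hyperplane_moment_def by (rule integral_hyperplane_scaleR[OF \<omega> _ a]) measurable
  also have "(\<lambda>x. indicator (cball 0 a) (a *\<^sub>R x) * ((1 / norm (a *\<^sub>R x)) ^ k * ((a *\<^sub>R x) \<bullet> y) ^ i))
    = (\<lambda>x. ((1 / a) ^ k * a ^ i) * (indicator (cball 0 1) x * ((1 / norm x) ^ k * (x \<bullet> y) ^ i)))"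
    using a by (auto simp: fun_eq_iff indicator_def power_mult_distrib power_divide)
  also have "a ^ (CARD('n) - 1) * (\<integral>x. ((1 / a) ^ k * a ^ i) * (indicator (cball 0 1) x * ((1 / norm x) ^ k * (x \<bullet> y) ^ i)) \<partial>hyperplane_measure \<omega>)
    = (a ^ (CARD('n) - 1) * ((1 / a) ^ k * a ^ i)) * hyperplane_moment k \<omega> y i 1"
    by (simp only: integral_mult_right_zero hyperplane_moment_def mult.assoc)
  finally show ?thesis unfolding e .
qed

lemma moment_zero_radius:
  fixes \<omega> y :: "real^'n"
  assumes \<omega>: "norm \<omega> = 1"
  shows "hyperplane_moment k \<omega> y i 0 = 0"
  unfolding hyperplane_moment_def
  by (rule integral_eq_zero_AE)
     (use homogeneous_AE_nonzero[OF homogeneous_hyperplane[OF \<omega> n2]] in \<open>eventually_elim, simp add: indicator_def\<close>)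

lemma moment_direction:
  fixes \<omega> y e :: "real^'n"
  assumes \<omega>: "norm \<omega> = 1" and e: "norm e = 1" "\<omega> \<bullet> e = 0" and y: "y - (y \<bullet> \<omega>) *\<^sub>R \<omega> = c *\<^sub>R e"
  shows "hyperplane_moment k \<omega> y i a = c ^ i * hyperplane_moment k \<omega> e i a"
proof -
  have "hyperplane_moment k \<omega> y i a
    = (\<integral>x. c ^ i * (indicator (cball 0 a) x * ((1 / norm x) ^ k * (x \<bullet> e) ^ i)) \<partial>hyperplane_measure \<omega>)"
    unfolding hyperplane_moment_def
  proof (rule integral_cong_AE)
    show "AE x in hyperplane_measure \<omega>. indicator (cball 0 a) x * ((1 / norm x) ^ k * (x \<bullet> y) ^ i)
      = c ^ i * (indicator (cball 0 a) x * ((1 / norm x) ^ k * (x \<bullet> e) ^ i))"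
      using AE_hyperplane[of \<omega>]
    proof eventually_elim
      case x: (elim x)
      have "x \<bullet> y = x \<bullet> (y - (y \<bullet> \<omega>) *\<^sub>R \<omega>)" using x by (simp add: inner_simps)
      also have "\<dots> = c * (x \<bullet> e)" unfolding y by simp
      finally show ?case
        by (simp add: power_mult_distrib)
    qed
  qed measurable
  then show ?thesis by (simp add: hyperplane_moment_def)
qed

lemma moment_odd:
  fixes \<omega> y :: "real^'n"
  assumes \<omega>: "norm \<omega> = 1" and i: "odd i"
  shows "hyperplane_moment k \<omega> y i a = 0"
proof -
  have T: "orthogonal_transformation (uminus :: real^'n \<Rightarrow> real^'n)"
    using orthogonal_transformation_neg[of "\<lambda>x::real^'n. x"] by (simp add: orthogonal_transformation_id)
  have "hyperplane_measure (- \<omega>) = hyperplane_measure \<omega>" by (simp add: hyperplane_measure_def)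
  then have "hyperplane_moment k \<omega> (- y) i a = hyperplane_moment k \<omega> y i a"
    using moment_orthogonal[OF \<omega> T, of y i a] by (simp add: hyperplane_moment_def)
  moreover have "hyperplane_moment k \<omega> (- y) i a = - hyperplane_moment k \<omega> y i a"
    using i by (simp add: hyperplane_moment_def)
  ultimately show ?thesis by simp
qed

text \<open>Strict positivity is what later rules out cancellation in the leading
  coefficients.\<close>

lemma moment_even_pos:
  fixes \<omega> e :: "real^'n"
  assumes \<omega>: "norm \<omega> = 1" and e: "norm e = 1" "\<omega> \<bullet> e = 0" and i: "even i"
  shows "0 < hyperplane_moment k \<omega> e i 1"
proof -
  define F where "F x = indicator (cball 0 1) x * ((1 / norm x) ^ k * (x \<bullet> e) ^ i)" for x :: "real^'n"
  have [measurable]: "F \<in> borel_measurable borel" unfolding F_def by measurable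
  have F0: "0 \<le> F x" for x using i by (simp add: F_def indicator_def zero_le_even_power)
  \<comment> \<open>The ball of radius 1/4 about \<open>p\<close> lies in the slab
    \<open>0 \<le> x \<bullet> \<omega> \<le> 1\<close>, and its projection lies in the unit ball at
    points with \<open>e\<close>-coordinate at least 1/4.\<close>
  define p where "p = (1/2) *\<^sub>R e + (1/2) *\<^sub>R \<omega>"
  have pe: "p \<bullet> e = 1/2" and p\<omega>: "p \<bullet> \<omega> = 1/2"
    using e \<omega> by (simp_all add: p_def inner_simps norm_eq_1 inner_commute)
  have lower: "ennreal ((1/4) ^ i) * indicator (cball p (1/4)) x
      \<le> ennreal (F (x - (x \<bullet> \<omega>) *\<^sub>R \<omega>)) * indicator {0..1} (x \<bullet> \<omega>)" for x
  proof (cases "x \<in> cball p (1/4)")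
    case True
    then have d: "norm (x - p) \<le> 1/4" by (simp add: dist_norm norm_minus_commute)
    define z where "z = x - (x \<bullet> \<omega>) *\<^sub>R \<omega>"
    have "\<bar>(x - p) \<bullet> e\<bar> \<le> 1/4" "\<bar>(x - p) \<bullet> \<omega>\<bar> \<le> 1/4"
      using Cauchy_Schwarz_ineq2[of "x - p" e] Cauchy_Schwarz_ineq2[of "x - p" \<omega>] d e \<omega> by auto
    then have xe: "1/4 \<le> x \<bullet> e" and x\<omega>: "0 \<le> x \<bullet> \<omega>" "x \<bullet> \<omega> \<le> 1"
      using pe p\<omega> unfolding inner_diff_left by linarith+
    have ze: "z \<bullet> e = x \<bullet> e" using e by (simp add: z_def inner_simps)
    have "z \<bullet> z \<le> x \<bullet> x"
      using \<omega> by (simp add: z_def inner_simps norm_eq_1 inner_commute)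
    then have "norm z \<le> norm x" by (simp add: norm_le)
    moreover have "norm p \<le> 3/4"
    proof (rule power2_le_imp_le)
      have "(norm p)\<^sup>2 = 1/2" unfolding power2_norm_eq_inner
        using e \<omega> by (simp add: p_def inner_simps norm_eq_1 inner_commute)
      then show "(norm p)\<^sup>2 \<le> (3/4)\<^sup>2" by (simp add: power2_eq_square)
    qed simp
    ultimately have nz: "norm z \<le> 1" using norm_triangle_ineq[of p "x - p"] d by simp
    have z0: "0 < norm z" using ze xe by auto
    have "1 * (1/4) ^ i \<le> (1 / norm z) ^ k * (z \<bullet> e) ^ i"
      using nz z0 xe ze by (intro mult_mono one_le_power power_mono) auto
    then have "(1/4) ^ i \<le> F z" using nz by (simp add: F_def)
    then show ?thesis using True x\<omega> by (simp add: z_def[symmetric] ennreal_leI)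
  qed simp
  have "0 < ennreal ((1/4) ^ i) * emeasure lborel (cball p (1/4))"
    using content_cball_pos[of "1/4" p] by (auto simp: ennreal_zero_less_mult_iff measure_def enn2real_positive_iff)
  also have "\<dots> = (\<integral>\<^sup>+x. ennreal ((1/4) ^ i) * indicator (cball p (1/4)) x \<partial>lborel)"
    by (subst nn_integral_cmult) auto
  also have "\<dots> \<le> (\<integral>\<^sup>+x. ennreal (F (x - (x \<bullet> \<omega>) *\<^sub>R \<omega>)) * indicator {0..1} (x \<bullet> \<omega>) \<partial>lborel)"
    by (intro nn_integral_mono lower)
  also have "\<dots> = (\<integral>\<^sup>+x. ennreal (F x) \<partial>hyperplane_measure \<omega>)"
    using nn_integral_hyperplane_eq[OF \<omega>, of "\<lambda>x. ennreal (F x)" 1] by simp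
  also have "\<dots> = ennreal (hyperplane_moment k \<omega> e i 1)"
    unfolding hyperplane_moment_def F_def[symmetric]
    using moment_integrable[OF \<omega>, of 1 e i] F0 by (intro nn_integral_eq_integral) (simp_all add: F_def)
  finally show ?thesis by simp
qed

text \<open>Orthogonal maps carry every orthonormal pair to every other, so a single number per
  degree remains; the dependence on the radius and on \<open>y\<close> follows by scaling and by
  projecting \<open>y\<close> to the hyperplane.\<close>

lemma ex_moment_constants:
  "\<exists>Z. (\<forall>(\<omega> :: real^'n) y i a. norm \<omega> = 1 \<longrightarrow> 0 \<le> a \<longrightarrow>
          hyperplane_moment k \<omega> y i a = a ^ (m + i) * norm (y - (y \<bullet> \<omega>) *\<^sub>R \<omega>) ^ i * Z i)
     \<and> (\<forall>i. odd i \<longrightarrow> Z i = 0) \<and> (\<forall>i. even i \<longrightarrow> 0 < Z i)"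
proof -
  obtain \<omega>\<^sub>0 e\<^sub>0 :: "real^'n" where 0: "norm \<omega>\<^sub>0 = 1" "norm e\<^sub>0 = 1" "\<omega>\<^sub>0 \<bullet> e\<^sub>0 = 0"
    using ex_orthonormal_pair[OF n2] by blast
  define Z where "Z i = hyperplane_moment k \<omega>\<^sub>0 e\<^sub>0 i 1" for i
  have unit: "hyperplane_moment k \<omega> e i 1 = Z i" if e: "norm \<omega> = 1" "norm e = 1" "\<omega> \<bullet> e = 0" for \<omega> e :: "real^'n" and i
  proof -
    obtain T where T: "orthogonal_transformation T" "T \<omega>\<^sub>0 = \<omega>" "T e\<^sub>0 = e"
      using orthogonal_transformation_exists_2[OF 0 e] by blast
    show ?thesis using moment_orthogonal[OF 0(1) T(1), of e\<^sub>0 i 1] by (simp add: T Z_def)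
  qed
  have "hyperplane_moment k \<omega> y i a = a ^ (m + i) * norm (y - (y \<bullet> \<omega>) *\<^sub>R \<omega>) ^ i * Z i"
    if \<omega>: "norm \<omega> = 1" and a: "0 \<le> a" for \<omega> y :: "real^'n" and i a
  proof (cases "a = 0")
    case True
    then show ?thesis using moment_zero_radius[OF \<omega>] m by simp
  next
    case False
    define y' where "y' = y - (y \<bullet> \<omega>) *\<^sub>R \<omega>"
    obtain e where e: "norm e = 1" "\<omega> \<bullet> e = 0" "y' = norm y' *\<^sub>R e"
    proof (cases "y' = 0")
      \<comment> \<open>Here \<open>y\<close> is a multiple of \<open>\<omega>\<close> and any unit
        vector orthogonal to \<open>\<omega>\<close> will do; for \<open>i = 0\<close> the factor
        \<open>0 ^ 0 = 1\<close> gives the right value.\<close>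
      case True
      obtain T where T: "orthogonal_transformation T" "T \<omega>\<^sub>0 = \<omega>"
        using orthogonal_transformation_exists[of \<omega>\<^sub>0 \<omega>] 0 \<omega> by metis
      have "\<omega> \<bullet> T e\<^sub>0 = 0" using T 0(3) by (metis orthogonal_transformation_def)
      then show ?thesis using that[of "T e\<^sub>0"] True T(1) 0 by (simp add: orthogonal_transformation_norm)
    next
      case False
      have "\<omega> \<bullet> y' = 0" using \<omega> by (simp add: y'_def inner_simps norm_eq_1 inner_commute)
      then show ?thesis using that[of "(1 / norm y') *\<^sub>R y'"] False by simp
    qed
    have "hyperplane_moment k \<omega> y i a = a ^ (m + i) * hyperplane_moment k \<omega> y i 1"
      using False a by (intro moment_scale[OF \<omega>]) simp
    also have "hyperplane_moment k \<omega> y i 1 = norm y' ^ i * Z i"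
      using moment_direction[OF \<omega> e(1,2), of y "norm y'" i 1] e(3) unit[OF \<omega> e(1,2)] by (simp add: y'_def)
    finally show ?thesis by (simp add: y'_def)
  qed
  moreover have "Z i = 0" if "odd i" for i using moment_odd[OF 0(1) that] by (simp add: Z_def)
  moreover have "0 < Z i" if "even i" for i using moment_even_pos[OF 0 that] by (simp add: Z_def)
  ultimately show ?thesis by blast
qed

text \<open>The sphere enters through cones over its subsets, so the spherical integral is
  \<open>n - 1\<close> times an integral over the unit ball, which cancels the factor
  \<open>1 / (n - 1)\<close>; the formula for star bodies turns the latter into a weighted volume of
  the slice. With \<open>t \<xi>\<close> interior to \<open>K\<close>, the translated body has a
  positive bounded radial function.\<close>

lemma nn_integral_section:
  fixes K :: "(real^'n) set" and \<xi> :: "real^'n"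
  assumes ev: "even m" and \<xi>: "norm \<xi> = 1"
    and K: "compact K" "convex K" and t: "t *\<^sub>R \<xi> \<in> interior K"
  shows "(\<integral>\<^sup>+x. indicator K (t *\<^sub>R \<xi> + x) * ennreal ((1 / norm x) ^ k) \<partial>hyperplane_measure \<xi>)
    = ennreal (real (CARD('n) - 1) / real m * dual_section_fun K m \<xi> t)"
proof -
  let ?H = "{x. x \<bullet> \<xi> = 0}"
  let ?D = "real (CARD('n) - 1)"
  define L where "L = (\<lambda>x. x - t *\<^sub>R \<xi>) ` K"
  have L: "compact L" "convex L" "0 \<in> interior L"
  proof -
    show "compact L" "convex L" unfolding L_def using K
      by (simp_all add: compact_translation_subtract convex_translation_subtract)
    show "0 \<in> interior L" unfolding L_def interior_translation_subtract using t by force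
  qed
  have memL: "x \<in> L \<longleftrightarrow> t *\<^sub>R \<xi> + x \<in> K" for x
    unfolding L_def by (auto simp: image_iff algebra_simps intro!: bexI[of _ "t *\<^sub>R \<xi> + x"])
  have rm[measurable]: "radial_fun L \<in> borel_measurable borel" by (rule borel_measurable_radial_fun[OF L])
  \<comment> \<open>The formula for star bodies wants a function nonnegative everywhere, while the
    radial function is unspecified at \<open>0\<close>.\<close>
  define f where "f x = (if x = 0 then 0 else radial_fun L x)" for x
  have fm[measurable]: "f \<in> borel_measurable borel" unfolding f_def by measurable
  have f0: "0 \<le> f x" for x using radial_fun_Greatest(1)[OF L, of x] by (auto simp: f_def)
  have nz: "AE x in hyperplane_measure \<xi>. x \<noteq> 0"
    by (rule homogeneous_AE_nonzero[OF homogeneous_hyperplane[OF \<xi> n2]])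
  define Y where "Y = (\<integral>\<^sup>+x. indicator K (t *\<^sub>R \<xi> + x) * ennreal ((1 / norm x) ^ k) \<partial>hyperplane_measure \<xi>)"
  define X where "X = (\<integral>\<^sup>+x. indicator (cball 0 1) x * ennreal (f (sgn x) ^ m) \<partial>hyperplane_measure \<xi>)"
  have "Y = (\<integral>\<^sup>+x. indicator {x. norm x \<le> f (sgn x)} x * ennreal ((1 / norm x) ^ k) \<partial>hyperplane_measure \<xi>)"
    unfolding Y_def
  proof (rule nn_integral_cong_AE, use nz in eventually_elim)
    case x: (elim x)
    then have "norm x \<le> f (sgn x) \<longleftrightarrow> t *\<^sub>R \<xi> + x \<in> K"
      using radial_fun_sgn_iff[OF L x] by (simp add: f_def memL sgn_zero_iff)
    then show ?case by (simp add: indicator_def)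
  qed
  then have XY: "ennreal (real m) * Y = ennreal ?D * X"
    unfolding X_def by (simp only: nn_integral_star_body[OF homogeneous_hyperplane[OF \<xi> n2] fm f0 m km])
  have Sph: "(\<integral>\<^sup>+\<theta>. ennreal (radial_fun L \<theta> ^ m) \<partial>sphere_measure ?H) = ennreal ?D * X"
  proof -
    have [measurable]: "sgn \<in> borel_measurable (restrict_space (hyperplane_measure \<xi>) (cball 0 1))"
      by (intro measurable_restrict_space1) measurable
    have "dim ?H = CARD('n) - 1"
      using dim_hyperplane[of \<xi>] \<xi> by (force simp: inner_commute)
    then have "(\<integral>\<^sup>+\<theta>. ennreal (radial_fun L \<theta> ^ m) \<partial>sphere_measure ?H)
      = of_nat (CARD('n) - 1) * (\<integral>\<^sup>+\<theta>. ennreal (radial_fun L \<theta> ^ m) \<partial>distr (restrict_space (hyperplane_measure \<xi>) (cball 0 1)) borel sgn)"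
      unfolding sphere_measure_def hyperplane_measure_def[symmetric]
      by (subst nn_integral_scale_measure) auto
    also have "(\<integral>\<^sup>+\<theta>. ennreal (radial_fun L \<theta> ^ m) \<partial>distr (restrict_space (hyperplane_measure \<xi>) (cball 0 1)) borel sgn)
      = (\<integral>\<^sup>+x. ennreal (radial_fun L (sgn x) ^ m) \<partial>restrict_space (hyperplane_measure \<xi>) (cball 0 1))"
      by (rule nn_integral_distr) measurable
    also have "\<dots> = (\<integral>\<^sup>+x. ennreal (radial_fun L (sgn x) ^ m) * indicator (cball 0 1) x \<partial>hyperplane_measure \<xi>)"
      by (rule nn_integral_restrict_space) simp
    also have "\<dots> = X"
      unfolding X_def
      by (rule nn_integral_cong_AE) (use nz in eventually_elim, simp add: f_def mult.commute sgn_zero_iff)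
    finally show ?thesis by (simp add: ennreal_of_nat_eq_real_of_nat)
  qed
  \<comment> \<open>Finiteness allows the return from \<open>enn2real\<close> to an equation between
    extended reals.\<close>
  have Xfin: "X < \<infinity>"
  proof -
    obtain R where R: "\<And>y. y \<in> L \<Longrightarrow> norm y \<le> R" using compact_imp_bounded[OF L(1)] by (auto simp: bounded_iff)
    have R0: "0 \<le> R" using R[of 0] L(3) interior_subset by force
    have "f (sgn x) \<le> R" for x
      using radial_fun_le[OF L R, of "sgn x"] R0 by (auto simp: f_def norm_sgn sgn_zero_iff)
    then have "X \<le> (\<integral>\<^sup>+x. indicator (cball 0 1) x * ennreal (R ^ m) \<partial>hyperplane_measure \<xi>)"
      unfolding X_def using f0 by (intro nn_integral_mono mult_left_mono ennreal_leI power_mono) auto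
    also have "\<dots> = emeasure (hyperplane_measure \<xi>) (cball 0 1) * ennreal (R ^ m)"
      by (subst nn_integral_multc) auto
    also have "\<dots> < \<infinity>" using emeasure_hyperplane_cball[OF \<xi>, of 1] by (simp add: ennreal_mult_less_top)
    finally show ?thesis .
  qed
  define I where "I = (LINT \<theta>|sphere_measure ?H. radial_fun L \<theta> ^ m)"
  \<comment> \<open>As \<open>m\<close> is even, the integrand is nonnegative even where the radial
    function is unspecified.\<close>
  have "I = enn2real (ennreal ?D * X)"
    unfolding I_def Sph[symmetric]
    by (rule integral_eq_nn_integral) (auto simp: ev zero_le_even_power sphere_measure_def)
  then have I: "ennreal I = ennreal ?D * X" using Xfin by (simp add: ennreal_mult_less_top)
  have I0: "0 \<le> I" unfolding I_def using ev by (intro integral_nonneg_AE) (simp add: zero_le_even_power)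
  have "ennreal (real m) * Y = ennreal (real m) * ennreal (I / real m)"
    using XY I I0 m by (simp add: ennreal_mult[symmetric])
  then have "Y = ennreal (I / real m)"
    using m by (auto simp: ennreal_mult_cancel_left)
  moreover have "?D / real m * dual_section_fun K m \<xi> t = I / real m"
    using n2 by (simp add: dual_section_fun_def I_def L_def of_nat_diff)
  ultimately show ?thesis unfolding Y_def by (simp only:)
qed

end

section \<open>The double integral over pairs of vectors\<close>

text \<open>The radicand is the Gram determinant of the pair. For \<open>k = 0\<close>, the case
  \<open>m = n - 1\<close>, the weight is constantly 1; for \<open>k > 0\<close> it is 0 at
  dependent pairs by the convention \<open>1 / 0 = 0\<close>.\<close>

definition area_weight :: "nat \<Rightarrow> 'a::euclidean_space \<Rightarrow> 'a \<Rightarrow> real" where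
  "area_weight k x z = (1 / sqrt ((norm x)\<^sup>2 * (norm z)\<^sup>2 - (x \<bullet> z)\<^sup>2)) ^ k"

lemma area_weight_commute: "area_weight k x z = area_weight k z x"
  by (simp add: area_weight_def inner_commute mult.commute)

lemma area_weight_nonneg: "0 \<le> area_weight k x z"
proof -
  have "(x \<bullet> z)\<^sup>2 \<le> (norm x)\<^sup>2 * (norm z)\<^sup>2"
    using Cauchy_Schwarz_ineq[of x z] by (simp add: power2_norm_eq_inner)
  then show ?thesis by (simp add: area_weight_def)
qed

text \<open>Area is base times height: the base is \<open>p\<close> and the height
  \<open>|x|\<close>, whatever the value of \<open>t\<close>.\<close>

lemma area_weight_slice:
  assumes \<zeta>: "norm \<zeta> = 1" and x: "x \<bullet> \<zeta> = 0" and p: "0 < p"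
  shows "area_weight k (t *\<^sub>R \<zeta> + x) (p *\<^sub>R \<zeta>) = (1 / p) ^ k * (1 / norm x) ^ k"
proof -
  have \<zeta>\<zeta>: "\<zeta> \<bullet> \<zeta> = 1" using \<zeta> by (simp add: norm_eq_1)
  have n1: "(norm (t *\<^sub>R \<zeta> + x))\<^sup>2 = t\<^sup>2 + (norm x)\<^sup>2"
    using x unfolding power2_norm_eq_inner
    by (simp add: inner_add_left inner_add_right \<zeta>\<zeta> inner_commute[of \<zeta> x] power2_eq_square)
  have n2: "(t *\<^sub>R \<zeta> + x) \<bullet> (p *\<^sub>R \<zeta>) = t * p"
    using x by (simp add: inner_add_left \<zeta>\<zeta>)
  have n3: "(norm (p *\<^sub>R \<zeta>))\<^sup>2 = p\<^sup>2" using \<zeta> by simp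
  have "(norm (t *\<^sub>R \<zeta> + x))\<^sup>2 * (norm (p *\<^sub>R \<zeta>))\<^sup>2 - ((t *\<^sub>R \<zeta> + x) \<bullet> (p *\<^sub>R \<zeta>))\<^sup>2 = (p * norm x)\<^sup>2"
    unfolding n1 n2 n3 by (simp add: algebra_simps power_mult_distrib)
  then have "area_weight k (t *\<^sub>R \<zeta> + x) (p *\<^sub>R \<zeta>) = (1 / sqrt ((p * norm x)\<^sup>2)) ^ k"
    by (simp only: area_weight_def)
  also have "sqrt ((p * norm x)\<^sup>2) = p * norm x" using p by simp
  also have "(1 / (p * norm x)) ^ k = (1 / p) ^ k * (1 / norm x) ^ k"
    by (simp add: power_mult_distrib[symmetric])
  finally show ?thesis .
qed

lemma borel_measurable_area_weight [measurable (raw)]: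
  assumes [measurable]: "f \<in> borel_measurable M" "g \<in> borel_measurable M"
  shows "(\<lambda>x. area_weight k (f x) (g x :: 'a::euclidean_space)) \<in> borel_measurable M"
  unfolding area_weight_def by measurable

lemma integral_power_sum_Icc:
  fixes c :: "nat \<Rightarrow> real"
  assumes "0 \<le> a"
  shows "(\<integral>t. indicator {0..a} t * (\<Sum>l\<le>N. c l * t ^ l) \<partial>lborel) = (\<Sum>l\<le>N. c l * a ^ (l + 1) / real (l + 1))"
proof -
  have "((\<lambda>x. x ^ (l + 1) / real (l + 1)) has_real_derivative t ^ l) (at t)" for t :: real and l
    using DERIV_cdivide[OF DERIV_pow[of "l + 1" t], of "real (l + 1)"] by simp
  then have "has_bochner_integral lborel (\<lambda>t. t ^ l * indicator {0..a} t) (a ^ (l + 1) / real (l + 1) - 0 ^ (l + 1) / real (l + 1))" for l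
    using assms by (intro has_bochner_integral_FTC_Icc_nonneg) auto
  then have "has_bochner_integral lborel (\<lambda>t. \<Sum>l\<le>N. c l * (t ^ l * indicator {0..a} t))
      (\<Sum>l\<le>N. c l * (a ^ (l + 1) / real (l + 1) - 0 ^ (l + 1) / real (l + 1)))"
    by (intro has_bochner_integral_sum has_bochner_integral_mult_right)
  then have "has_bochner_integral lborel (\<lambda>t. indicator {0..a} t * (\<Sum>l\<le>N. c l * t ^ l)) (\<Sum>l\<le>N. c l * a ^ (l + 1) / real (l + 1))"
    by (simp add: sum_distrib_left mult_ac)
  then show ?thesis by (rule has_bochner_integral_integral_eq)
qed

text \<open>Serves both orders of integration, since the weight is symmetric: the vector held fixed
  is \<open>p \<zeta>\<close>, and the range of the inner product becomes a range of heights up to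
  \<open>T / p\<close>.\<close>

lemma integral_area_slice:
  fixes \<zeta> :: "real^'n"
  assumes \<zeta>: "norm \<zeta> = 1" and p: "0 < p" and [measurable]: "g \<in> borel_measurable borel"
    and int: "integrable lborel (\<lambda>x. g x * indicator {0..T} (x \<bullet> (p *\<^sub>R \<zeta>)) * area_weight k x (p *\<^sub>R \<zeta>))"
  shows "(\<integral>x. g x * indicator {0..T} (x \<bullet> (p *\<^sub>R \<zeta>)) * area_weight k x (p *\<^sub>R \<zeta>) \<partial>lborel)
    = (1 / p) ^ k * (\<integral>t. indicator {0..T / p} t *
         (\<integral>x. g (t *\<^sub>R \<zeta> + x) * (1 / norm x) ^ k \<partial>hyperplane_measure \<zeta>) \<partial>lborel)"
proof -
  have \<zeta>\<zeta>: "\<zeta> \<bullet> \<zeta> = 1" using \<zeta> by (simp add: norm_eq_1)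
  have "(\<integral>x. g x * indicator {0..T} (x \<bullet> (p *\<^sub>R \<zeta>)) * area_weight k x (p *\<^sub>R \<zeta>) \<partial>lborel)
    = (\<integral>t. (\<integral>x. g (t *\<^sub>R \<zeta> + x) * indicator {0..T} ((t *\<^sub>R \<zeta> + x) \<bullet> (p *\<^sub>R \<zeta>)) * area_weight k (t *\<^sub>R \<zeta> + x) (p *\<^sub>R \<zeta>)
        \<partial>hyperplane_measure \<zeta>) \<partial>lborel)"
    by (rule integral_lborel_slice[OF \<zeta> int])
  also have "\<dots> = (\<integral>t. (1 / p) ^ k * (indicator {0..T / p} t *
         (\<integral>x. g (t *\<^sub>R \<zeta> + x) * (1 / norm x) ^ k \<partial>hyperplane_measure \<zeta>)) \<partial>lborel)"
  proof (rule Bochner_Integration.integral_cong[OF refl], goal_cases)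
    case (1 t)
    have "(\<integral>x. g (t *\<^sub>R \<zeta> + x) * indicator {0..T} ((t *\<^sub>R \<zeta> + x) \<bullet> (p *\<^sub>R \<zeta>)) * area_weight k (t *\<^sub>R \<zeta> + x) (p *\<^sub>R \<zeta>) \<partial>hyperplane_measure \<zeta>)
      = (\<integral>x. ((1 / p) ^ k * indicator {0..T / p} t) * (g (t *\<^sub>R \<zeta> + x) * (1 / norm x) ^ k) \<partial>hyperplane_measure \<zeta>)"
    proof (rule integral_cong_AE)
      show "AE x in hyperplane_measure \<zeta>.
        g (t *\<^sub>R \<zeta> + x) * indicator {0..T} ((t *\<^sub>R \<zeta> + x) \<bullet> (p *\<^sub>R \<zeta>)) * area_weight k (t *\<^sub>R \<zeta> + x) (p *\<^sub>R \<zeta>)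
        = ((1 / p) ^ k * indicator {0..T / p} t) * (g (t *\<^sub>R \<zeta> + x) * (1 / norm x) ^ k)"
        using AE_hyperplane[of \<zeta>]
      proof eventually_elim
        case x: (elim x)
        have "(t *\<^sub>R \<zeta> + x) \<bullet> (p *\<^sub>R \<zeta>) = t * p" using x by (simp add: inner_add_left \<zeta>\<zeta>)
        moreover have "t * p \<in> {0..T} \<longleftrightarrow> t \<in> {0..T / p}" using p by (auto simp: pos_le_divide_eq zero_le_mult_iff)
        ultimately have ind: "indicator {0..T} ((t *\<^sub>R \<zeta> + x) \<bullet> (p *\<^sub>R \<zeta>)) = (indicator {0..T / p} t :: real)"
          by (simp only: indicator_def)
        show ?case
          by (simp only: area_weight_slice[OF \<zeta> x p] ind mult_ac)
      qed
    qed measurable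
    then show ?case
      by (simp only: integral_mult_right_zero mult.assoc)
  qed
  finally show ?thesis by (simp only: integral_mult_right_zero)
qed

text \<open>The dependence on the height \<open>\<alpha>\<close> of the degree \<open>i\<close> part
  of a slice of the shell \<open>1 < |\<eta>| \<le> 2\<close>. The two balls have squared radii
  \<open>4 - \<alpha>^2\<close> and \<open>1 - \<alpha>^2\<close>, and their moments carry the
  radius to the power \<open>m + i\<close>, a power of its square for even \<open>i\<close>. The
  monomial is left from the binomial expansion of \<open>(\<eta> \<bullet> y) ^ e\<close>.\<close>

definition shell_poly :: "nat \<Rightarrow> nat \<Rightarrow> nat \<Rightarrow> real poly" where
  "shell_poly m e i = monom 1 (e - i) * ([:4, 0, - 1:] ^ ((m + i) div 2) - [:1, 0, - 1:] ^ ((m + i) div 2))"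

text \<open>The coefficient of \<open>\<alpha> ^ b\<close> in the weighted slice integral of
  \<open>(\<eta> \<bullet> y) ^ e\<close>, as a polynomial in
  \<open>u = \<omega> \<bullet> y\<close>. For unit vectors \<open>(1 - u^2) ^ (i div 2)\<close> is
  the \<open>i\<close>-th power of the length of the projection of \<open>y\<close> to the
  hyperplane.\<close>

definition ridge_poly :: "nat \<Rightarrow> (nat \<Rightarrow> real) \<Rightarrow> nat \<Rightarrow> nat \<Rightarrow> real poly" where
  "ridge_poly m Z e b = (\<Sum>i | i \<le> e \<and> even i.
     smult (real (e choose i) * Z i * coeff (shell_poly m e i) b) (monom 1 (e - i) * [:1, 0, - 1:] ^ (i div 2)))"

lemma degree_shell_poly:
  assumes "i \<le> e"
  shows "degree (shell_poly m e i) \<le> e + m"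
proof -
  define q where "q = (m + i) div 2"
  have p: "degree ([:c, 0, - 1:] ^ q) \<le> 2 * q" for c :: real
    by (rule order_trans[OF degree_power_le]) simp
  have "degree ([:4, 0, - 1:] ^ q - [:1, 0, - 1:] ^ q :: real poly) \<le> 2 * q"
    by (intro degree_diff_le p)
  moreover have "degree (monom (1::real) (e - i)) \<le> e - i" by (rule degree_monom_le)
  ultimately have "degree (shell_poly m e i) \<le> (e - i) + 2 * q"
    unfolding shell_poly_def q_def[symmetric] by (rule order_trans[OF degree_mult_le add_mono, rotated])
  also have "2 * q \<le> m + i" by (simp add: q_def)
  finally show ?thesis using assms by linarith
qed

lemma sqrt_power_even: "0 \<le> x \<Longrightarrow> even i \<Longrightarrow> sqrt x ^ i = x ^ (i div 2)"
  by (metis dvd_mult_div_cancel power_mult real_sqrt_pow2)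

lemma coeff_zero_of_poly_identity:
  fixes c d :: "nat \<Rightarrow> real"
  assumes r: "0 < r" and eq: "\<And>T. 0 < T \<Longrightarrow> T \<le> r \<Longrightarrow> (\<Sum>l\<le>M. c l * T ^ (l + 1)) = (\<Sum>b\<le>N. d b * T ^ (b + 1))"
    and b: "M < b" "b \<le> N"
  shows "d b = 0"
proof -
  define p where "p = (\<Sum>l\<le>M. monom (c l) (l + 1)) - (\<Sum>b\<le>N. monom (d b) (b + 1))"
  have "poly p T = 0" if "T \<in> {0<..r}" for T
    using eq[of T] that by (simp add: p_def poly_sum poly_monom)
  then have "{0<..r} \<subseteq> {T. poly p T = 0}" by blast
  moreover have "infinite {0<..r}" using r by simp
  ultimately have "p = 0" using poly_roots_finite finite_subset by metis
  then have "0 = coeff p (b + 1)" by simp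
  also have "\<dots> = - d b" using b by (simp add: p_def coeff_sum)
  finally show ?thesis by simp
qed

context
  fixes k m :: nat and Z :: "nat \<Rightarrow> real"
  assumes km: "k + m = CARD('n::finite) - 1" and m: "0 < m" and n2: "2 \<le> CARD('n)" and ev: "even m"
    and Z: "\<And>(\<omega> :: real^'n) y i a. norm \<omega> = 1 \<Longrightarrow> 0 \<le> a \<Longrightarrow>
          hyperplane_moment k \<omega> y i a = a ^ (m + i) * norm (y - (y \<bullet> \<omega>) *\<^sub>R \<omega>) ^ i * Z i"
    and Zodd: "\<And>i. odd i \<Longrightarrow> Z i = 0" and Zeven: "\<And>i. even i \<Longrightarrow> 0 < Z i"
begin

lemma nn_integral_cball_weight:
  fixes \<zeta> :: "real^'n"
  assumes \<zeta>: "norm \<zeta> = 1" and R: "0 \<le> R"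
  shows "(\<integral>\<^sup>+x. indicator (cball 0 R) x * ennreal ((1 / norm x) ^ k) \<partial>hyperplane_measure \<zeta>) = ennreal (R ^ m * Z 0)"
proof -
  have "(\<integral>\<^sup>+x. indicator (cball 0 R) x * ennreal ((1 / norm x) ^ k) \<partial>hyperplane_measure \<zeta>)
    = (\<integral>\<^sup>+x. ennreal (indicator (cball 0 R) x * ((1 / norm x) ^ k * (x \<bullet> \<zeta>) ^ 0)) \<partial>hyperplane_measure \<zeta>)"
    by (intro nn_integral_cong) (simp add: indicator_def)
  also have "\<dots> = ennreal (hyperplane_moment k \<zeta> \<zeta> 0 R)"
    unfolding hyperplane_moment_def
    by (intro nn_integral_eq_integral moment_integrable[OF km m n2 \<zeta> R]) simp
  finally show ?thesis using Z[OF \<zeta> R, of \<zeta> 0] by simp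
qed

text \<open>A slice of the ball lies over the ball of the same radius in the hyperplane, so the
  integral is at most the weight of the latter times the length of the range of heights. This gives
  the absolute integrability required by Fubini.\<close>

lemma nn_integral_area_weight_le:
  fixes \<zeta> :: "real^'n"
  assumes \<zeta>: "norm \<zeta> = 1" and p: "0 < p" and R: "0 \<le> R" and T: "0 \<le> T"
  shows "(\<integral>\<^sup>+x. indicator (cball 0 R) x * indicator {0..T} (x \<bullet> (p *\<^sub>R \<zeta>)) * ennreal (area_weight k x (p *\<^sub>R \<zeta>)) \<partial>lborel)
    \<le> ennreal ((1 / p) ^ k * (T / p) * (R ^ m * Z 0))"
proof -
  have \<zeta>\<zeta>: "\<zeta> \<bullet> \<zeta> = 1" using \<zeta> by (simp add: norm_eq_1)
  have "(\<integral>\<^sup>+x. indicator (cball 0 R) x * indicator {0..T} (x \<bullet> (p *\<^sub>R \<zeta>)) * ennreal (area_weight k x (p *\<^sub>R \<zeta>)) \<partial>lborel)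
    = (\<integral>\<^sup>+t. (\<integral>\<^sup>+x. indicator (cball 0 R) (t *\<^sub>R \<zeta> + x) * indicator {0..T} ((t *\<^sub>R \<zeta> + x) \<bullet> (p *\<^sub>R \<zeta>)) *
        ennreal (area_weight k (t *\<^sub>R \<zeta> + x) (p *\<^sub>R \<zeta>)) \<partial>hyperplane_measure \<zeta>) \<partial>lborel)"
    by (rule nn_integral_lborel_slice[OF \<zeta>]) measurable
  also have "\<dots> \<le> (\<integral>\<^sup>+t. (\<integral>\<^sup>+x. (ennreal ((1 / p) ^ k) * indicator {0..T / p} t) * (indicator (cball 0 R) x * ennreal ((1 / norm x) ^ k)) \<partial>hyperplane_measure \<zeta>) \<partial>lborel)"
  proof (rule nn_integral_mono, rule nn_integral_mono_AE)
    fix t :: real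
    show "AE x in hyperplane_measure \<zeta>.
      indicator (cball 0 R) (t *\<^sub>R \<zeta> + x) * indicator {0..T} ((t *\<^sub>R \<zeta> + x) \<bullet> (p *\<^sub>R \<zeta>)) * ennreal (area_weight k (t *\<^sub>R \<zeta> + x) (p *\<^sub>R \<zeta>))
      \<le> (ennreal ((1 / p) ^ k) * indicator {0..T / p} t) * (indicator (cball 0 R) x * ennreal ((1 / norm x) ^ k))"
      using AE_hyperplane[of \<zeta>]
    proof eventually_elim
      case x: (elim x)
      have "(t *\<^sub>R \<zeta> + x) \<bullet> (p *\<^sub>R \<zeta>) = t * p" using x by (simp add: inner_add_left \<zeta>\<zeta>)
      moreover have "t * p \<in> {0..T} \<longleftrightarrow> t \<in> {0..T / p}" using p by (auto simp: pos_le_divide_eq zero_le_mult_iff)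
      ultimately have ind: "indicator {0..T} ((t *\<^sub>R \<zeta> + x) \<bullet> (p *\<^sub>R \<zeta>)) = (indicator {0..T / p} t :: ennreal)"
        by (simp only: indicator_def)
      have "norm x \<le> norm (t *\<^sub>R \<zeta> + x)"
        unfolding norm_le using x by (simp add: inner_add_left inner_add_right \<zeta>\<zeta> inner_commute[of \<zeta> x])
      then have "indicator (cball 0 R) (t *\<^sub>R \<zeta> + x) \<le> (indicator (cball 0 R) x :: ennreal)"
        by (auto simp: indicator_def)
      then show ?case
      proof -
        assume le: "indicator (cball 0 R) (t *\<^sub>R \<zeta> + x) \<le> (indicator (cball 0 R) x :: ennreal)"
        have e: "ennreal ((1 / p) ^ k * (1 / norm x) ^ k) = ennreal ((1 / p) ^ k) * ennreal ((1 / norm x) ^ k)"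
          using p by (intro ennreal_mult) auto
        have "indicator (cball 0 R) (t *\<^sub>R \<zeta> + x) * indicator {0..T / p} t * (ennreal ((1 / p) ^ k) * ennreal ((1 / norm x) ^ k))
          \<le> indicator (cball 0 R) x * indicator {0..T / p} t * (ennreal ((1 / p) ^ k) * ennreal ((1 / norm x) ^ k))"
          by (intro mult_right_mono le) auto
        also have "\<dots> = (ennreal ((1 / p) ^ k) * indicator {0..T / p} t) * (indicator (cball 0 R) x * ennreal ((1 / norm x) ^ k))"
          by (simp only: mult_ac)
        finally show ?thesis unfolding area_weight_slice[OF \<zeta> x p] ind e .
      qed
    qed
  qed
  also have "\<dots> = (\<integral>\<^sup>+t. (ennreal ((1 / p) ^ k) * indicator {0..T / p} t) * ennreal (R ^ m * Z 0) \<partial>lborel)"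
    by (intro nn_integral_cong, subst nn_integral_cmult) (simp_all add: nn_integral_cball_weight[OF \<zeta> R])
  also have "\<dots> = ennreal ((1 / p) ^ k) * ennreal (T / p) * ennreal (R ^ m * Z 0)"
    using T p by (simp add: nn_integral_multc nn_integral_cmult)
  also have "\<dots> = ennreal ((1 / p) ^ k * (T / p) * (R ^ m * Z 0))"
    using T p R Zeven[of 0] by (simp add: ennreal_mult[symmetric] less_imp_le)
  finally show ?thesis .
qed

lemma nn_integral_area_bound:
  fixes z :: "real^'n"
  assumes z: "0 < norm z" and g: "\<And>x. \<bar>g x\<bar> \<le> B * indicator (cball 0 R) x" and B: "0 \<le> B" and R: "0 \<le> R" and T: "0 \<le> T"
  shows "(\<integral>\<^sup>+x. ennreal (norm (g x * indicator {0..T} (x \<bullet> z) * area_weight k x z)) \<partial>lborel)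
    \<le> ennreal (B * ((1 / norm z) ^ k * (T / norm z) * (R ^ m * Z 0)))"
proof -
  let ?h = "\<lambda>x. g x * indicator {0..T} (x \<bullet> z) * area_weight k x z"
  let ?i = "\<lambda>x. indicator (cball 0 R) x * indicator {0..T} (x \<bullet> z)"
  let ?b = "(1 / norm z) ^ k * (T / norm z) * (R ^ m * Z 0)"
  have zz: "norm z *\<^sub>R sgn z = z" using z by (simp add: sgn_div_norm)
  have "(\<integral>\<^sup>+x. ennreal (norm (?h x)) \<partial>lborel)
    \<le> (\<integral>\<^sup>+x. ennreal B * (?i x * ennreal (area_weight k x z)) \<partial>lborel)"
  proof (rule nn_integral_mono, goal_cases)
    case (1 x)
    have "norm (?h x)
      \<le> B * (?i x * area_weight k x z)"
      using mult_right_mono[OF g[of x], of "indicator {0..T} (x \<bullet> z) * area_weight k x z"] area_weight_nonneg[of k x z]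
      by (simp add: abs_mult mult.assoc)
    then have "ennreal (norm (?h x))
      \<le> ennreal (B * (?i x * area_weight k x z))" by (rule ennreal_leI)
    also have "\<dots> = ennreal B * (?i x * ennreal (area_weight k x z))"
      using B by (auto simp: indicator_def ennreal_mult')
    finally show ?case .
  qed
  also have "\<dots> = ennreal B * (\<integral>\<^sup>+x. ?i x * ennreal (area_weight k x z) \<partial>lborel)"
    by (rule nn_integral_cmult) measurable
  also have "\<dots> \<le> ennreal B * ennreal ?b"
    using nn_integral_area_weight_le[of "sgn z" "norm z" R T] z R T
    by (intro mult_left_mono) (simp_all add: zz norm_sgn)
  also have "\<dots> = ennreal (B * ?b)"
    by (rule ennreal_mult'[symmetric, OF B])
  finally show ?thesis .
qed

lemma integrable_area:
  fixes z :: "real^'n"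
  assumes z: "0 < norm z" and [measurable]: "g \<in> borel_measurable borel"
    and g: "\<And>x. \<bar>g x\<bar> \<le> B * indicator (cball 0 R) x" and B: "0 \<le> B" and R: "0 \<le> R" and T: "0 \<le> T"
  shows "integrable lborel (\<lambda>x. g x * indicator {0..T} (x \<bullet> z) * area_weight k x z)"
proof (rule integrableI_bounded)
  show "(\<integral>\<^sup>+x. ennreal (norm (g x * indicator {0..T} (x \<bullet> z) * area_weight k x z)) \<partial>lborel) < \<infinity>"
    by (rule le_less_trans[OF nn_integral_area_bound[OF z g B R T]]) simp
qed measurable

lemma section_shell:
  fixes K :: "(real^'n) set" and \<xi> :: "real^'n"
  assumes \<xi>: "norm \<xi> = 1" and K: "compact K" "convex K" and r: "cball 0 r \<subseteq> interior K" and t: "0 \<le> t" "t \<le> r"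
  shows "(\<integral>x. indicator (K - cball 0 r) (t *\<^sub>R \<xi> + x) * (1 / norm x) ^ k \<partial>hyperplane_measure \<xi>)
    = real (CARD('n) - 1) / real m * dual_section_fun K m \<xi> t - (r\<^sup>2 - t\<^sup>2) ^ (m div 2) * Z 0"
proof -
  have [measurable]: "K \<in> sets borel" using K by (simp add: borel_compact)
  have rt: "0 \<le> r\<^sup>2 - t\<^sup>2" using t by simp
  have \<xi>\<xi>: "\<xi> \<bullet> \<xi> = 1" using \<xi> by (simp add: norm_eq_1)
  have t\<xi>: "t *\<^sub>R \<xi> \<in> interior K" using r t \<xi> by (intro subsetD[OF r]) simp
  define DS where "DS = real (CARD('n) - 1) / real m * dual_section_fun K m \<xi> t"
  have nn: "(\<integral>\<^sup>+x. ennreal (indicator K (t *\<^sub>R \<xi> + x) * (1 / norm x) ^ k) \<partial>hyperplane_measure \<xi>) = ennreal DS"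
    unfolding DS_def nn_integral_section[OF km m n2 ev \<xi> K t\<xi>, symmetric]
    by (intro nn_integral_cong) (simp add: indicator_def)
  have DS0: "0 \<le> DS"
  proof -
    have "0 \<le> dual_section_fun K m \<xi> t"
      unfolding dual_section_fun_def using ev n2 by (intro mult_nonneg_nonneg integral_nonneg_AE) (simp_all add: zero_le_even_power)
    then show ?thesis by (simp add: DS_def)
  qed
  have i1: "has_bochner_integral (hyperplane_measure \<xi>) (\<lambda>x. indicator K (t *\<^sub>R \<xi> + x) * (1 / norm x) ^ k) DS"
    by (rule has_bochner_integral_nn_integral[OF _ _ DS0 nn]) simp_all
  have i2: "has_bochner_integral (hyperplane_measure \<xi>) (\<lambda>x. indicator (cball 0 r) (t *\<^sub>R \<xi> + x) * (1 / norm x) ^ k)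
      ((r\<^sup>2 - t\<^sup>2) ^ (m div 2) * Z 0)"
  proof -
    have "has_bochner_integral (hyperplane_measure \<xi>) (\<lambda>x. indicator (cball 0 (sqrt (r\<^sup>2 - t\<^sup>2))) x * ((1 / norm x) ^ k * (x \<bullet> \<xi>) ^ 0))
      (hyperplane_moment k \<xi> \<xi> 0 (sqrt (r\<^sup>2 - t\<^sup>2)))"
      unfolding hyperplane_moment_def using rt
      by (intro has_bochner_integral_integrable moment_integrable[OF km m n2 \<xi>]) simp
    also have "hyperplane_moment k \<xi> \<xi> 0 (sqrt (r\<^sup>2 - t\<^sup>2)) = (r\<^sup>2 - t\<^sup>2) ^ (m div 2) * Z 0"
      using Z[OF \<xi>, of "sqrt (r\<^sup>2 - t\<^sup>2)" \<xi> 0] rt ev by (simp add: sqrt_power_even)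
    finally show ?thesis
    proof (rule has_bochner_integral_cong_AE[THEN iffD1, rotated -1])
      show "AE x in hyperplane_measure \<xi>. indicator (cball 0 (sqrt (r\<^sup>2 - t\<^sup>2))) x * ((1 / norm x) ^ k * (x \<bullet> \<xi>) ^ 0)
        = indicator (cball 0 r) (t *\<^sub>R \<xi> + x) * (1 / norm x) ^ k"
        using AE_hyperplane[of \<xi>]
      proof eventually_elim
        case x: (elim x)
        have "(norm (t *\<^sub>R \<xi> + x))\<^sup>2 = t\<^sup>2 + (norm x)\<^sup>2"
          using x unfolding power2_norm_eq_inner
          by (simp add: inner_add_left inner_add_right \<xi>\<xi> inner_commute[of \<xi> x] power2_eq_square)
        moreover have "norm (t *\<^sub>R \<xi> + x) \<le> r \<longleftrightarrow> (norm (t *\<^sub>R \<xi> + x))\<^sup>2 \<le> r\<^sup>2"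
          using t by (metis abs_le_square_iff abs_norm_cancel abs_of_nonneg order_trans)
        moreover have "norm x \<le> sqrt (r\<^sup>2 - t\<^sup>2) \<longleftrightarrow> (norm x)\<^sup>2 \<le> r\<^sup>2 - t\<^sup>2"
          using rt by (metis norm_ge_zero real_le_rsqrt real_sqrt_le_iff real_sqrt_abs abs_norm_cancel)
        ultimately show ?case
          by (simp add: indicator_def algebra_simps)
      qed
    qed measurable
  qed
  have "(\<lambda>x. indicator (K - cball 0 r) (t *\<^sub>R \<xi> + x) * (1 / norm x) ^ k)
    = (\<lambda>x. indicator K (t *\<^sub>R \<xi> + x) * (1 / norm x) ^ k - indicator (cball 0 r) (t *\<^sub>R \<xi> + x) * (1 / norm x) ^ k)"
    using r interior_subset[of K] by (auto simp: fun_eq_iff indicator_def)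
  then show ?thesis
    using has_bochner_integral_integral_eq[OF has_bochner_integral_diff[OF i1 i2]] by (simp add: DS_def)
qed

text \<open>The binomial expansion of \<open>(\<alpha> u + x \<bullet> y) ^ e\<close> leaves
  differences of moments of two concentric balls, whose radii are real because
  \<open>\<alpha> \<le> 1\<close>. Odd moments vanish; for even \<open>i\<close> the exponent
  \<open>m + i\<close> is even, so the square roots disappear and a polynomial in
  \<open>\<alpha>\<close> remains.\<close>

lemma integral_annulus_section:
  fixes \<omega> y :: "real^'n"
  assumes \<omega>: "norm \<omega> = 1" and y: "norm y = 1" and \<alpha>: "0 \<le> \<alpha>" "\<alpha> \<le> 1"
  shows "(\<integral>x. (((\<alpha> *\<^sub>R \<omega> + x) \<bullet> y) ^ e * indicator {1<..2} (norm (\<alpha> *\<^sub>R \<omega> + x))) * (1 / norm x) ^ k \<partial>hyperplane_measure \<omega>)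
    = (\<Sum>b\<le>e + m. poly (ridge_poly m Z e b) (\<omega> \<bullet> y) * \<alpha> ^ b)"
proof -
  define u where "u = \<omega> \<bullet> y"
  let ?y = "y - (y \<bullet> \<omega>) *\<^sub>R \<omega>" and ?c = "\<lambda>i. real (e choose i) * (\<alpha> * u) ^ (e - i)"
  let ?d = "\<lambda>i. sqrt (4 - \<alpha>\<^sup>2) ^ (m + i) * norm ?y ^ i * Z i - sqrt (1 - \<alpha>\<^sup>2) ^ (m + i) * norm ?y ^ i * Z i"
  let ?f = "\<lambda>x. (((\<alpha> *\<^sub>R \<omega> + x) \<bullet> y) ^ e * indicator {1<..2} (norm (\<alpha> *\<^sub>R \<omega> + x))) * (1 / norm x) ^ k"
  have \<omega>\<omega>: "\<omega> \<bullet> \<omega> = 1" using \<omega> by (simp add: norm_eq_1)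
  have \<alpha>2: "0 \<le> 1 - \<alpha>\<^sup>2" "0 \<le> 4 - \<alpha>\<^sup>2" using \<alpha> by (auto simp: power_le_one intro: order_trans[of _ 1])
  have yu: "(norm ?y)\<^sup>2 = 1 - u\<^sup>2"
    unfolding power2_norm_eq_inner using y
    by (simp add: inner_diff_left inner_diff_right \<omega>\<omega> norm_eq_1 u_def inner_commute[of y \<omega>] power2_eq_square)
  have split: "indicator {1<..2} (norm (\<alpha> *\<^sub>R \<omega> + x))
      = indicator (cball 0 (sqrt (4 - \<alpha>\<^sup>2))) x - (indicator (cball 0 (sqrt (1 - \<alpha>\<^sup>2))) x :: real)"
    if x: "x \<bullet> \<omega> = 0" for x :: "real^'n"
  proof -
    have n: "(norm (\<alpha> *\<^sub>R \<omega> + x))\<^sup>2 = \<alpha>\<^sup>2 + (norm x)\<^sup>2"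
      using x unfolding power2_norm_eq_inner
      by (simp add: inner_add_left inner_add_right \<omega>\<omega> inner_commute[of \<omega> x] power2_eq_square)
    have le: "norm (\<alpha> *\<^sub>R \<omega> + x) \<le> c \<longleftrightarrow> norm x \<le> sqrt (c\<^sup>2 - \<alpha>\<^sup>2)" if "0 \<le> c" "0 \<le> c\<^sup>2 - \<alpha>\<^sup>2" for c
    proof -
      have "norm (\<alpha> *\<^sub>R \<omega> + x) \<le> c \<longleftrightarrow> (norm (\<alpha> *\<^sub>R \<omega> + x))\<^sup>2 \<le> c\<^sup>2"
        using that by (metis abs_le_square_iff abs_norm_cancel abs_of_nonneg)
      also have "\<dots> \<longleftrightarrow> (norm x)\<^sup>2 \<le> c\<^sup>2 - \<alpha>\<^sup>2" unfolding n by linarith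
      also have "\<dots> \<longleftrightarrow> norm x \<le> sqrt (c\<^sup>2 - \<alpha>\<^sup>2)"
        using that by (metis norm_ge_zero real_le_rsqrt real_sqrt_le_iff real_sqrt_abs abs_norm_cancel)
      finally show ?thesis .
    qed
    have "norm (\<alpha> *\<^sub>R \<omega> + x) \<le> 1 \<longleftrightarrow> norm x \<le> sqrt (1 - \<alpha>\<^sup>2)" "norm (\<alpha> *\<^sub>R \<omega> + x) \<le> 2 \<longleftrightarrow> norm x \<le> sqrt (4 - \<alpha>\<^sup>2)"
      using le[of 1] le[of 2] \<alpha>2 by simp_all
    moreover have "sqrt (1 - \<alpha>\<^sup>2) \<le> sqrt (4 - \<alpha>\<^sup>2)" by simp
    ultimately show ?thesis by (auto simp: indicator_def not_le)
  qed
  define W where "W i a x = indicator (cball 0 a) x * ((1 / norm x) ^ k * (x \<bullet> y) ^ i)" for i a and x :: "real^'n"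
  have [measurable]: "W i a \<in> borel_measurable borel" for i a
    unfolding W_def[abs_def] by measurable
  have Wint: "has_bochner_integral (hyperplane_measure \<omega>) (W i (sqrt (c - \<alpha>\<^sup>2)))
      (sqrt (c - \<alpha>\<^sup>2) ^ (m + i) * norm ?y ^ i * Z i)" if "0 \<le> c - \<alpha>\<^sup>2" for i c
    using moment_integrable[OF km m n2 \<omega>, of "sqrt (c - \<alpha>\<^sup>2)" y i] Z[OF \<omega>, of "sqrt (c - \<alpha>\<^sup>2)" y i] that
    unfolding has_bochner_integral_iff W_def[abs_def] hyperplane_moment_def by simp
  have "has_bochner_integral (hyperplane_measure \<omega>)
      (\<lambda>x. \<Sum>i\<le>e. ?c i * (W i (sqrt (4 - \<alpha>\<^sup>2)) x - W i (sqrt (1 - \<alpha>\<^sup>2)) x))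
      (\<Sum>i\<le>e. ?c i *
         ?d i)"
    using \<alpha>2 by (intro has_bochner_integral_sum has_bochner_integral_mult_right has_bochner_integral_diff Wint)
  then have "has_bochner_integral (hyperplane_measure \<omega>)
      ?f
      (\<Sum>i\<le>e. ?c i *
         ?d i)"
  proof (rule has_bochner_integral_cong_AE[THEN iffD1, rotated -1])
    show "AE x in hyperplane_measure \<omega>.
      (\<Sum>i\<le>e. ?c i * (W i (sqrt (4 - \<alpha>\<^sup>2)) x - W i (sqrt (1 - \<alpha>\<^sup>2)) x))
      = (((\<alpha> *\<^sub>R \<omega> + x) \<bullet> y) ^ e * indicator {1<..2} (norm (\<alpha> *\<^sub>R \<omega> + x))) * (1 / norm x) ^ k"
      using AE_hyperplane[of \<omega>]
    proof eventually_elim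
      case x: (elim x)
      have "((\<alpha> *\<^sub>R \<omega> + x) \<bullet> y) ^ e = (x \<bullet> y + \<alpha> * u) ^ e" by (simp add: inner_add_left u_def add.commute)
      also have "\<dots> = (\<Sum>i\<le>e. real (e choose i) * (x \<bullet> y) ^ i * (\<alpha> * u) ^ (e - i))" by (rule binomial_ring)
      finally have ex: "((\<alpha> *\<^sub>R \<omega> + x) \<bullet> y) ^ e = (\<Sum>i\<le>e. real (e choose i) * (x \<bullet> y) ^ i * (\<alpha> * u) ^ (e - i))" .
      show ?case
        unfolding split[OF x] ex sum_distrib_right W_def
        by (intro sum.cong refl) (simp only: left_diff_distrib right_diff_distrib mult_ac)
    qed
  qed measurable
  then have "(\<integral>x. ?f x \<partial>hyperplane_measure \<omega>)
    = (\<Sum>i\<le>e. ?c i *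
         ?d i)"
    by (rule has_bochner_integral_integral_eq)
  also have "\<dots> = (\<Sum>i | i \<le> e \<and> even i. (real (e choose i) * Z i * (u ^ (e - i) * (1 - u\<^sup>2) ^ (i div 2))) * poly (shell_poly m e i) \<alpha>)"
  proof (rule sum.mono_neutral_cong_right)
    show "\<forall>i\<in>{..e} - {i. i \<le> e \<and> even i}. ?c i *
         ?d i = 0"
      by (auto simp: Zodd)
    fix i assume "i \<in> {i. i \<le> e \<and> even i}"
    then have i: "even i" by simp
    have e1: "norm ?y ^ i = (1 - u\<^sup>2) ^ (i div 2)"
      using i by (metis yu dvd_mult_div_cancel power_mult)
    have e2: "sqrt (4 - \<alpha>\<^sup>2) ^ (m + i) = (4 - \<alpha>\<^sup>2) ^ ((m + i) div 2)" "sqrt (1 - \<alpha>\<^sup>2) ^ (m + i) = (1 - \<alpha>\<^sup>2) ^ ((m + i) div 2)"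
      using i ev \<alpha>2 by (simp_all add: sqrt_power_even)
    have e3: "poly (shell_poly m e i) \<alpha> = \<alpha> ^ (e - i) * ((4 - \<alpha>\<^sup>2) ^ ((m + i) div 2) - (1 - \<alpha>\<^sup>2) ^ ((m + i) div 2))"
      by (simp add: shell_poly_def poly_monom power2_eq_square)
    show "?c i *
         ?d i
      = (real (e choose i) * Z i * (u ^ (e - i) * (1 - u\<^sup>2) ^ (i div 2))) * poly (shell_poly m e i) \<alpha>"
      unfolding e1 e2 e3 power_mult_distrib by (simp only: left_diff_distrib right_diff_distrib mult_ac)
  qed auto
  also have "\<dots> = (\<Sum>i | i \<le> e \<and> even i. \<Sum>b\<le>e + m. (real (e choose i) * Z i * (u ^ (e - i) * (1 - u\<^sup>2) ^ (i div 2))) * (coeff (shell_poly m e i) b * \<alpha> ^ b))"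
  proof (rule sum.cong[OF refl], goal_cases)
    case (1 i)
    then have "degree (shell_poly m e i) \<le> e + m" by (intro degree_shell_poly) simp
    then have "poly (shell_poly m e i) \<alpha> = (\<Sum>b\<le>e + m. coeff (shell_poly m e i) b * \<alpha> ^ b)"
      unfolding poly_altdef by (intro sum.mono_neutral_left) (auto simp: coeff_eq_0)
    then show ?case
      by (simp only: sum_distrib_left)
  qed
  also have "\<dots> = (\<Sum>b\<le>e + m. poly (ridge_poly m Z e b) u * \<alpha> ^ b)"
    unfolding ridge_poly_def poly_sum sum_distrib_right
    by (subst sum.swap, intro sum.cong refl) (simp add: poly_monom power2_eq_square)
  finally show ?thesis by (simp only: u_def)
qed

text \<open>The range of \<open>b\<close> is the gap between the degree \<open>max N m\<close> known
  from the sections and the degree \<open>e + m\<close> of the explicit polynomial; coefficients in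
  this gap must vanish.\<close>

lemma ridge_integral_eq_0:
  fixes K :: "(real^'n) set" and y :: "real^'n"
  assumes K: "compact K" "convex K" and r: "0 < r" "cball 0 r \<subseteq> interior K" and y: "norm y = 1"
    and a: "\<And>l. l \<le> N \<Longrightarrow> continuous_on (sphere 0 1) (a l)"
    and DS: "\<And>\<xi> t. norm \<xi> = 1 \<Longrightarrow> 0 \<le> t \<Longrightarrow> t \<le> r \<Longrightarrow> dual_section_fun K m \<xi> t = (\<Sum>l\<le>N. a l \<xi> * t ^ l)"
    and b: "max N m < b" "b \<le> e + m"
  shows "(\<integral>x. indicator (K - cball 0 r) x * ((1 / norm x) ^ (k + b + 1) * poly (ridge_poly m Z e b) (sgn x \<bullet> y)) \<partial>lborel) = 0"
proof -
  define C where "C = K - cball 0 r"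
  have [measurable]: "K \<in> sets borel" using K by (simp add: borel_compact)
  have [measurable]: "C \<in> sets borel" unfolding C_def by measurable
  obtain R where R: "0 \<le> R" "K \<subseteq> cball 0 R"
  proof -
    obtain B where B: "\<And>x. x \<in> K \<Longrightarrow> norm x \<le> B" using compact_imp_bounded[OF K(1)] by (auto simp: bounded_iff)
    then have "K \<subseteq> cball 0 (max B 0)" by force
    then show ?thesis using that[of "max B 0"] by simp
  qed
  define M where "M = max N m"
  define q where "q = [:r\<^sup>2, 0, - 1:] ^ (m div 2)"
  \<comment> \<open>Coefficients of the slice integrals of \<open>C\<close>: those of the section
    function of \<open>K\<close>, extended by zero beyond \<open>N\<close>, minus those of the
    removed ball.\<close>
  define A where "A l \<xi> = (if l \<le> N then real (CARD('n) - 1) / real m * a l \<xi> else 0) - Z 0 * coeff q l" for l \<xi>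
  have A_cont: "continuous_on (sphere 0 1) (A l)" for l
    unfolding A_def using a[of l] m by (cases "l \<le> N") (auto intro!: continuous_intros)
  have sec: "(\<integral>x. indicator C (t *\<^sub>R \<xi> + x) * (1 / norm x) ^ k \<partial>hyperplane_measure \<xi>) = (\<Sum>l\<le>M. A l \<xi> * t ^ l)"
    if \<xi>: "norm \<xi> = 1" and t: "0 \<le> t" "t \<le> r" for \<xi> t
  proof -
    have dq: "degree q \<le> m"
      unfolding q_def using ev by (intro order_trans[OF degree_power_le]) auto
    have "(r\<^sup>2 - t\<^sup>2) ^ (m div 2) = poly q t" by (simp add: q_def power2_eq_square)
    also have "\<dots> = (\<Sum>l\<le>M. coeff q l * t ^ l)"
      unfolding poly_altdef using dq by (intro sum.mono_neutral_left) (auto simp: coeff_eq_0 M_def)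
    finally have 1: "(r\<^sup>2 - t\<^sup>2) ^ (m div 2) = (\<Sum>l\<le>M. coeff q l * t ^ l)" .
    have 2: "(\<Sum>l\<le>N. a l \<xi> * t ^ l) = (\<Sum>l\<le>M. (if l \<le> N then a l \<xi> else 0) * t ^ l)"
      by (rule sum.mono_neutral_cong_left) (auto simp: M_def)
    have "(\<integral>x. indicator C (t *\<^sub>R \<xi> + x) * (1 / norm x) ^ k \<partial>hyperplane_measure \<xi>)
      = real (CARD('n) - 1) / real m * dual_section_fun K m \<xi> t - (r\<^sup>2 - t\<^sup>2) ^ (m div 2) * Z 0"
      unfolding C_def by (rule section_shell[OF \<xi> K r(2) t])
    also have "\<dots> = (\<Sum>l\<le>M. real (CARD('n) - 1) / real m * ((if l \<le> N then a l \<xi> else 0) * t ^ l) - coeff q l * t ^ l * Z 0)"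
      by (simp only: DS[OF \<xi> t] 1 2 sum_distrib_left sum_distrib_right sum_subtractf)
    also have "\<dots> = (\<Sum>l\<le>M. A l \<xi> * t ^ l)"
      by (intro sum.cong refl) (simp add: A_def algebra_simps)
    finally show ?thesis .
  qed
  define F where "F T \<eta> x = ((\<eta> \<bullet> y) ^ e * indicator {1<..2} (norm \<eta>)) * indicator C x * indicator {0..T} (x \<bullet> \<eta>) * area_weight k x \<eta>"
    for T and \<eta> x :: "real^'n"
  \<comment> \<open>\<open>Y\<close> and \<open>X\<close> anticipate the coefficients of
    \<open>T ^ (l + 1)\<close> and \<open>T ^ (b + 1)\<close> in the two inner integrals. The raised
    exponents and the denominators come from integrating a power of \<open>t\<close> up to
    \<open>T\<close> divided by the length of the fixed vector.\<close>
  define Y where "Y l \<eta> = indicator {1<..2} (norm \<eta>) * ((\<eta> \<bullet> y) ^ e * ((1 / norm \<eta>) ^ k * (A l (sgn \<eta>) * (1 / norm \<eta>) ^ (l + 1) / real (l + 1))))"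
    for l and \<eta> :: "real^'n"
  define X where "X b x = indicator C x * ((1 / norm x) ^ (k + b + 1) * poly (ridge_poly m Z e b) (sgn x \<bullet> y)) / real (b + 1)"
    for b and x :: "real^'n"
  have pow2: "\<bar>\<eta> \<bullet> y\<bar> ^ e \<le> 2 ^ e" if "norm \<eta> \<le> 2" for \<eta>
    using Cauchy_Schwarz_ineq2[of \<eta> y] that y by (intro power_mono) auto
  have innerx: "(\<integral>x. F T \<eta> x \<partial>lborel) = (\<Sum>l\<le>M. T ^ (l + 1) * Y l \<eta>)" if T: "0 < T" "T \<le> r" for T \<eta>
  proof (cases "norm \<eta> \<in> {1<..2}")
    case True
    define p where "p = norm \<eta>"
    have p: "1 < p" "p \<le> 2" using True by (auto simp: p_def)
    have \<xi>: "norm (sgn \<eta>) = 1" using p by (simp add: p_def norm_sgn) auto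
    have "\<eta> \<noteq> 0" using p by (auto simp: p_def)
    then have \<eta>: "\<eta> = p *\<^sub>R sgn \<eta>" by (simp add: p_def sgn_div_norm)
    define g where "g x = (\<eta> \<bullet> y) ^ e * indicator C x" for x
    have [measurable]: "g \<in> borel_measurable borel" unfolding g_def by measurable
    have gb: "\<bar>g x\<bar> \<le> 2 ^ e * indicator (cball 0 R) x" for x
      using pow2[of \<eta>] R(2) p by (auto simp: g_def C_def indicator_def power_abs p_def)
    have "(\<integral>x. F T \<eta> x \<partial>lborel) = (\<integral>x. g x * indicator {0..T} (x \<bullet> (p *\<^sub>R sgn \<eta>)) * area_weight k x (p *\<^sub>R sgn \<eta>) \<partial>lborel)"
      using True unfolding F_def g_def \<eta>[symmetric] by simp
    also have "\<dots> = (1 / p) ^ k * (\<integral>t. indicator {0..T / p} t *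
         (\<integral>x. g (t *\<^sub>R sgn \<eta> + x) * (1 / norm x) ^ k \<partial>hyperplane_measure (sgn \<eta>)) \<partial>lborel)"
    proof (rule integral_area_slice[OF \<xi>])
      show "integrable lborel (\<lambda>x. g x * indicator {0..T} (x \<bullet> (p *\<^sub>R sgn \<eta>)) * area_weight k x (p *\<^sub>R sgn \<eta>))"
        unfolding \<eta>[symmetric] by (rule integrable_area[OF _ _ gb]) (use p R T in \<open>auto simp: p_def\<close>)
    qed (use p in auto)
    also have "(\<integral>t. indicator {0..T / p} t * (\<integral>x. g (t *\<^sub>R sgn \<eta> + x) * (1 / norm x) ^ k \<partial>hyperplane_measure (sgn \<eta>)) \<partial>lborel)
      = (\<integral>t. (\<eta> \<bullet> y) ^ e * (indicator {0..T / p} t * (\<Sum>l\<le>M. A l (sgn \<eta>) * t ^ l)) \<partial>lborel)"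
    proof (rule Bochner_Integration.integral_cong[OF refl], goal_cases)
      case (1 t)
      show ?case
      proof (cases "t \<in> {0..T / p}")
        case True
        \<comment> \<open>Here \<open>|\<eta>| > 1\<close> keeps the heights in
          \<open>[0, r]\<close>, where the slices of \<open>C\<close> are controlled.\<close>
        have "T / p \<le> T / 1" using p T by (intro divide_left_mono) auto
        then have t: "0 \<le> t" "t \<le> r" using True T by auto
        show ?thesis unfolding g_def mult.assoc integral_mult_right_zero sec[OF \<xi> t]
          by (simp only: mult_ac)
      qed simp
    qed
    also have "\<dots> = (\<eta> \<bullet> y) ^ e * (\<Sum>l\<le>M. A l (sgn \<eta>) * (T / p) ^ (l + 1) / real (l + 1))"
      using T p unfolding integral_mult_right_zero by (subst integral_power_sum_Icc) auto
    also have "(1 / p) ^ k * \<dots> = (\<Sum>l\<le>M. T ^ (l + 1) * Y l \<eta>)"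
      unfolding sum_distrib_left
    proof (rule sum.cong[OF refl], goal_cases)
      case (1 l)
      have "(T / p) ^ (l + 1) = T ^ (l + 1) * (1 / p) ^ (l + 1)" by (simp only: power_mult_distrib[symmetric] times_divide_eq_right mult_1_right)
      then show ?case
        using True unfolding Y_def p_def[symmetric]
        by (simp only: indicator_simps mult_1_left mult_ac times_divide_eq_right)
    qed
    finally show ?thesis .
  qed (simp add: F_def Y_def)
  have inner\<eta>: "(\<integral>\<eta>. F T \<eta> x \<partial>lborel) = (\<Sum>b\<le>e + m. T ^ (b + 1) * X b x)" if T: "0 < T" "T \<le> r" for T x
  proof (cases "x \<in> C")
    case True
    define s where "s = norm x"
    have s: "r < s" "0 < s" using True r by (auto simp: C_def s_def)
    have \<omega>: "norm (sgn x) = 1" using s by (auto simp: s_def norm_sgn)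
    have "x \<noteq> 0" using s by (auto simp: s_def)
    then have x: "x = s *\<^sub>R sgn x" by (simp add: s_def sgn_div_norm)
    define g where "g \<eta> = (\<eta> \<bullet> y) ^ e * indicator {1<..2} (norm \<eta>)" for \<eta>
    have [measurable]: "g \<in> borel_measurable borel" unfolding g_def by measurable
    have gb: "\<bar>g \<eta>\<bar> \<le> 2 ^ e * indicator (cball 0 2) \<eta>" for \<eta>
      using pow2[of \<eta>] by (auto simp: g_def indicator_def power_abs)
    have "(\<integral>\<eta>. F T \<eta> x \<partial>lborel) = (\<integral>\<eta>. g \<eta> * indicator {0..T} (\<eta> \<bullet> (s *\<^sub>R sgn x)) * area_weight k \<eta> (s *\<^sub>R sgn x) \<partial>lborel)"
      using True unfolding F_def g_def x[symmetric] by (simp add: inner_commute[of x] area_weight_commute[of k x])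
    also have "\<dots> = (1 / s) ^ k * (\<integral>t. indicator {0..T / s} t *
         (\<integral>\<eta>. g (t *\<^sub>R sgn x + \<eta>) * (1 / norm \<eta>) ^ k \<partial>hyperplane_measure (sgn x)) \<partial>lborel)"
    proof (rule integral_area_slice[OF \<omega>])
      show "integrable lborel (\<lambda>\<eta>. g \<eta> * indicator {0..T} (\<eta> \<bullet> (s *\<^sub>R sgn x)) * area_weight k \<eta> (s *\<^sub>R sgn x))"
        unfolding x[symmetric] by (rule integrable_area[OF _ _ gb]) (use s T in \<open>auto simp: s_def\<close>)
    qed (use s in auto)
    also have "(\<integral>t. indicator {0..T / s} t * (\<integral>\<eta>. g (t *\<^sub>R sgn x + \<eta>) * (1 / norm \<eta>) ^ k \<partial>hyperplane_measure (sgn x)) \<partial>lborel)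
      = (\<integral>t. indicator {0..T / s} t * (\<Sum>b\<le>e + m. poly (ridge_poly m Z e b) (sgn x \<bullet> y) * t ^ b) \<partial>lborel)"
    proof (rule Bochner_Integration.integral_cong[OF refl], goal_cases)
      case (1 t)
      show ?case
      proof (cases "t \<in> {0..T / s}")
        case True
        \<comment> \<open>Here \<open>|x| > r \<ge> T\<close> keeps the heights in
          \<open>[0, 1]\<close>, where the slices of the shell are controlled.\<close>
        have "T / s \<le> 1" using s T by simp
        then have t: "0 \<le> t" "t \<le> 1" using True by auto
        show ?thesis unfolding g_def integral_annulus_section[OF \<omega> y t] ..
      qed simp
    qed
    also have "\<dots> = (\<Sum>b\<le>e + m. poly (ridge_poly m Z e b) (sgn x \<bullet> y) * (T / s) ^ (b + 1) / real (b + 1))"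
      using T s by (subst integral_power_sum_Icc) auto
    also have "(1 / s) ^ k * \<dots> = (\<Sum>b\<le>e + m. T ^ (b + 1) * X b x)"
      unfolding sum_distrib_left
    proof (rule sum.cong[OF refl], goal_cases)
      case (1 b)
      have "(T / s) ^ (b + 1) = T ^ (b + 1) * (1 / s) ^ (b + 1)" by (simp only: power_mult_distrib[symmetric] times_divide_eq_right mult_1_right)
      then show ?case
        using True unfolding X_def s_def[symmetric] add.assoc[of k b 1] power_add[of "1 / s" k "b + 1"]
        by (simp only: indicator_simps mult_1_left mult_ac times_divide_eq_right)
    qed
    finally show ?thesis .
  qed (simp add: F_def X_def)
  have Yint: "integrable lborel (Y l)" for l
  proof -
    let ?S = "cball 0 2 - ball 0 1 :: (real^'n) set"
    let ?h = "\<lambda>\<eta>. (\<eta> \<bullet> y) ^ e * ((1 / norm \<eta>) ^ k * (A l (sgn \<eta>) * (1 / norm \<eta>) ^ (l + 1) / real (l + 1)))"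
    have nz: "\<eta> \<noteq> 0" if "\<eta> \<in> ?S" for \<eta> using that by auto
    have "continuous_on ?S (\<lambda>\<eta>. A l (sgn \<eta>))"
    proof (rule continuous_on_compose2[OF A_cont])
      show "continuous_on ?S sgn" using nz by (intro continuous_on_sgn continuous_intros) auto
      show "sgn ` ?S \<subseteq> sphere 0 1" using nz by (auto simp: norm_sgn)
    qed
    then have "continuous_on ?S ?h" using nz by (intro continuous_intros) auto
    then have "integrable lborel (\<lambda>\<eta>. indicator ?S \<eta> *\<^sub>R ?h \<eta>)"
      by (intro borel_integrable_compact compact_diff) auto
    \<comment> \<open>Continuity gives integrability on the compact closed shell; the half-open
      shell is cut out of it.\<close>
    then have "integrable lborel (\<lambda>\<eta>. indicator {\<eta>. 1 < norm \<eta>} \<eta> *\<^sub>R (indicator ?S \<eta> *\<^sub>R ?h \<eta>))"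
      by (rule integrable_mult_indicator[rotated]) simp
    also have "(\<lambda>\<eta>. indicator {\<eta>. 1 < norm \<eta>} \<eta> *\<^sub>R (indicator ?S \<eta> *\<^sub>R ?h \<eta>)) = Y l"
      by (auto simp: fun_eq_iff Y_def indicator_def)
    finally show ?thesis .
  qed
  have Xint: "integrable lborel (X b)" for b
  proof -
    let ?S = "K - ball 0 r"
    let ?h = "\<lambda>x. (1 / norm x) ^ (k + b + 1) * poly (ridge_poly m Z e b) (sgn x \<bullet> y) / real (b + 1)"
    have nz: "x \<noteq> 0" if "x \<in> ?S" for x using that r by auto
    have "continuous_on ?S sgn" using nz by (intro continuous_on_sgn continuous_intros) auto
    then have "continuous_on ?S ?h" using nz by (intro continuous_intros) auto
    then have "integrable lborel (\<lambda>x. indicator ?S x *\<^sub>R ?h x)"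
      using K by (intro borel_integrable_compact compact_diff) auto
    then have "integrable lborel (\<lambda>x. indicator {x. r < norm x} x *\<^sub>R (indicator ?S x *\<^sub>R ?h x))"
      by (rule integrable_mult_indicator[rotated]) simp
    also have "(\<lambda>x. indicator {x. r < norm x} x *\<^sub>R (indicator ?S x *\<^sub>R ?h x)) = X b"
      by (auto simp: fun_eq_iff X_def C_def indicator_def)
    finally show ?thesis .
  qed
  \<comment> \<open>The bound for the inner integral is uniform in \<open>\<eta>\<close> since
    \<open>|\<eta>| > 1\<close>, and \<open>\<eta>\<close> ranges over a bounded set.\<close>
  have Fint: "integrable (lborel \<Otimes>\<^sub>M lborel) (\<lambda>(\<eta>, x). F T \<eta> x)" if T: "0 < T" for T
  proof (rule integrableI_bounded)
    show Fm: "(\<lambda>(\<eta>, x). F T \<eta> x) \<in> borel_measurable (lborel \<Otimes>\<^sub>M lborel)"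
      unfolding F_def by measurable
    have "(\<integral>\<^sup>+ z. ennreal (norm (case z of (\<eta>, x) \<Rightarrow> F T \<eta> x)) \<partial>(lborel \<Otimes>\<^sub>M lborel))
      = (\<integral>\<^sup>+\<eta>. \<integral>\<^sup>+x. ennreal (norm (F T \<eta> x)) \<partial>lborel \<partial>lborel)"
      using Fm by (subst lborel.nn_integral_fst[symmetric]) auto
    also have "\<dots> \<le> (\<integral>\<^sup>+\<eta>. ennreal (2 ^ e * (T * (R ^ m * Z 0))) * indicator (cball (0::real^'n) 2) \<eta> \<partial>lborel)"
    proof (rule nn_integral_mono, goal_cases)
      case (1 \<eta>)
      show ?case
      proof (cases "norm \<eta> \<in> {1<..2}")
        case True
        define g where "g x = (\<eta> \<bullet> y) ^ e * indicator C x" for x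
        have gb: "\<bar>g x\<bar> \<le> 2 ^ e * indicator (cball 0 R) x" for x
          using pow2[of \<eta>] R(2) True by (auto simp: g_def C_def indicator_def power_abs)
        have "(\<integral>\<^sup>+x. ennreal (norm (F T \<eta> x)) \<partial>lborel)
          = (\<integral>\<^sup>+x. ennreal (norm (g x * indicator {0..T} (x \<bullet> \<eta>) * area_weight k x \<eta>)) \<partial>lborel)"
          using True by (simp add: F_def g_def)
        also have "\<dots> \<le> ennreal (2 ^ e * ((1 / norm \<eta>) ^ k * (T / norm \<eta>) * (R ^ m * Z 0)))"
          by (rule nn_integral_area_bound[OF _ gb]) (use True R T in auto)
        also have "\<dots> \<le> ennreal (2 ^ e * (1 * T * (R ^ m * Z 0)))"
        proof (intro ennreal_leI mult_left_mono mult_right_mono mult_mono)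
          show "(1 / norm \<eta>) ^ k \<le> 1" using True by (intro power_le_one) (auto simp: divide_le_eq_1)
          show "T / norm \<eta> \<le> T" using True T by (simp add: divide_le_eq)
        qed (use True R T Zeven[of 0] in \<open>auto simp: less_imp_le\<close>)
        finally show ?thesis using True by simp
      qed (simp add: F_def)
    qed
    also have "\<dots> = ennreal (2 ^ e * (T * (R ^ m * Z 0))) * emeasure lborel (cball (0::real^'n) 2)"
      by (rule nn_integral_cmult_indicator) simp
    also have "\<dots> < \<infinity>"
      using emeasure_compact_finite[OF compact_cball, of "0::real^'n" 2] by (simp add: ennreal_mult_less_top)
    finally show "(\<integral>\<^sup>+ z. ennreal (norm (case z of (\<eta>, x) \<Rightarrow> F T \<eta> x)) \<partial>(lborel \<Otimes>\<^sub>M lborel)) < \<infinity>" .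
  qed
  have "(\<Sum>l\<le>M. (\<integral>\<eta>. Y l \<eta> \<partial>lborel) * T ^ (l + 1)) = (\<Sum>b\<le>e + m. (\<integral>x. X b x \<partial>lborel) * T ^ (b + 1))"
    if T: "0 < T" "T \<le> r" for T
  proof -
    have "(\<Sum>b\<le>e + m. (\<integral>x. X b x \<partial>lborel) * T ^ (b + 1)) = (\<integral>x. (\<Sum>b\<le>e + m. T ^ (b + 1) * X b x) \<partial>lborel)"
      using Xint by (subst Bochner_Integration.integral_sum) (auto simp: mult.commute)
    also have "\<dots> = (\<integral>x. (\<integral>\<eta>. F T \<eta> x \<partial>lborel) \<partial>lborel)" by (simp only: inner\<eta>[OF T])
    also have "\<dots> = (\<integral>\<eta>. (\<integral>x. F T \<eta> x \<partial>lborel) \<partial>lborel)"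
      by (rule lborel_pair.Fubini_integral[OF Fint[OF T(1)]])
    also have "\<dots> = (\<integral>\<eta>. (\<Sum>l\<le>M. T ^ (l + 1) * Y l \<eta>) \<partial>lborel)" by (simp only: innerx[OF T])
    also have "\<dots> = (\<Sum>l\<le>M. (\<integral>\<eta>. Y l \<eta> \<partial>lborel) * T ^ (l + 1))"
      using Yint by (subst Bochner_Integration.integral_sum) (auto simp: mult.commute)
    finally show ?thesis ..
  qed
  then have "(\<integral>x. X b x \<partial>lborel) = 0"
    by (rule coeff_zero_of_poly_identity[OF r(1)]) (use b in \<open>simp_all add: M_def\<close>)
  then have "(\<integral>x. indicator (K - cball 0 r) x * ((1 / norm x) ^ (k + b + 1) * poly (ridge_poly m Z e b) (sgn x \<bullet> y)) \<partial>lborel) / real (b + 1) = 0"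
    unfolding X_def C_def by (simp only: integral_divide_zero)
  then show ?thesis unfolding divide_eq_0_iff by simp
qed

end

section \<open>Leading coefficients, elimination and concentration\<close>

lemma coeff_quadratic_power:
  fixes c :: real
  shows "coeff ([:c, 0, - 1:] ^ q) (2 * l) = real (q choose l) * (- 1) ^ l * c ^ (q - l)"
proof -
  have q: "[:c, 0, - 1:] = monom (- 1) 2 + [:c:]" by (simp add: monom_altdef numeral_2_eq_2)
  have cp: "[:c:] ^ i = [:c ^ i:]" for i by (induction i) (auto simp: one_pCons)
  have "[:c, 0, - 1:] ^ q = (\<Sum>i\<le>q. of_nat (q choose i) * monom (- 1) 2 ^ i * [:c:] ^ (q - i))"
    unfolding q by (rule binomial_ring)
  also have "\<dots> = (\<Sum>i\<le>q. monom (real (q choose i) * (- 1) ^ i * c ^ (q - i)) (2 * i))"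
    by (intro sum.cong refl) (simp add: monom_power cp of_nat_poly smult_monom mult_ac)
  finally have "coeff ([:c, 0, - 1:] ^ q) (2 * l) = (\<Sum>i\<le>q. if i = l then real (q choose i) * (- 1) ^ i * c ^ (q - i) else 0)"
    by (simp add: coeff_sum cong: if_cong)
  also have "\<dots> = real (q choose l) * (- 1) ^ l * c ^ (q - l)"
    by (cases "l \<le> q") (auto simp: binomial_eq_0)
  finally show ?thesis .
qed

lemma degree_ridge_poly: "degree (ridge_poly m Z e b) \<le> e"
  unfolding ridge_poly_def
proof (rule degree_sum_le)
  fix i assume "i \<in> {i. i \<le> e \<and> even i}"
  then have i: "i \<le> e" by simp
  have "degree (monom (1::real) (e - i) * [:1, 0, - 1:] ^ (i div 2)) \<le> (e - i) + 2 * (i div 2)"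
    by (intro order_trans[OF degree_mult_le] add_mono degree_monom_le order_trans[OF degree_power_le]) simp
  also have "\<dots> \<le> e" using i by linarith
  finally show "degree (smult (real (e choose i) * Z i * coeff (shell_poly m e i) b) (monom 1 (e - i) * [:1, 0, - 1:] ^ (i div 2))) \<le> e"
    by (rule order_trans[OF degree_smult_le])
qed simp

text \<open>No cancellation occurs in the leading coefficient: every summand has the sign of
  \<open>(-1) ^ ((b + e) div 2 + e)\<close>. This is where the parity of \<open>m\<close> enters.\<close>

lemma lead_coeff_ridge_poly:
  assumes m: "even m" and Z: "\<And>i. even i \<Longrightarrow> 0 < Z i" and be: "even (b + e)" "0 < b" "b < e + m"
  shows "coeff (ridge_poly m Z e b) e \<noteq> 0"
proof -
  define \<sigma> :: real where "\<sigma> = (- 1) ^ ((b + e) div 2) * (- 1) ^ e"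
  have \<sigma>: "\<sigma> * \<sigma> = 1" unfolding \<sigma>_def by (simp add: mult.assoc[symmetric] power_add[symmetric] mult_2[symmetric] mult.left_commute)
  \<comment> \<open>The absolute value of the coefficient of \<open>shell_poly\<close>. Its monomial
    factor shifts indices, so the coefficient vanishes for \<open>b < e - i\<close>.\<close>
  define w where "w i = (if e \<le> b + i then real (((m + i) div 2) choose ((b + i - e) div 2)) * (4 ^ ((m + i) div 2 - (b + i - e) div 2) - 1) else 0)" for i
  have w0: "0 \<le> w i" for i by (simp add: w_def)
  have summand: "coeff (shell_poly m e i) b * coeff (monom 1 (e - i) * [:1, 0, - 1:] ^ (i div 2)) e = \<sigma> * w i"
    if i: "i \<le> e" "even i" for i
  proof -
    have top: "coeff (monom (1::real) (e - i) * [:1, 0, - 1:] ^ (i div 2)) e = (- 1) ^ (i div 2)"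
      using i coeff_quadratic_power[of 1 "i div 2" "i div 2"] by (simp add: coeff_monom_mult)
    show ?thesis
    proof (cases "e \<le> b + i")
      case False
      then show ?thesis by (simp add: shell_poly_def coeff_monom_mult w_def)
    next
      case True
      define l where "l = (b + i - e) div 2"
      have "even (b + i - e)" using True be(1) i by (simp add: even_diff_nat)
      then have l: "b - (e - i) = 2 * l" using True i by (simp add: l_def)
      have "coeff (shell_poly m e i) b = (- 1) ^ l * w i"
      proof -
        have "coeff (shell_poly m e i) b
          = coeff ([:4, 0, - 1:] ^ ((m + i) div 2)) (2 * l) - coeff ([:1, 0, - 1:] ^ ((m + i) div 2)) (2 * l)"
          using True i(1) by (simp add: shell_poly_def coeff_monom_mult l)
        also have "\<dots> = (- 1) ^ l * w i"
          using True unfolding coeff_quadratic_power w_def l_def[symmetric] by (simp add: right_diff_distrib)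
        finally show ?thesis .
      qed
      moreover have "(- 1) ^ l * (- 1) ^ (i div 2) = \<sigma>"
      proof -
        have "(l + i div 2) + e = i + (b + e) div 2"
          using l i True be(1) by (auto elim!: evenE)
        then have "(- 1 :: real) ^ (l + i div 2) * (- 1) ^ e = (- 1) ^ i * (- 1) ^ ((b + e) div 2)"
          by (simp only: power_add[symmetric])
        then have S: "(- 1 :: real) ^ (l + i div 2) * (- 1) ^ e = (- 1) ^ ((b + e) div 2)"
          using i(2) by simp
        have "(- 1 :: real) ^ e * (- 1) ^ e = 1" by (simp add: power_add[symmetric] mult_2[symmetric])
        then show ?thesis unfolding \<sigma>_def S[symmetric] by (simp add: power_add mult.assoc)
      qed
      ultimately show ?thesis unfolding top by (simp add: mult_ac)
    qed
  qed
  have "coeff (ridge_poly m Z e b) e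
    = (\<Sum>i | i \<le> e \<and> even i. (real (e choose i) * Z i) * (coeff (shell_poly m e i) b * coeff (monom 1 (e - i) * [:1, 0, - 1:] ^ (i div 2)) e))"
    by (simp add: ridge_poly_def coeff_sum mult.assoc)
  also have "\<dots> = (\<Sum>i | i \<le> e \<and> even i. (real (e choose i) * Z i) * (\<sigma> * w i))"
    by (intro sum.cong refl) (simp only: mem_Collect_eq summand)
  also have "\<dots> = \<sigma> * (\<Sum>i | i \<le> e \<and> even i. real (e choose i) * Z i * w i)"
    by (simp add: sum_distrib_left mult_ac)
  finally have eq: "coeff (ridge_poly m Z e b) e = \<sigma> * (\<Sum>i | i \<le> e \<and> even i. real (e choose i) * Z i * w i)" .
  have "0 < (\<Sum>i | i \<le> e \<and> even i. real (e choose i) * Z i * w i)"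
  proof (rule sum_pos2)
    \<comment> \<open>The largest even \<open>i \<le> e\<close> gives a positive term:
      \<open>0 < b\<close> keeps its index in range when \<open>e\<close> is odd, and
      \<open>b < e + m\<close> makes the exponent of 4 positive.\<close>
    define i where "i = 2 * (e div 2)"
    show "i \<in> {i. i \<le> e \<and> even i}" by (simp add: i_def)
    then have ie: "i \<le> e" "even i" by auto
    have eb: "e \<le> b + i" using be(2) by (simp add: i_def)
    have "(b + i - e) div 2 < (m + i) div 2"
    proof -
      have "even (b + i - e)" using eb be(1) ie by (simp add: even_diff_nat)
      then show ?thesis using be(3) eb m ie by (auto elim!: evenE)
    qed
    then have "0 < w i"
      using eb by (simp add: w_def zero_less_binomial_iff one_less_power)
    then show "0 < real (e choose i) * Z i * w i" using ie Z[of i] by simp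
  qed (use w0 Z in \<open>auto simp: less_imp_le\<close>)
  then show ?thesis using eq \<sigma> by auto
qed

text \<open>Each relation is solved for its top moment and the lower ones are replaced by induction.
  Relations exist only for \<open>e\<close> of the parity of \<open>j\<close>, so moments of the
  other parity have to be removed first. The coefficients stay independent of \<open>y\<close>, as
  polynomiality along lines will require.\<close>

lemma finite_span_elimination:
  fixes M :: "nat \<Rightarrow> 'a::euclidean_space \<Rightarrow> real"
  assumes par: "\<And>i y. M i (- y) = (- 1) ^ i * M i y"
    and rel: "\<And>e. j < e \<Longrightarrow> even (e + j) \<Longrightarrow> \<exists>c::nat \<Rightarrow> real. c e \<noteq> 0 \<and> (\<forall>y. norm y = 1 \<longrightarrow> (\<Sum>i\<le>e. c i * M i y) = 0)"
  shows "even (e + j) \<Longrightarrow> \<exists>d::nat \<Rightarrow> real. \<forall>y. norm y = 1 \<longrightarrow> M e y = (\<Sum>i | i \<le> j \<and> even (i + j). d i * M i y)"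
proof (induction e rule: less_induct)
  case (less e)
  show ?case
  proof (cases "e \<le> j")
    case True
    have eq: "M e y = (\<Sum>i | i \<le> j \<and> even (i + j). (if i = e then 1 else 0) * M i y)" for y
      using True less.prems by (subst sum.mono_neutral_right[of _ "{e}"]) auto
    show ?thesis by (intro exI[of _ "\<lambda>i. if i = e then 1 else 0"] allI impI) (rule eq)
  next
    case False
    then obtain c where c: "c e \<noteq> 0" "\<And>y. norm y = 1 \<Longrightarrow> (\<Sum>i\<le>e. c i * M i y) = 0"
      using rel[of e] less.prems by auto
    have "\<exists>d. \<forall>i<e. even (i + j) \<longrightarrow> (\<forall>y. norm y = 1 \<longrightarrow> M i y = (\<Sum>h | h \<le> j \<and> even (h + j). d i h * M h y))"
      using less.IH by metis
    then obtain d where d: "\<And>i y. i < e \<Longrightarrow> even (i + j) \<Longrightarrow> norm y = 1 \<Longrightarrow> M i y = (\<Sum>h | h \<le> j \<and> even (h + j). d i h * M h y)"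
      by blast
    define I where "I = {i. i < e \<and> even (i + j)}"
    have finI: "finite I" by (simp add: I_def)
    have "M e y = (\<Sum>h | h \<le> j \<and> even (h + j). (\<Sum>i\<in>I. - c i / c e * d i h) * M h y)" if y: "norm y = 1" for y
    proof -
      \<comment> \<open>Adding the relation at \<open>- y\<close> with the sign
        \<open>(- 1) ^ e\<close> doubles the terms of the parity of \<open>e\<close> and cancels the
        others.\<close>
      have "0 = (\<Sum>i\<le>e. c i * M i y) + (- 1) ^ e * (\<Sum>i\<le>e. c i * M i (- y))"
        using c(2)[of y] c(2)[of "- y"] y by simp
      also have "\<dots> = (\<Sum>i\<le>e. (1 + (- 1) ^ (i + e)) * (c i * M i y))"
        by (simp add: par sum_distrib_left sum.distrib[symmetric] algebra_simps power_add)
      also have "\<dots> = (\<Sum>i\<in>insert e I. 2 * (c i * M i y))"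
      proof (rule sum.mono_neutral_cong_right)
        show "\<forall>i\<in>{..e} - insert e I. (1 + (- 1) ^ (i + e)) * (c i * M i y) = 0"
        proof
          fix i assume i: "i \<in> {..e} - insert e I"
          then have "odd (i + e)" using less.prems by (auto simp: I_def)
          then show "(1 + (- 1) ^ (i + e)) * (c i * M i y) = 0" by simp
        qed
        fix i assume "i \<in> insert e I"
        then have "even (i + e)" using less.prems by (auto simp: I_def)
        then show "(1 + (- 1) ^ (i + e)) * (c i * M i y) = 2 * (c i * M i y)" by simp
      qed (auto simp: I_def)
      also have "\<dots> = 2 * (c e * M e y + (\<Sum>i\<in>I. c i * M i y))"
        using finI by (simp add: I_def sum_distrib_left)
      finally have "c e * M e y = - (\<Sum>i\<in>I. c i * M i y)" by simp
      then have "M e y = (\<Sum>i\<in>I. - c i / c e * M i y)"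
      proof -
        assume "c e * M e y = - (\<Sum>i\<in>I. c i * M i y)"
        then have "M e y = - (\<Sum>i\<in>I. c i * M i y) / c e" using c(1) by (metis nonzero_mult_div_cancel_left)
        then show ?thesis by (simp add: sum_divide_distrib sum_negf)
      qed
      also have "\<dots> = (\<Sum>i\<in>I. \<Sum>h | h \<le> j \<and> even (h + j). - c i / c e * d i h * M h y)"
        by (intro sum.cong refl) (simp add: I_def d[OF _ _ y] sum_distrib_left mult.assoc)
      also have "\<dots> = (\<Sum>h | h \<le> j \<and> even (h + j). (\<Sum>i\<in>I. - c i / c e * d i h) * M h y)"
        by (subst sum.swap) (simp only: sum_distrib_right)
      finally show ?thesis .
    qed
    then show ?thesis by (intro exI[of _ "\<lambda>h. \<Sum>i\<in>I. - c i / c e * d i h"]) blast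
  qed
qed

text \<open>Laplace's method for powers: the normalized weights \<open>w ^ e\<close> gather where
  \<open>w\<close> is close to 1. There \<open>near\<close> keeps \<open>H\<close> close to
  \<open>H0\<close>, and \<open>mass\<close> says that this region is not null.\<close>

lemma concentration_at_maximum:
  fixes w H :: "'a \<Rightarrow> real"
  assumes "finite_measure \<mu>" and w[measurable]: "w \<in> borel_measurable \<mu>" and H[measurable]: "H \<in> borel_measurable \<mu>"
    and w01: "\<And>z. 0 \<le> w z" "\<And>z. w z \<le> 1" and B: "\<And>z. \<bar>H z\<bar> \<le> B" "\<bar>H0\<bar> \<le> B"
    and near: "\<And>\<epsilon>. 0 < \<epsilon> \<Longrightarrow> \<exists>\<delta>>0. \<delta> < 1 \<and> (\<forall>z. 1 - \<delta> < w z \<longrightarrow> \<bar>H z - H0\<bar> \<le> \<epsilon>)"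
    and mass: "\<And>\<delta>. 0 < \<delta> \<Longrightarrow> \<delta> < 1 \<Longrightarrow> 0 < measure \<mu> {z \<in> space \<mu>. 1 - \<delta> < w z}"
  shows "(\<lambda>e. (\<integral>z. w z ^ e * H z \<partial>\<mu>) / (\<integral>z. w z ^ e \<partial>\<mu>)) \<longlonglongrightarrow> H0"
    and "\<And>e. 0 < (\<integral>z. w z ^ e \<partial>\<mu>)"
proof -
  interpret finite_measure \<mu> by fact
  have B0: "0 \<le> B" using B(2) by linarith
  let ?I = "\<lambda>e. \<integral>z. w z ^ e * H z \<partial>\<mu>" and ?c = "\<lambda>e. \<integral>z. w z ^ e \<partial>\<mu>"
  have iw: "integrable \<mu> (\<lambda>z. w z ^ e)" for e
    using w01 by (intro integrable_const_bound[of _ 1]) (auto simp: power_le_one)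
  have iwH: "integrable \<mu> (\<lambda>z. w z ^ e * H z)" for e
  proof (rule integrable_const_bound[of _ B])
    show "AE z in \<mu>. norm (w z ^ e * H z) \<le> B"
    proof (rule AE_I2)
      fix z
      have "w z ^ e * \<bar>H z\<bar> \<le> 1 * B" using w01 B(1) B0 by (intro mult_mono power_le_one) auto
      then show "norm (w z ^ e * H z) \<le> B" using w01 by (simp add: abs_mult)
    qed
  qed measurable
  have lower: "(1 - \<delta>) ^ e * measure \<mu> {z \<in> space \<mu>. 1 - \<delta> < w z} \<le> ?c e" if \<delta>: "0 < \<delta>" "\<delta> < 1" for \<delta> e
  proof -
    have "(1 - \<delta>) ^ e * measure \<mu> {z \<in> space \<mu>. 1 - \<delta> < w z} = (\<integral>z. (1 - \<delta>) ^ e * indicator {z \<in> space \<mu>. 1 - \<delta> < w z} z \<partial>\<mu>)"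
      by simp
    also have "\<dots> \<le> ?c e"
    proof (rule integral_mono)
      show "integrable \<mu> (\<lambda>z. (1 - \<delta>) ^ e * indicator {z \<in> space \<mu>. 1 - \<delta> < w z} z)"
        by (intro integrable_mult_right integrable_real_indicator) (auto simp: less_top[symmetric])
      fix z show "(1 - \<delta>) ^ e * indicator {z \<in> space \<mu>. 1 - \<delta> < w z} z \<le> w z ^ e"
        using w01 \<delta> by (auto simp: indicator_def intro!: power_mono)
    qed (rule iw)
    finally show ?thesis .
  qed
  show c0: "0 < ?c e" for e
  proof -
    have "0 < (1 - 1/2) ^ e * measure \<mu> {z \<in> space \<mu>. 1 - 1/2 < w z}"
      using mass[of "1/2"] by simp
    then show ?thesis using lower[of "1/2" e] by linarith
  qed
  show "(\<lambda>e. ?I e / ?c e) \<longlonglongrightarrow> H0"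
  proof (rule LIMSEQ_I)
    fix \<epsilon> :: real assume \<epsilon>: "0 < \<epsilon>"
    obtain \<delta> where \<delta>: "0 < \<delta>" "\<delta> < 1" "\<And>z. 1 - \<delta> < w z \<Longrightarrow> \<bar>H z - H0\<bar> \<le> \<epsilon> / 2"
      using near[of "\<epsilon> / 2"] \<epsilon> by auto
    define \<kappa> where "\<kappa> = measure \<mu> {z \<in> space \<mu>. 1 - \<delta> / 2 < w z}"
    have \<kappa>: "0 < \<kappa>" unfolding \<kappa>_def using \<delta> by (intro mass) auto
    \<comment> \<open>Away from the maximum the weight is at most \<open>(1 - \<delta>) ^ e\<close>,
      while the total is at least a fixed multiple of \<open>(1 - \<delta> / 2) ^ e\<close>; the two
      different thresholds make the ratio decay geometrically.\<close>
    define \<tau> where "\<tau> = (1 - \<delta>) / (1 - \<delta> / 2)"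
    have \<tau>: "0 \<le> \<tau>" "\<tau> < 1" using \<delta> by (auto simp: \<tau>_def field_simps)
    have bound: "\<bar>?I e / ?c e - H0\<bar> \<le> \<epsilon> / 2 + 2 * B * measure \<mu> (space \<mu>) / \<kappa> * \<tau> ^ e" for e
    proof -
      have "?I e - H0 * ?c e = (\<integral>z. w z ^ e * H z - H0 * w z ^ e \<partial>\<mu>)"
        using iw iwH by simp
      also have "\<bar>\<dots>\<bar> \<le> (\<integral>z. \<bar>w z ^ e * H z - H0 * w z ^ e\<bar> \<partial>\<mu>)" by (rule integral_abs_bound)
      also have "\<dots> \<le> (\<integral>z. \<epsilon> / 2 * w z ^ e + 2 * B * (1 - \<delta>) ^ e \<partial>\<mu>)"
      proof (rule integral_mono)
        show "integrable \<mu> (\<lambda>z. \<bar>w z ^ e * H z - H0 * w z ^ e\<bar>)" using iw iwH by simp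
        show "integrable \<mu> (\<lambda>z. \<epsilon> / 2 * w z ^ e + 2 * B * (1 - \<delta>) ^ e)" using iw by simp
        fix z
        have e: "\<bar>w z ^ e * H z - H0 * w z ^ e\<bar> = w z ^ e * \<bar>H z - H0\<bar>"
        proof -
          have "w z ^ e * H z - H0 * w z ^ e = w z ^ e * (H z - H0)" by (simp add: algebra_simps)
          then show ?thesis using w01 by (simp add: abs_mult)
        qed
        show "\<bar>w z ^ e * H z - H0 * w z ^ e\<bar> \<le> \<epsilon> / 2 * w z ^ e + 2 * B * (1 - \<delta>) ^ e"
        proof (cases "1 - \<delta> < w z")
          case True
          have "w z ^ e * \<bar>H z - H0\<bar> \<le> \<epsilon> / 2 * w z ^ e"
            using \<delta>(3)[OF True] w01 by (subst mult.commute, intro mult_right_mono) auto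
          moreover have "0 \<le> 2 * B * (1 - \<delta>) ^ e" using B0 \<delta> by simp
          ultimately show ?thesis unfolding e by linarith
        next
          case False
          have "\<bar>H z - H0\<bar> \<le> 2 * B" using B(1)[of z] B(2) by linarith
          then have "w z ^ e * \<bar>H z - H0\<bar> \<le> 2 * B * (1 - \<delta>) ^ e"
            using False w01 \<delta> B0 by (subst mult.commute, intro mult_mono power_mono) auto
          moreover have "0 \<le> \<epsilon> / 2 * w z ^ e" using \<epsilon> w01 by simp
          ultimately show ?thesis unfolding e by linarith
        qed
      qed
      also have "\<dots> = \<epsilon> / 2 * ?c e + 2 * B * (1 - \<delta>) ^ e * measure \<mu> (space \<mu>)"
        using iw by simp
      finally have 1: "\<bar>?I e - H0 * ?c e\<bar> \<le> \<epsilon> / 2 * ?c e + 2 * B * (1 - \<delta>) ^ e * measure \<mu> (space \<mu>)" .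
      have "(1 - \<delta>) ^ e = \<tau> ^ e * (1 - \<delta> / 2) ^ e" using \<delta> by (simp add: \<tau>_def power_mult_distrib[symmetric])
      also have "\<dots> \<le> \<tau> ^ e * (?c e / \<kappa>)"
        using lower[of "\<delta> / 2" e] \<kappa> \<tau> \<delta> unfolding \<kappa>_def[symmetric]
        by (intro mult_left_mono) (simp_all add: field_simps)
      finally have "2 * B * measure \<mu> (space \<mu>) * (1 - \<delta>) ^ e \<le> 2 * B * measure \<mu> (space \<mu>) * (\<tau> ^ e * (?c e / \<kappa>))"
        using B0 by (intro mult_left_mono) auto
      then have "\<bar>?I e - H0 * ?c e\<bar> \<le> (\<epsilon> / 2 + 2 * B * measure \<mu> (space \<mu>) / \<kappa> * \<tau> ^ e) * ?c e"
        using 1 by (simp add: algebra_simps)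
      moreover have "\<bar>?I e / ?c e - H0\<bar> = \<bar>?I e - H0 * ?c e\<bar> / ?c e"
      proof -
        have "?I e / ?c e - H0 = (?I e - H0 * ?c e) / ?c e"
          using c0[of e] by (simp add: diff_divide_distrib)
        then show ?thesis using c0[of e] by (simp add: abs_divide)
      qed
      ultimately show ?thesis using c0[of e] by (simp add: pos_divide_le_eq)
    qed
    have "(\<lambda>e. 2 * B * measure \<mu> (space \<mu>) / \<kappa> * \<tau> ^ e) \<longlonglongrightarrow> 2 * B * measure \<mu> (space \<mu>) / \<kappa> * 0"
      using \<tau> by (intro tendsto_intros LIMSEQ_realpow_zero) auto
    then have "\<forall>\<^sub>F e in sequentially. 2 * B * measure \<mu> (space \<mu>) / \<kappa> * \<tau> ^ e < \<epsilon> / 2"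
      using \<epsilon> by (intro order_tendstoD) auto
    then obtain e0 where e0: "\<And>e. e0 \<le> e \<Longrightarrow> 2 * B * measure \<mu> (space \<mu>) / \<kappa> * \<tau> ^ e < \<epsilon> / 2"
      by (auto simp: eventually_sequentially)
    show "\<exists>no. \<forall>e\<ge>no. norm (?I e / ?c e - H0) < \<epsilon>"
    proof (intro exI allI impI)
      fix e assume "e0 \<le> e"
      then show "norm (?I e / ?c e - H0) < \<epsilon>"
        using bound[of e] e0[of e] unfolding real_norm_def by linarith
    qed
  qed
qed

section \<open>Ridge moments determine power sums of the gauge\<close>

lemma inner_power_bound:
  fixes v y :: "'a::euclidean_space"
  assumes "norm v \<le> 1"
  shows "\<bar>(v \<bullet> y) ^ i\<bar> \<le> norm y ^ i"
proof -
  have "\<bar>v \<bullet> y\<bar> \<le> norm y"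
    using Cauchy_Schwarz_ineq2[of v y] mult_right_mono[OF assms norm_ge_zero[of y]] by simp
  then show ?thesis by (simp add: power_abs power_mono)
qed

locale inscribed_ball_body =
  fixes K :: "(real^'n) set" and r :: real and j :: nat
  assumes K: "compact K" "convex K" and r: "0 < r" "cball 0 r \<subseteq> interior K" and j: "0 < j"
begin

text \<open>The exponent \<open>n + j\<close> is such that, with the Jacobian
  \<open>l ^ (n - 1)\<close>, integration along rays produces the \<open>j\<close>-th power of the
  gauge.\<close>

definition shell_moment :: "(real^'n \<Rightarrow> real) \<Rightarrow> real" where
  "shell_moment w = (\<integral>x. indicator (K - cball 0 r) x * ((1 / norm x) ^ (CARD('n) + j) * w (sgn x)) \<partial>lborel)"

text \<open>For a unit vector \<open>v\<close>, the integral of \<open>l ^ - (j + 1)\<close> from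
  \<open>r\<close> to the boundary of \<open>K\<close> in direction \<open>v\<close>.\<close>

definition polar_profile :: "real^'n \<Rightarrow> real" where
  "polar_profile v = ((1 / r) ^ j - star_gauge K v ^ j) / real j"

text \<open>A stand-in for surface measure: only functions of \<open>sgn z\<close> are integrated,
  and the image under \<open>sgn\<close> is \<open>ln 2\<close> times surface measure on the unit
  sphere.\<close>

definition annulus_measure :: "(real^'n) measure" where
  "annulus_measure = density lborel (\<lambda>z. ennreal (indicator {1/2..1} (norm z) * (1 / norm z) ^ CARD('n)))"

lemma zero_in_interior: "0 \<in> interior K"
  using r by (intro subsetD[OF r(2)]) simp

lemma measurable_body [measurable]: "K \<in> sets borel"
  using K by (simp add: borel_compact)

lemma measurable_gauge [measurable]: "star_gauge K \<in> borel_measurable borel"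
  by (rule borel_measurable_continuous_onI[OF continuous_on_star_gauge[OF K zero_in_interior]])

lemma measurable_profile [measurable]: "polar_profile \<in> borel_measurable borel"
  unfolding polar_profile_def by measurable

lemma profile_bounds:
  assumes "norm v \<le> 1"
  shows "0 \<le> polar_profile v" "polar_profile v \<le> (1 / r) ^ j / real j"
proof -
  have "cball 0 r \<subseteq> K" using r(2) interior_subset by blast
  then have "star_gauge K v \<le> norm v / r"
    using star_gauge_le_norm[OF K zero_in_interior r(1)] by blast
  also have "\<dots> \<le> 1 / r" using assms r(1) by (simp add: divide_right_mono)
  finally have "star_gauge K v ^ j \<le> (1 / r) ^ j"
    using star_gauge_nonneg[OF K zero_in_interior] by (intro power_mono) auto
  then show "0 \<le> polar_profile v" by (simp add: polar_profile_def)
  show "polar_profile v \<le> (1 / r) ^ j / real j"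
    using star_gauge_nonneg[OF K zero_in_interior, of v] by (simp add: polar_profile_def divide_right_mono)
qed

lemma shell_integrable:
  assumes [measurable]: "w \<in> borel_measurable borel" and B: "\<And>v. norm v \<le> 1 \<Longrightarrow> \<bar>w v\<bar> \<le> B"
  shows "integrable lborel (\<lambda>x. indicator (K - cball 0 r) x * ((1 / norm x) ^ (CARD('n) + j) * w (sgn x)))"
proof (rule Bochner_Integration.integrable_bound)
  show "integrable lborel (\<lambda>x. indicator K x *\<^sub>R ((1 / r) ^ (CARD('n) + j) * B))"
    using borel_integrable_compact[OF K(1), of "\<lambda>_. (1 / r) ^ (CARD('n) + j) * B"] by simp
  show "AE x in lborel. norm (indicator (K - cball 0 r) x * ((1 / norm x) ^ (CARD('n) + j) * w (sgn x)))
    \<le> norm (indicator K x *\<^sub>R ((1 / r) ^ (CARD('n) + j) * B))"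
  proof (rule AE_I2)
    fix x :: "real^'n"
    have B0: "0 \<le> B" using B[of 0] by simp
    show "norm (indicator (K - cball 0 r) x * ((1 / norm x) ^ (CARD('n) + j) * w (sgn x)))
      \<le> norm (indicator K x *\<^sub>R ((1 / r) ^ (CARD('n) + j) * B))"
    proof (cases "x \<in> K - cball 0 r")
      case True
      then have x: "r < norm x" "x \<in> K" by auto
      have "(1 / norm x) ^ (CARD('n) + j) * \<bar>w (sgn x)\<bar> \<le> (1 / r) ^ (CARD('n) + j) * B"
        using x r(1) B0 B[of "sgn x"] by (intro mult_mono power_mono) (auto simp: norm_sgn frac_le)
      then show ?thesis using x r(1) B0 True by (simp add: abs_mult)
    qed simp
  qed
qed measurable

lemma finite_annulus_measure: "finite_measure annulus_measure"
proof
  have "emeasure annulus_measure (space annulus_measure)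
    = (\<integral>\<^sup>+z. ennreal (indicator {1/2..1} (norm z) * (1 / norm z) ^ CARD('n)) \<partial>(lborel :: (real^'n) measure))"
    unfolding annulus_measure_def by (subst emeasure_density) (auto simp: indicator_def)
  also have "\<dots> \<le> (\<integral>\<^sup>+z. ennreal (2 ^ CARD('n)) * indicator (cball 0 1) z \<partial>(lborel :: (real^'n) measure))"
  proof (rule nn_integral_mono, goal_cases)
    case (1 z)
    have "(1 / norm z) ^ CARD('n) \<le> 2 ^ CARD('n)" if "1/2 \<le> norm z"
    proof (rule power_mono)
      have "0 < norm z" using that by linarith
      then show "1 / norm z \<le> 2" using that by (simp add: divide_le_eq)
    qed simp
    then show ?case
      by (auto simp: indicator_def intro!: ennreal_leI)
  qed
  also have "\<dots> = ennreal (2 ^ CARD('n)) * emeasure lborel (cball (0::real^'n) 1)"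
    by (rule nn_integral_cmult_indicator) simp
  also have "\<dots> < \<infinity>"
    using emeasure_compact_finite[OF compact_cball, of "0::real^'n" 1] by (simp add: ennreal_mult_less_top)
  finally show "emeasure annulus_measure (space annulus_measure) \<noteq> \<infinity>" by simp
qed

text \<open>On the ray the powers of \<open>l\<close> combine to \<open>l ^ - (j + 1)\<close>, with
  antiderivative \<open>- l ^ - j / j\<close>, taken between the scales \<open>r / |z|\<close> and
  \<open>1 / star_gauge K z\<close>.\<close>

lemma ray_integral:
  fixes z :: "real^'n"
  assumes z: "0 < norm z"
  shows "(\<integral>\<^sup>+l. ennreal (indicator (K - cball 0 r) (l *\<^sub>R z) * (1 / norm (l *\<^sub>R z)) ^ (CARD('n) + j)) * ennreal (l ^ (CARD('n) - 1)) * indicator {0<..} l \<partial>lborel)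
    = ennreal ((1 / norm z) ^ CARD('n) * polar_profile (sgn z))"
proof -
  define a where "a = r / norm z"
  define b where "b = 1 / star_gauge K z"
  have z0: "z \<noteq> 0" using z by auto
  have a0: "0 < a" using r z by (simp add: a_def)
  have g0: "0 < star_gauge K z" using star_gauge_pos[OF K zero_in_interior z0] .
  have mem: "l *\<^sub>R z \<in> K \<longleftrightarrow> l \<le> b" if "0 < l" for l
    using star_gauge_le1[OF K zero_in_interior, of "l *\<^sub>R z"] star_gauge_scaleR[OF K zero_in_interior, of l z] that g0
    by (simp add: b_def field_simps)
  have "a *\<^sub>R z \<in> K"
  proof -
    have "a *\<^sub>R z \<in> cball 0 r" using z r(1) by (simp add: a_def)
    then show ?thesis using r(2) interior_subset by blast
  qed
  then have ab: "a \<le> b" using mem[OF a0] by simp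
  \<comment> \<open>The removed ball is closed, so the ray lacks its lower endpoint
    \<open>a\<close>; as a null set it may be restored.\<close>
  have "AE l::real in lborel. l \<noteq> a" by (rule AE_lborel_singleton)
  then have "(\<integral>\<^sup>+l. ennreal (indicator (K - cball 0 r) (l *\<^sub>R z) * (1 / norm (l *\<^sub>R z)) ^ (CARD('n) + j)) * ennreal (l ^ (CARD('n) - 1)) * indicator {0<..} l \<partial>lborel)
    = (\<integral>\<^sup>+l. ennreal ((1 / norm z) ^ (CARD('n) + j)) * (ennreal ((1 / l) ^ (j + 1)) * indicator {a..b} l) \<partial>lborel)"
  proof (intro nn_integral_cong_AE, eventually_elim)
    case la: (elim l)
    show ?case
    proof (cases "0 < l")
      case True
      have "l *\<^sub>R z \<in> K - cball 0 r \<longleftrightarrow> l \<in> {a..b}"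
        using mem[OF True] la True z by (auto simp: a_def field_simps)
      moreover have "(1 / norm (l *\<^sub>R z)) ^ (CARD('n) + j) * l ^ (CARD('n) - 1) = (1 / norm z) ^ (CARD('n) + j) * (1 / l) ^ (j + 1)"
      proof -
        have "CARD('n) + j = (CARD('n) - 1) + (j + 1)" by simp
        then have "(1 / l) ^ (CARD('n) + j) * l ^ (CARD('n) - 1) = (1 / l) ^ (j + 1) * ((1 / l) ^ (CARD('n) - 1) * l ^ (CARD('n) - 1))"
          by (simp only: power_add mult_ac)
        also have "(1 / l) ^ (CARD('n) - 1) * l ^ (CARD('n) - 1) = 1"
          using True by (simp add: power_mult_distrib[symmetric])
        finally have "(1 / l) ^ (CARD('n) + j) * l ^ (CARD('n) - 1) = (1 / l) ^ (j + 1)" by simp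
        moreover have "1 / norm (l *\<^sub>R z) = (1 / norm z) * (1 / l)" using True by simp
        ultimately show ?thesis by (simp only: power_mult_distrib mult.assoc)
      qed
      ultimately show ?thesis
        using True by (simp add: ennreal_mult[symmetric] indicator_def del: norm_scaleR)
    next
      case False
      then show ?thesis using a0 by (auto simp: indicator_def)
    qed
  qed
  also have "\<dots> = ennreal ((1 / norm z) ^ (CARD('n) + j)) * (\<integral>\<^sup>+l. ennreal ((1 / l) ^ (j + 1)) * indicator {a..b} l \<partial>lborel)"
    by (rule nn_integral_cmult) measurable
  also have "(\<integral>\<^sup>+l. ennreal ((1 / l) ^ (j + 1)) * indicator {a..b} l \<partial>lborel)
    = ennreal (- ((1 / b) ^ j / real j) - - ((1 / a) ^ j / real j))"
  proof (rule nn_integral_FTC_Icc)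
    fix l assume "l \<in> {a..b}"
    then have l: "0 < l" using a0 by auto
    have "((\<lambda>l. inverse l ^ j) has_real_derivative real j * (inverse l ^ (j - 1) * - (inverse l ^ Suc (Suc 0)))) (at l)"
      using DERIV_power[OF DERIV_inverse[of l UNIV], of j] l by (simp add: mult_ac)
    then have "((\<lambda>l. - (inverse l ^ j / real j)) has_real_derivative - (real j * (inverse l ^ (j - 1) * - (inverse l ^ Suc (Suc 0))) / real j)) (at l)"
      by (intro DERIV_minus DERIV_cdivide)
    also have "- (real j * (inverse l ^ (j - 1) * - (inverse l ^ Suc (Suc 0))) / real j) = (1 / l) ^ (j + 1)"
      using j by (cases j) (simp_all add: divide_inverse)
    finally show "((\<lambda>l. - ((1 / l) ^ j / real j)) has_real_derivative (1 / l) ^ (j + 1)) (at l)"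
      by (simp only: inverse_eq_divide)
    show "0 \<le> (1 / l) ^ (j + 1)" using l by simp
  qed (use ab in simp_all)
  also have "- ((1 / b) ^ j / real j) - - ((1 / a) ^ j / real j) = norm z ^ j * polar_profile (sgn z)"
  proof -
    have "star_gauge K z = norm z * star_gauge K (sgn z)"
      using star_gauge_scaleR[OF K zero_in_interior, of "norm z" "sgn z"] z0 by (simp add: sgn_div_norm)
    then have "1 / b = norm z * star_gauge K (sgn z)" "1 / a = norm z * (1 / r)"
      by (simp_all add: b_def a_def)
    then show ?thesis by (simp only: polar_profile_def power_mult_distrib) (simp add: diff_divide_distrib right_diff_distrib)
  qed
  also have "ennreal ((1 / norm z) ^ (CARD('n) + j)) * ennreal (norm z ^ j * polar_profile (sgn z))
    = ennreal ((1 / norm z) ^ CARD('n) * polar_profile (sgn z))"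
  proof -
    have "(1 / norm z) ^ (CARD('n) + j) * (norm z ^ j * polar_profile (sgn z))
      = (1 / norm z) ^ CARD('n) * ((1 / norm z) ^ j * norm z ^ j) * polar_profile (sgn z)"
      by (simp only: power_add mult_ac)
    also have "(1 / norm z) ^ j * norm z ^ j = 1" using z by (simp add: power_mult_distrib[symmetric])
    finally show ?thesis
      using profile_bounds(1)[of "sgn z"] z by (simp add: ennreal_mult[symmetric] norm_sgn)
  qed
  finally show ?thesis .
qed

lemma shell_moment_polar:
  assumes [measurable]: "w \<in> borel_measurable borel" and w: "\<And>v. 0 \<le> w v"
  shows "ln 2 * shell_moment w = (\<integral>z. w (sgn z) * polar_profile (sgn z) \<partial>annulus_measure)"
proof -
  let ?A = "\<lambda>z. w (sgn z) * polar_profile (sgn z)"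
  let ?G = "\<lambda>z l. indicator (K - cball 0 r) (l *\<^sub>R z) * (1 / norm (l *\<^sub>R z)) ^ (CARD('n) + j)"
  define F where "F x = ennreal (indicator (K - cball 0 r) x * ((1 / norm x) ^ (CARD('n) + j) * w (sgn x)))" for x
  have [measurable]: "F \<in> borel_measurable borel" unfolding F_def by measurable
  have "ennreal (ln 2) * (\<integral>\<^sup>+x. F x \<partial>lborel)
    = (\<integral>\<^sup>+z. indicator {1/2..1} (norm z) * (\<integral>\<^sup>+l. F (l *\<^sub>R z) * ennreal (l ^ (CARD('n) - 1)) * indicator {0<..} l \<partial>lborel) \<partial>lborel)"
    using nn_integral_annulus[OF homogeneous_lborel[where 'a = "real^'n"], of F] by simp
  also have "\<dots> = (\<integral>\<^sup>+z. ennreal (indicator {1/2..1} (norm z) * (1 / norm z) ^ CARD('n)) * ennreal (?A z) \<partial>lborel)"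
  proof (rule nn_integral_cong, goal_cases)
    case (1 z)
    show ?case
    proof (cases "0 < norm z")
      case True
      have "(\<integral>\<^sup>+l. F (l *\<^sub>R z) * ennreal (l ^ (CARD('n) - 1)) * indicator {0<..} l \<partial>lborel)
        = (\<integral>\<^sup>+l. ennreal (w (sgn z)) * (ennreal (?G z l) * ennreal (l ^ (CARD('n) - 1)) * indicator {0<..} l) \<partial>lborel)"
      proof (rule nn_integral_cong, goal_cases)
        case (1 l)
        show ?case
        proof (cases "0 < l")
          case True
          then have "F (l *\<^sub>R z) = ennreal (w (sgn z)) * ennreal (?G z l)"
            unfolding F_def using w by (subst ennreal_mult[symmetric]) (simp_all add: sgn_scaleR mult_ac del: norm_scaleR)
          then show ?thesis by (simp only: mult.assoc)
        qed simp
      qed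
      also have "\<dots> = ennreal (w (sgn z)) * (\<integral>\<^sup>+l. ennreal (?G z l) * ennreal (l ^ (CARD('n) - 1)) * indicator {0<..} l \<partial>lborel)"
        by (rule nn_integral_cmult) measurable
      also have "\<dots> = ennreal (w (sgn z)) * ennreal ((1 / norm z) ^ CARD('n) * polar_profile (sgn z))"
        by (simp only: ray_integral[OF True])
      also have "\<dots> = ennreal ((1 / norm z) ^ CARD('n)) * ennreal (?A z)"
        using w profile_bounds(1)[of "sgn z"] True by (simp add: ennreal_mult[symmetric] norm_sgn mult_ac)
      finally show ?thesis by (simp add: indicator_def)
    qed simp
  qed
  also have "\<dots> = (\<integral>\<^sup>+z. ennreal (?A z) \<partial>annulus_measure)"
    unfolding annulus_measure_def by (subst nn_integral_density) auto
  finally have "enn2real (ennreal (ln 2) * (\<integral>\<^sup>+x. F x \<partial>lborel)) = enn2real (\<integral>\<^sup>+z. ennreal (?A z) \<partial>annulus_measure)"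
    by simp
  moreover have "shell_moment w = enn2real (\<integral>\<^sup>+x. F x \<partial>lborel)"
    unfolding shell_moment_def F_def using w by (intro integral_eq_nn_integral) auto
  moreover have "(\<integral>z. w (sgn z) * polar_profile (sgn z) \<partial>annulus_measure) = enn2real (\<integral>\<^sup>+z. ennreal (?A z) \<partial>annulus_measure)"
    using w profile_bounds(1) by (intro integral_eq_nn_integral) (auto simp: annulus_measure_def norm_sgn)
  ultimately show ?thesis by (simp add: enn2real_mult)
qed

definition cap_mass :: "real^'n \<Rightarrow> nat \<Rightarrow> real" where
  "cap_mass y e = (\<integral>z. max 0 (sgn z \<bullet> y) ^ e \<partial>annulus_measure)"

text \<open>By rotation invariance one normalizing constant serves all directions, hence all points
  of a line.\<close>

lemma cap_mass_eq:
  assumes "norm y = 1" "norm y' = 1"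
  shows "cap_mass y e = cap_mass y' e"
proof -
  obtain T where T: "orthogonal_transformation T" "T y = y'"
    using orthogonal_transformation_exists[of y y'] assms by metis
  have [measurable]: "T \<in> borel_measurable borel"
    by (rule borel_measurable_linear[OF orthogonal_transformation_linear[OF T(1)]])
  have sgnT: "sgn (T z) = T (sgn z)" for z
    using T(1) by (simp add: sgn_div_norm orthogonal_transformation_norm orthogonal_transformation_scaleR)
  define d :: "real^'n \<Rightarrow> real" where "d z = indicator {1/2..1} (norm z) * (1 / norm z) ^ CARD('n)" for z
  have [measurable]: "d \<in> borel_measurable borel" unfolding d_def by measurable
  have d0: "0 \<le> d z" for z by (simp add: d_def indicator_def)
  have cm: "cap_mass v e = (\<integral>z. d z * max 0 (sgn z \<bullet> v) ^ e \<partial>lborel)" for v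
    unfolding cap_mass_def annulus_measure_def d_def[symmetric] using d0
    by (subst integral_density) auto
  have "cap_mass y' e = (\<integral>z. d z * max 0 (sgn z \<bullet> y') ^ e \<partial>distr lborel borel T)"
    by (simp add: cm distr_lborel_orthogonal[OF T(1)])
  also have "\<dots> = (\<integral>z. d (T z) * max 0 (sgn (T z) \<bullet> y') ^ e \<partial>lborel)"
    by (rule integral_distr) measurable
  also have "\<dots> = (\<integral>z. d z * max 0 (sgn z \<bullet> y) ^ e \<partial>lborel)"
  proof (rule Bochner_Integration.integral_cong[OF refl], goal_cases)
    case (1 z)
    have "sgn (T z) \<bullet> y' = sgn z \<bullet> y"
      unfolding sgnT T(2)[symmetric] using T(1) by (simp add: orthogonal_transformation_def)
    moreover have "d (T z) = d z" using T(1) by (simp add: d_def orthogonal_transformation_norm)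
    ultimately show ?case by simp
  qed
  finally show ?thesis by (simp add: cm)
qed

text \<open>On the sphere \<open>max 0 (v \<bullet> y)\<close> attains its maximum 1 at
  \<open>y\<close> alone; the truncation removes the antipode, where
  \<open>(v \<bullet> y) ^ e\<close> has the same absolute value.\<close>

lemma cap_limit:
  fixes y :: "real^'n"
  assumes y: "norm y = 1"
  shows "(\<lambda>e. ln 2 * shell_moment (\<lambda>v. max 0 (v \<bullet> y) ^ e) / cap_mass y e) \<longlonglongrightarrow> polar_profile y"
    and "0 < cap_mass y e"
proof -
  define B where "B = (1 / r) ^ j / real j"
  have pb: "\<bar>polar_profile v\<bar> \<le> B" if "norm v \<le> 1" for v
    using profile_bounds[OF that] by (simp add: B_def)
  have sgn1: "norm (sgn z) \<le> 1" for z :: "real^'n" by (simp add: norm_sgn)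
  have sets_an[measurable_cong]: "sets annulus_measure = sets borel" by (simp add: annulus_measure_def)
  have sp: "space annulus_measure = UNIV" by (simp add: annulus_measure_def)
  interpret finite_measure annulus_measure by (rule finite_annulus_measure)
  have near: "\<exists>\<delta>>0. \<delta> < 1 \<and> (\<forall>z. 1 - \<delta> < max 0 (sgn z \<bullet> y) \<longrightarrow> \<bar>polar_profile (sgn z) - polar_profile y\<bar> \<le> \<epsilon>)"
    if \<epsilon>: "0 < \<epsilon>" for \<epsilon>
  proof -
    have "continuous_on UNIV polar_profile"
      unfolding polar_profile_def using j
      by (intro continuous_intros continuous_on_star_gauge[OF K zero_in_interior]) auto
    then obtain \<eta> where \<eta>: "0 < \<eta>" "\<And>v. dist v y < \<eta> \<Longrightarrow> dist (polar_profile v) (polar_profile y) < \<epsilon>"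
      using \<epsilon> unfolding continuous_on_iff by (metis UNIV_I)
    \<comment> \<open>For unit vectors \<open>|v - y|^2 = 2 - 2 (v \<bullet> y)\<close>, so
      \<open>v \<bullet> y > 1 - \<eta>^2 / 2\<close> puts \<open>v\<close> within
      \<open>\<eta>\<close> of \<open>y\<close>.\<close>
    define \<delta> where "\<delta> = min (1/2) (\<eta>\<^sup>2 / 2)"
    have \<delta>: "0 < \<delta>" "\<delta> < 1" "\<delta> \<le> \<eta>\<^sup>2 / 2" using \<eta>(1) by (auto simp: \<delta>_def)
    have "\<bar>polar_profile (sgn z) - polar_profile y\<bar> \<le> \<epsilon>" if z: "1 - \<delta> < max 0 (sgn z \<bullet> y)" for z
    proof -
      have zy: "1 - \<delta> < sgn z \<bullet> y" using z \<delta> by (auto simp: max_def split: if_splits)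
      then have "z \<noteq> 0" using \<delta> by auto
      then have sz: "sgn z \<bullet> sgn z = 1" by (simp add: norm_eq_1[symmetric] norm_sgn)
      have "(dist (sgn z) y)\<^sup>2 = 2 - 2 * (sgn z \<bullet> y)"
        using y sz unfolding dist_norm power2_norm_eq_inner
        by (simp add: inner_diff_left inner_diff_right norm_eq_1 inner_commute[of y "sgn z"])
      also have "\<dots> < \<eta>\<^sup>2" using zy \<delta>(3) by linarith
      finally have "dist (sgn z) y < \<eta>" using \<eta>(1) by (simp add: power2_less_imp_less)
      then show ?thesis using \<eta>(2)[of "sgn z"] by (simp add: dist_real_def)
    qed
    then show ?thesis using \<delta> by blast
  qed
  have mass: "0 < measure annulus_measure {z \<in> space annulus_measure. 1 - \<delta> < max 0 (sgn z \<bullet> y)}"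
    if \<delta>: "0 < \<delta>" "\<delta> < 1" for \<delta>
  proof -
    \<comment> \<open>An open part of the region inside the annulus, containing
      \<open>(3/4) y\<close>; the density is at least 1 there.\<close>
    define U where "U = {z. 1/2 < norm z} \<inter> {z. norm z < 1} \<inter> {z. (1 - \<delta>) * norm z < z \<bullet> y}"
    have "open U" unfolding U_def by (intro open_Int open_Collect_less continuous_intros)
    moreover have "y \<bullet> y = 1" using y by (simp add: norm_eq_1)
    then have "(3/4) *\<^sub>R y \<in> U" using y \<delta> by (simp add: U_def)
    ultimately obtain \<rho> where \<rho>: "0 < \<rho>" "ball ((3/4) *\<^sub>R y) \<rho> \<subseteq> U" by (auto simp: open_contains_ball)
    have [measurable]: "U \<in> sets borel" using \<open>open U\<close> by simp
    have "0 < emeasure lborel (ball ((3/4) *\<^sub>R y) \<rho>)"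
      using content_ball_pos[OF \<rho>(1), of "(3/4) *\<^sub>R y"] by (auto simp: measure_def enn2real_positive_iff)
    also have "\<dots> \<le> emeasure lborel U" by (rule emeasure_mono[OF \<rho>(2)]) simp
    also have "\<dots> = (\<integral>\<^sup>+z. indicator U z \<partial>lborel)" by simp
    also have "\<dots> \<le> (\<integral>\<^sup>+z. ennreal (indicator {1/2..1} (norm z) * (1 / norm z) ^ CARD('n)) * indicator {z. 1 - \<delta> < max 0 (sgn z \<bullet> y)} z \<partial>lborel)"
    proof (rule nn_integral_mono, goal_cases)
      case (1 z)
      show ?case
      proof (cases "z \<in> U")
        case True
        then have z: "1/2 < norm z" "norm z < 1" "(1 - \<delta>) * norm z < z \<bullet> y" by (auto simp: U_def)
        have nz: "0 < norm z" using z(1) by linarith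
        have "1 - \<delta> < sgn z \<bullet> y" using z(3) nz by (simp add: sgn_div_norm divide_inverse_commute[symmetric] pos_less_divide_eq)
        moreover have "1 \<le> (1 / norm z) ^ CARD('n)" using z nz by (intro one_le_power) simp
        ultimately show ?thesis using z True by (auto simp: indicator_def)
      qed simp
    qed
    also have "\<dots> = emeasure annulus_measure {z \<in> space annulus_measure. 1 - \<delta> < max 0 (sgn z \<bullet> y)}"
      unfolding sp by (simp add: annulus_measure_def emeasure_density)
    finally show ?thesis using emeasure_finite by (simp add: measure_def enn2real_positive_iff less_top[symmetric])
  qed
  have w01: "0 \<le> max 0 (sgn z \<bullet> y)" "max 0 (sgn z \<bullet> y) \<le> 1" for z
  proof -
    have "sgn z \<bullet> y \<le> norm (sgn z) * norm y" by (rule norm_cauchy_schwarz)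
    also have "\<dots> \<le> 1" using y sgn1[of z] by simp
    finally show "max 0 (sgn z \<bullet> y) \<le> 1" by simp
  qed simp
  have "(\<lambda>e. (\<integral>z. max 0 (sgn z \<bullet> y) ^ e * polar_profile (sgn z) \<partial>annulus_measure) / (\<integral>z. max 0 (sgn z \<bullet> y) ^ e \<partial>annulus_measure)) \<longlonglongrightarrow> polar_profile y"
    by (rule concentration_at_maximum(1)[OF finite_annulus_measure _ _ w01, where B = B])
       (use near mass pb sgn1 y in auto)
  moreover have "ln 2 * shell_moment (\<lambda>v. max 0 (v \<bullet> y) ^ e) = (\<integral>z. max 0 (sgn z \<bullet> y) ^ e * polar_profile (sgn z) \<partial>annulus_measure)" for e
    by (rule shell_moment_polar) simp_all
  ultimately show "(\<lambda>e. ln 2 * shell_moment (\<lambda>v. max 0 (v \<bullet> y) ^ e) / cap_mass y e) \<longlonglongrightarrow> polar_profile y"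
    by (simp add: cap_mass_def)
  show "0 < cap_mass y e"
    unfolding cap_mass_def
    by (rule concentration_at_maximum(2)[OF finite_annulus_measure _ _ w01, where B = B and H = "\<lambda>z. polar_profile (sgn z)" and ?H0.0 = "polar_profile y"])
       (use near mass pb sgn1 y in auto)
qed

section \<open>Ridge moments and their limit along a line\<close>

definition ridge_moment :: "nat \<Rightarrow> real^'n \<Rightarrow> real" where
  "ridge_moment i y = shell_moment (\<lambda>v. (v \<bullet> y) ^ i)"

lemma ridge_moment_scaleR: "ridge_moment i (c *\<^sub>R y) = c ^ i * ridge_moment i y"
proof -
  have "ridge_moment i (c *\<^sub>R y) = (\<integral>x. c ^ i * (indicator (K - cball 0 r) x * ((1 / norm x) ^ (CARD('n) + j) * (sgn x \<bullet> y) ^ i)) \<partial>lborel)"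
    unfolding ridge_moment_def shell_moment_def
    by (intro Bochner_Integration.integral_cong refl) (simp add: power_mult_distrib)
  then show ?thesis by (simp only: integral_mult_right_zero ridge_moment_def shell_moment_def)
qed

lemma ridge_moment_minus: "ridge_moment i (- y) = (- 1) ^ i * ridge_moment i y"
  using ridge_moment_scaleR[of i "- 1" y] by simp

text \<open>The moment feels both poles, and each half concentrates at one of them: the source of
  the two terms in the power sum. For \<open>e = 0\<close> the constant 1 would be counted
  twice.\<close>

lemma ridge_moment_split:
  assumes e: "0 < e"
  shows "ridge_moment e y = shell_moment (\<lambda>v. max 0 (v \<bullet> y) ^ e) + (- 1) ^ e * shell_moment (\<lambda>v. max 0 (v \<bullet> - y) ^ e)"
proof -
  have split: "u ^ e = max 0 u ^ e + (- 1) ^ e * max 0 (- u) ^ e" for u :: real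
  proof (cases "0 \<le> u")
    case True
    then show ?thesis using e by (simp add: max_def)
  next
    case False
    have "(- 1) ^ e * (- u) ^ e = u ^ e" by (simp add: power_mult_distrib[symmetric])
    then show ?thesis using e False by (simp add: max_def)
  qed
  have int: "integrable lborel (\<lambda>x. indicator (K - cball 0 r) x * ((1 / norm x) ^ (CARD('n) + j) * max 0 (sgn x \<bullet> z) ^ e))" for z :: "real^'n"
  proof (rule shell_integrable[where B = "norm z ^ e" and w = "\<lambda>v. max 0 (v \<bullet> z) ^ e"])
    fix v :: "real^'n" assume v: "norm v \<le> 1"
    have "\<bar>max 0 (v \<bullet> z) ^ e\<bar> \<le> \<bar>(v \<bullet> z) ^ e\<bar>" unfolding power_abs by (intro power_mono) auto
    then show "\<bar>max 0 (v \<bullet> z) ^ e\<bar> \<le> norm z ^ e" using inner_power_bound[OF v, of z e] by linarith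
  qed measurable
  have "ridge_moment e y = (\<integral>x. indicator (K - cball 0 r) x * ((1 / norm x) ^ (CARD('n) + j) * max 0 (sgn x \<bullet> y) ^ e)
      + (- 1) ^ e * (indicator (K - cball 0 r) x * ((1 / norm x) ^ (CARD('n) + j) * max 0 (sgn x \<bullet> - y) ^ e)) \<partial>lborel)"
    unfolding ridge_moment_def shell_moment_def
  proof (intro Bochner_Integration.integral_cong refl, goal_cases)
    case (1 x)
    have "(sgn x \<bullet> y) ^ e = max 0 (sgn x \<bullet> y) ^ e + (- 1) ^ e * max 0 (sgn x \<bullet> - y) ^ e"
      using split[of "sgn x \<bullet> y"] by simp
    then show ?case
      by (simp only: distrib_left mult_ac)
  qed
  also have "\<dots> = shell_moment (\<lambda>v. max 0 (v \<bullet> y) ^ e) + (- 1) ^ e * shell_moment (\<lambda>v. max 0 (v \<bullet> - y) ^ e)"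
    unfolding shell_moment_def by (subst Bochner_Integration.integral_add[OF int integrable_mult_right[OF int]]) (simp only: integral_mult_right_zero)
  finally show ?thesis .
qed

lemma poly_fun_ridge_moment: "poly_fun i (\<lambda>s. ridge_moment i (p + s *\<^sub>R v))"
proof -
  define w where "w l u = (u \<bullet> v) ^ l * (u \<bullet> p) ^ (i - l)" for l and u :: "real^'n"
  have [measurable]: "w l \<in> borel_measurable borel" for l unfolding w_def[abs_def] by measurable
  have int: "integrable lborel (\<lambda>x. indicator (K - cball 0 r) x * ((1 / norm x) ^ (CARD('n) + j) * w l (sgn x)))" for l
  proof (rule shell_integrable[where B = "norm v ^ l * norm p ^ (i - l)"])
    fix u :: "real^'n" assume u: "norm u \<le> 1"
    show "\<bar>w l u\<bar> \<le> norm v ^ l * norm p ^ (i - l)"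
      unfolding w_def abs_mult by (intro mult_mono inner_power_bound u) auto
  qed measurable
  have eq: "ridge_moment i (p + s *\<^sub>R v) = (\<Sum>l\<le>i. (real (i choose l) * shell_moment (w l)) * s ^ l)" for s
  proof -
    have "ridge_moment i (p + s *\<^sub>R v) = (\<integral>x. (\<Sum>l\<le>i. (real (i choose l) * s ^ l) * (indicator (K - cball 0 r) x * ((1 / norm x) ^ (CARD('n) + j) * w l (sgn x)))) \<partial>lborel)"
      unfolding ridge_moment_def shell_moment_def
    proof (intro Bochner_Integration.integral_cong refl, goal_cases)
      case (1 x)
      have "(sgn x \<bullet> (p + s *\<^sub>R v)) ^ i = (s * (sgn x \<bullet> v) + sgn x \<bullet> p) ^ i"
        by (simp add: inner_add_right add.commute)
      also have "\<dots> = (\<Sum>l\<le>i. real (i choose l) * (s * (sgn x \<bullet> v)) ^ l * (sgn x \<bullet> p) ^ (i - l))"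
        by (rule binomial_ring)
      finally have ex: "(sgn x \<bullet> (p + s *\<^sub>R v)) ^ i = (\<Sum>l\<le>i. real (i choose l) * (s * (sgn x \<bullet> v)) ^ l * (sgn x \<bullet> p) ^ (i - l))" .
      show ?case
        unfolding ex w_def sum_distrib_left by (intro sum.cong refl) (simp only: power_mult_distrib mult_ac)
    qed
    also have "\<dots> = (\<Sum>l\<le>i. (real (i choose l) * s ^ l) * shell_moment (w l))"
      unfolding shell_moment_def using int by (subst Bochner_Integration.integral_sum) auto
    finally show ?thesis by (simp only: mult_ac)
  qed
  have "poly_fun i (\<lambda>s. \<Sum>l\<le>i. (real (i choose l) * shell_moment (w l)) * s ^ l)"
  proof (rule poly_fun_sum)
    fix l assume "l \<in> {..i}"
    then show "poly_fun i (\<lambda>s. (real (i choose l) * shell_moment (w l)) * s ^ l)"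
      by (intro poly_funI[of "monom (real (i choose l) * shell_moment (w l)) l"])
         (auto simp: poly_monom intro: order_trans[OF degree_monom_le])
  qed
  then show ?thesis by (simp only: eq)
qed

text \<open>The moments of degree \<open>j + 2 i\<close>, normalized and extended with homogeneity
  \<open>j\<close>, are polynomials of degree at most \<open>j\<close> on each line, hence so is
  their limit. It still contains the constant part of \<open>polar_profile\<close>, which is
  subtracted at the end.\<close>

lemma power_sums_poly_fun:
  assumes span: "\<And>e. even (e + j) \<Longrightarrow> \<exists>d::nat \<Rightarrow> real. \<forall>y. norm y = 1 \<longrightarrow> ridge_moment e y = (\<Sum>i | i \<le> j \<and> even (i + j). d i * ridge_moment i y)"
  shows "poly_fun j (\<lambda>s. star_gauge K (p + s *\<^sub>R v) ^ j + (- star_gauge K (- (p + s *\<^sub>R v))) ^ j)"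
proof -
  obtain d :: "nat \<Rightarrow> nat \<Rightarrow> real" where d: "\<And>e y. even (e + j) \<Longrightarrow> norm y = 1 \<Longrightarrow>
      ridge_moment e y = (\<Sum>i | i \<le> j \<and> even (i + j). d e i * ridge_moment i y)"
    using span by metis
  \<comment> \<open>A reference direction: the normalization must not vary with the point of the
    line.\<close>
  define y0 :: "real^'n" where "y0 = axis undefined 1"
  have y0: "norm y0 = 1" by (simp add: y0_def)
  have sq: "poly_fun 2 (\<lambda>s. (norm (p + s *\<^sub>R v))\<^sup>2)"
  proof (rule poly_funI[of "[:p \<bullet> p, 2 * (p \<bullet> v), v \<bullet> v:]"])
    show "(norm (p + s *\<^sub>R v))\<^sup>2 = poly [:p \<bullet> p, 2 * (p \<bullet> v), v \<bullet> v:] s" for s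
      unfolding power2_norm_eq_inner
      by (simp add: inner_add_left inner_add_right inner_commute[of v p] algebra_simps)
  qed simp
  have npow: "poly_fun q (\<lambda>s. norm (p + s *\<^sub>R v) ^ q)" if "even q" for q
    using poly_fun_power[OF sq, of "q div 2"] that by (simp add: power_mult[symmetric])
  \<comment> \<open>The relations hold on unit vectors only. The factor \<open>|x| ^ (j - h)\<close>
    makes every term homogeneous of degree \<open>j\<close>, and since \<open>j - h\<close> is even
    it is polynomial on lines.\<close>
  define F where "F i x = (\<Sum>h | h \<le> j \<and> even (h + j). (ln 2 / cap_mass y0 (j + 2 * i) * d (j + 2 * i) h) * (norm x ^ (j - h) * ridge_moment h x))"
    for i and x :: "real^'n"
  define G where "G x = norm x ^ j * (polar_profile (sgn x) + (- 1) ^ j * polar_profile (- sgn x))" for x :: "real^'n"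
  have Fpoly: "poly_fun j (\<lambda>s. F i (p + s *\<^sub>R v))" for i
    unfolding F_def
  proof (rule poly_fun_sum, rule poly_fun_cmult)
    fix h assume "h \<in> {h. h \<le> j \<and> even (h + j)}"
    then have h: "h \<le> j" "even (j - h)" by auto
    have "poly_fun ((j - h) + h) (\<lambda>s. norm (p + s *\<^sub>R v) ^ (j - h) * ridge_moment h (p + s *\<^sub>R v))"
      by (intro poly_fun_mult npow poly_fun_ridge_moment h)
    then show "poly_fun j (\<lambda>s. norm (p + s *\<^sub>R v) ^ (j - h) * ridge_moment h (p + s *\<^sub>R v))" using h by simp
  qed
  have Flim: "(\<lambda>i. F i x) \<longlonglongrightarrow> G x" for x
  proof (cases "x = 0")
    case True
    have "ridge_moment j 0 = 0" using ridge_moment_scaleR[of j 0 0] j by (simp add: power_0_left)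
    then have "norm x ^ (j - h) * ridge_moment h x = 0" if "h \<le> j" for h
      using that True by (cases "h = j") auto
    then have "F i x = 0" for i unfolding F_def by (intro sum.neutral) auto
    moreover have "G x = 0" using True j by (simp add: G_def)
    ultimately show ?thesis by simp
  next
    case False
    define y where "y = sgn x"
    have y: "norm y = 1" "norm (- y) = 1" using False by (simp_all add: y_def norm_sgn)
    have x: "x = norm x *\<^sub>R y" using False by (simp add: y_def sgn_div_norm)
    define S where "S y e = ln 2 * shell_moment (\<lambda>v. max 0 (v \<bullet> y) ^ e) / cap_mass y e" for y e
    have FS: "F i x = norm x ^ j * (S y (j + 2 * i) + (- 1) ^ j * S (- y) (j + 2 * i))" for i
    proof -
      let ?e = "j + 2 * i"
      have hom: "norm x ^ (j - h) * ridge_moment h x = norm x ^ j * ridge_moment h y" if "h \<le> j" for h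
      proof -
        have "norm x ^ (j - h) * ridge_moment h x = norm x ^ (j - h) * (norm x ^ h * ridge_moment h y)"
          by (subst (2) x) (simp only: ridge_moment_scaleR)
        also have "\<dots> = norm x ^ j * ridge_moment h y"
          using that by (simp add: mult.assoc[symmetric] power_add[symmetric])
        finally show ?thesis .
      qed
      have "F i x = (\<Sum>h | h \<le> j \<and> even (h + j). (norm x ^ j * (ln 2 / cap_mass y0 ?e)) * (d ?e h * ridge_moment h y))"
        unfolding F_def by (intro sum.cong refl) (simp add: hom)
      also have "\<dots> = (norm x ^ j * (ln 2 / cap_mass y0 ?e)) * ridge_moment ?e y"
        using d[OF _ y(1), of ?e] by (simp add: sum_distrib_left)
      also have "ridge_moment ?e y = shell_moment (\<lambda>v. max 0 (v \<bullet> y) ^ ?e) + (- 1) ^ ?e * shell_moment (\<lambda>v. max 0 (v \<bullet> - y) ^ ?e)"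
        using j by (intro ridge_moment_split) simp
      also have "(- 1 :: real) ^ ?e = (- 1) ^ j" by (simp add: power_add power_mult)
      finally show ?thesis
        unfolding S_def cap_mass_eq[OF y(1) y0] cap_mass_eq[OF y(2) y0]
        by (simp only: distrib_left times_divide_eq_left times_divide_eq_right mult_ac)
    qed
    have sub: "(\<lambda>i. S z (j + 2 * i)) \<longlonglongrightarrow> polar_profile z" if "norm z = 1" for z
    proof -
      have "strict_mono (\<lambda>i::nat. j + 2 * i)" by (simp add: strict_mono_def)
      from LIMSEQ_subseq_LIMSEQ[OF cap_limit(1)[OF that] this] show ?thesis by (simp add: S_def o_def)
    qed
    show ?thesis
      unfolding FS G_def y_def[symmetric] by (intro tendsto_intros sub y)
  qed
  have "poly_fun j (\<lambda>s. G (p + s *\<^sub>R v))"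
    by (rule poly_fun_limit[where F = "\<lambda>i s. F i (p + s *\<^sub>R v)", OF Fpoly Flim])
  then have "poly_fun j (\<lambda>s. (- real j) * G (p + s *\<^sub>R v))" by (rule poly_fun_cmult)
  \<comment> \<open>The contribution of the removed ball: it cancels between the poles for odd
    \<open>j\<close> and is a power of \<open>|x|^2\<close> for even \<open>j\<close>.\<close>
  moreover have "poly_fun j (\<lambda>s. ((1 / r) ^ j * (1 + (- 1) ^ j)) * norm (p + s *\<^sub>R v) ^ j)"
  proof (cases "even j")
    case True
    then show ?thesis by (intro poly_fun_cmult npow)
  next
    case False
    then show ?thesis using poly_fun_const[of j 0] by simp
  qed
  ultimately have "poly_fun j (\<lambda>s. ((1 / r) ^ j * (1 + (- 1) ^ j)) * norm (p + s *\<^sub>R v) ^ j + (- real j) * G (p + s *\<^sub>R v))"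
    by (intro poly_fun_add)
  moreover have "((1 / r) ^ j * (1 + (- 1) ^ j)) * norm x ^ j + (- real j) * G x = star_gauge K x ^ j + (- star_gauge K (- x)) ^ j" for x
  proof (cases "x = 0")
    case True
    then show ?thesis using j by (simp add: G_def star_gauge_def zero_power)
  next
    case False
    have g: "star_gauge K z = norm z * star_gauge K (sgn z)" for z
      using star_gauge_scaleR[OF K zero_in_interior, of "norm z" "sgn z"]
      by (cases "z = 0") (simp_all add: sgn_div_norm star_gauge_def)
    have g1: "star_gauge K x ^ j = norm x ^ j * star_gauge K (sgn x) ^ j"
      by (subst g) (simp only: power_mult_distrib)
    have g2: "(- star_gauge K (- x)) ^ j = (- 1) ^ j * (norm x ^ j * star_gauge K (- sgn x) ^ j)"
    proof -
      have "- star_gauge K (- x) = (- 1) * (norm x * star_gauge K (- sgn x))"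
        by (subst g) (simp add: sgn_minus)
      then show ?thesis by (simp only: power_mult_distrib)
    qed
    have jG: "real j * G x = norm x ^ j * (((1 / r) ^ j - star_gauge K (sgn x) ^ j) + (- 1) ^ j * ((1 / r) ^ j - star_gauge K (- sgn x) ^ j))"
      using j by (simp add: G_def polar_profile_def distrib_left)
    show ?thesis unfolding g1 g2 mult_minus_left jG by (simp add: algebra_simps)
  qed
  ultimately show ?thesis by simp
qed

end

theorem theorem2:
  fixes K :: "(real ^ 'n) set" and m :: nat
  assumes "even m" and "2 \<le> m" and "m \<le> CARD('n) - 1"
    and "convex_body K" and "0 \<in> interior K"
    and "has_polynomial_dual_section_fun K m"
  shows "ellipsoid K"
proof -
  have K: "compact K" "convex K" using assms(4) by (auto simp: convex_body_def)
  have n2: "2 \<le> CARD('n)" and m: "0 < m" using assms(2,3) by auto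
  define k where "k = CARD('n) - 1 - m"
  have km: "k + m = CARD('n) - 1" using assms(3) by (simp add: k_def)
  obtain r where r: "0 < r" "cball 0 r \<subseteq> interior K"
    using assms(5) open_contains_cball[of "interior K"] by auto
  obtain N a where a: "\<And>l. l \<le> N \<Longrightarrow> continuous_on (sphere 0 1) (a l)"
    and DS0: "\<And>\<xi> t. \<xi> \<in> sphere 0 1 \<Longrightarrow> t \<in> {- radial_fun K (- \<xi>)..radial_fun K \<xi>} \<Longrightarrow> dual_section_fun K m \<xi> t = (\<Sum>l\<le>N. a l \<xi> * t ^ l)"
    using assms(6) unfolding has_polynomial_dual_section_fun_def by blast
  have DS: "dual_section_fun K m \<xi> t = (\<Sum>l\<le>N. a l \<xi> * t ^ l)" if \<xi>: "norm \<xi> = 1" and t: "0 \<le> t" "t \<le> r" for \<xi> t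
  proof (rule DS0)
    have nz: "\<xi> \<noteq> 0" "- \<xi> \<noteq> 0" using \<xi> by auto
    have "t *\<^sub>R \<xi> \<in> K" using r(2) interior_subset \<xi> t by (intro subsetD[of "cball 0 r" K]) auto
    then have "t \<le> radial_fun K \<xi>" using radial_fun_Greatest(2)[OF K assms(5) nz(1) t(1)] by simp
    moreover have "0 < radial_fun K (- \<xi>)" by (rule radial_fun_Greatest(1)[OF K assms(5) nz(2)])
    ultimately show "t \<in> {- radial_fun K (- \<xi>)..radial_fun K \<xi>}" using t by auto
  qed (use \<xi> in simp)
  obtain Z where Z: "\<And>(\<omega> :: real^'n) y i a. norm \<omega> = 1 \<Longrightarrow> 0 \<le> a \<Longrightarrow>
          hyperplane_moment k \<omega> y i a = a ^ (m + i) * norm (y - (y \<bullet> \<omega>) *\<^sub>R \<omega>) ^ i * Z i"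
    and Zodd: "\<And>i. odd i \<Longrightarrow> Z i = 0" and Zeven: "\<And>i. even i \<Longrightarrow> 0 < Z i"
    using ex_moment_constants[OF km m n2] by metis
  \<comment> \<open>The index \<open>b = j + m\<close> used below has to exceed
    \<open>max N m\<close>; the added 1 also makes \<open>j\<close> positive.\<close>
  define J where "J = max N m - m + 1"
  have "ellipsoid {x. star_gauge K x \<le> 1}"
  proof (rule ellipsoid_of_gauge_power_sums[of "star_gauge K" J])
    show "0 < star_gauge K x" if "x \<noteq> 0" for x by (rule star_gauge_pos[OF K assms(5) that])
    show "star_gauge K (c *\<^sub>R x) = c * star_gauge K x" if "0 \<le> c" for c x by (rule star_gauge_scaleR[OF K assms(5) that])
    show "continuous_on UNIV (star_gauge K)" by (rule continuous_on_star_gauge[OF K assms(5)])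
    fix j p v assume J: "J \<le> j"
    then have j: "0 < j" and jN: "max N m < j + m" by (auto simp: J_def)
    interpret inscribed_ball_body K r j by standard (use K r j in auto)
    show "poly_fun j (\<lambda>s. star_gauge K (p + s *\<^sub>R v) ^ j + (- star_gauge K (- (p + s *\<^sub>R v))) ^ j)"
    proof (rule power_sums_poly_fun)
      fix e :: nat assume "even (e + j)"
      then show "\<exists>d::nat \<Rightarrow> real. \<forall>y. norm y = 1 \<longrightarrow> ridge_moment e y = (\<Sum>i | i \<le> j \<and> even (i + j). d i * ridge_moment i y)"
      proof (rule finite_span_elimination[rotated 2])
        show "ridge_moment i (- y) = (- 1) ^ i * ridge_moment i y" for i y
          by (rule ridge_moment_minus)
        fix e assume e: "j < e" "even (e + j)"
        \<comment> \<open>The index \<open>b = j + m\<close> is kept while \<open>e\<close> varies: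
          \<open>b < e + m\<close> amounts to \<open>j < e\<close>, and \<open>b\<close> has the
          parity of \<open>j\<close> because \<open>m\<close> is even.\<close>
        define c where "c i = coeff (ridge_poly m Z e (j + m)) i" for i
        have "c e \<noteq> 0"
          unfolding c_def using e j assms(1) by (intro lead_coeff_ridge_poly Zeven) auto
        moreover have "(\<Sum>i\<le>e. c i * ridge_moment i y) = 0" if y: "norm y = 1" for y
        proof -
          \<comment> \<open>As \<open>k + m + 1 = n\<close>, the exponent of the weight does not
            depend on \<open>m\<close>: the relations for all \<open>e\<close> concern the same
            moments.\<close>
          have kb: "k + (j + m) + 1 = CARD('n) + j" using km n2 by linarith
          have int: "integrable lborel (\<lambda>x. indicator (K - cball 0 r) x * ((1 / norm x) ^ (CARD('n) + j) * (sgn x \<bullet> y) ^ i))" for i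
            by (rule shell_integrable[where w = "\<lambda>v. (v \<bullet> y) ^ i" and B = "norm y ^ i"])
               (measurable, rule inner_power_bound)
          have "(\<Sum>i\<le>e. c i * ridge_moment i y)
            = (\<integral>x. (\<Sum>i\<le>e. c i * (indicator (K - cball 0 r) x * ((1 / norm x) ^ (CARD('n) + j) * (sgn x \<bullet> y) ^ i))) \<partial>lborel)"
            unfolding ridge_moment_def shell_moment_def
            using int by (subst Bochner_Integration.integral_sum) auto
          also have "\<dots> = (\<integral>x. indicator (K - cball 0 r) x * ((1 / norm x) ^ (k + (j + m) + 1) * poly (ridge_poly m Z e (j + m)) (sgn x \<bullet> y)) \<partial>lborel)"
          proof (rule Bochner_Integration.integral_cong[OF refl], goal_cases)
            case (1 x)
            have "poly (ridge_poly m Z e (j + m)) (sgn x \<bullet> y) = (\<Sum>i\<le>e. c i * (sgn x \<bullet> y) ^ i)"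
              unfolding poly_altdef c_def using degree_ridge_poly[of m Z e "j + m"]
              by (intro sum.mono_neutral_left) (auto simp: coeff_eq_0)
            then show ?case
              unfolding kb by (simp only: sum_distrib_left mult_ac)
          qed
          also have "\<dots> = 0"
            using jN e(1) by (intro ridge_integral_eq_0[OF km m n2 assms(1) Z Zodd Zeven K r y a DS]) auto
          finally show ?thesis .
        qed
        ultimately show "\<exists>c::nat \<Rightarrow> real. c e \<noteq> 0 \<and> (\<forall>y. norm y = 1 \<longrightarrow> (\<Sum>i\<le>e. c i * ridge_moment i y) = 0)"
          by blast
      qed
    qed
  qed
  moreover have "{x. star_gauge K x \<le> 1} = K" using star_gauge_le1[OF K assms(5)] by auto
  ultimately show ?thesis by simp
qed

end
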